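(* Let $n>0$, let $(X,\mu)$ be an $n$-regular space, let $1\le s<2<q<\infty$, $p\in(s,q)$, and let $\{T(z)\}_{z\in U}$ be a family of bounded operators on $L^2(X)$ that satisfies $L^s\to L^q$ off-diagonal estimates of order $\gamma>\frac ns$, where $U\subseteq\mathbb{C}\setminus\{0\}$ is some index set. Then $\{T(z)\}_{z\in U}$ satisfies square function estimates on $L^p$.
   Context: A metric space $X$ with a Borel measure $\mu$ is called $n$-regular ($n>0$ a real number) if $\mu(B(x,r))\approx(r\wedge\operatorname{diam}(X))^n$ for all $x\in X$ and $r>0$, with implicit constants independent of $x,r$. Here $\operatorname{diam}(X)\in(0,\infty]$ and $a\wedge b=\min(a,b)$. Off-diagonal estimates: the family $\{T(z)\}_{z\in U}$ satisfies $L^s\to L^q$ off-diagonal estimates of order $\gamma\ge0$ if there is a constant $C$ such that for all $z\in U$, $f\in L^s(X)\cap L^2(X)$ and measurable sets $E,F\subseteq X$, $$\|\mathbf 1_FT(z)\mathbf 1_Ef\|_q\le C(|z|\wedge\operatorname{diam}(X))^{\frac nq-\frac ns}\Bigl(1+\frac{d(E,F)}{|z|}\Bigr)^{-\gamma}\|\mathbf 1_Ef\|_s,$$ where $d(E,F)$ is the distance between $E$ and $F$. Square function estimates: the family $\{T(z)\}_{z\in U}$ satisfies square function estimates on $L^p$ if there is a constant $C$ such that for all $k\ge1$, all $z_1,\dots,z_k\in U$ and all $f_1,\dots,f_k\in L^p(X)\cap L^2(X)$, $$\Bigl\|\Bigl(\sum_{j=1}^k|T(z_j)f_j|^2\Bigr)^{1/2}\Bigr\|_p\le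 C\,\Bigl\|\Bigl(\sum_{j=1}^k|f_j|^2\Bigr)^{1/2}\Bigr\|_p.$$ *)

theory Defs
  imports "HOL-Analysis.Analysis"
begin

section \<open>Regular metric measure spaces\<close>

text \<open>The library's \<open>diameter\<close> is a real number and carries no information on unbounded
  sets, so the diameter with values in \<open>[0, \<infinity>]\<close> is defined here.\<close>

definition ediameter :: "'a::metric_space set \<Rightarrow> ennreal" where
  "ediameter X = (SUP x\<in>X. SUP y\<in>X. ennreal (dist x y))"

definition diam_cap :: "'a::metric_space set \<Rightarrow> real \<Rightarrow> real" where
  "diam_cap X r = enn2real (min (ennreal r) (ediameter X))"

text \<open>The metric space is the whole type (\<open>space M = UNIV\<close> follows from the first conjunct). The
  second conjunct is the convention \<open>diam X \<in> (0, \<infinity>]\<close>.\<close>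

definition n_regular :: "real \<Rightarrow> 'a::metric_space measure \<Rightarrow> bool" where
  "n_regular n M \<longleftrightarrow>
     sets M = sets borel \<and> 0 < ediameter (space M) \<and>
     (\<exists>c C::real. 0 < c \<and> 0 < C \<and>
        (\<forall>x\<in>space M. \<forall>r>0.
           ennreal (c * diam_cap (space M) r powr n) \<le> emeasure M (ball x r) \<and>
           emeasure M (ball x r) \<le> ennreal (C * diam_cap (space M) r powr n)))"


section \<open>Lebesgue spaces for finite exponents\<close>

text \<open>Elements of \<open>L\<^sup>p\<close> are handled through representatives. The norm takes values in
  \<open>[0, \<infinity>]\<close>, so that an inequality \<open>Lp_norm p M g \<le> a\<close> with finite \<open>a\<close> includes the claim
  that the norm of \<open>g\<close> is finite.\<close>

definition Lp_norm :: "real \<Rightarrow> 'a measure \<Rightarrow> ('a \<Rightarrow> 'b::real_normed_vector) \<Rightarrow> ennreal" where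
  "Lp_norm p M f =
     (let I = \<integral>\<^sup>+ x. ennreal (norm (f x) powr p) \<partial>M
      in if I = \<infinity> then \<infinity> else ennreal (enn2real I powr (1 / p)))"

definition Lp_space :: "real \<Rightarrow> 'a measure \<Rightarrow> ('a \<Rightarrow> complex) set" where
  "Lp_space p M = {f \<in> borel_measurable M. Lp_norm p M f < \<infinity>}"


section \<open>Operator families\<close>

text \<open>A bounded (complex-linear) operator on \<open>L\<^sup>2\<close>, acting on representatives: the second conjunct
  says that it descends to classes modulo almost everywhere equality.\<close>

definition bounded_L2_operator ::
    "'a measure \<Rightarrow> (('a \<Rightarrow> complex) \<Rightarrow> ('a \<Rightarrow> complex)) \<Rightarrow> bool" where
  "bounded_L2_operator M S \<longleftrightarrow>
     (\<forall>f\<in>Lp_space 2 M. S f \<in> Lp_space 2 M) \<and>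
     (\<forall>f\<in>Lp_space 2 M. \<forall>g\<in>Lp_space 2 M. (AE x in M. f x = g x) \<longrightarrow> (AE x in M. S f x = S g x)) \<and>
     (\<forall>f\<in>Lp_space 2 M. \<forall>g\<in>Lp_space 2 M. AE x in M. S (\<lambda>y. f y + g y) x = S f x + S g x) \<and>
     (\<forall>a. \<forall>f\<in>Lp_space 2 M. AE x in M. S (\<lambda>y. a * f y) x = a * S f x) \<and>
     (\<exists>C::real. \<forall>f\<in>Lp_space 2 M. Lp_norm 2 M (S f) \<le> ennreal C * Lp_norm 2 M f)"

text \<open>If \<open>E\<close> or \<open>F\<close> is empty then \<open>setdist E F = 0\<close> instead of \<open>\<infinity>\<close>; this is immaterial, as
  the left-hand side of the estimate then vanishes.\<close>

definition off_diagonal_estimates ::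
    "real \<Rightarrow> 'a::metric_space measure \<Rightarrow> real \<Rightarrow> real \<Rightarrow> real \<Rightarrow> complex set \<Rightarrow>
     (complex \<Rightarrow> ('a \<Rightarrow> complex) \<Rightarrow> ('a \<Rightarrow> complex)) \<Rightarrow> bool" where
  "off_diagonal_estimates n M s q \<gamma> U T \<longleftrightarrow>
     0 \<le> \<gamma> \<and>
     (\<exists>C::real. 0 \<le> C \<and>
        (\<forall>z\<in>U. \<forall>f\<in>Lp_space s M \<inter> Lp_space 2 M. \<forall>E\<in>sets M. \<forall>F\<in>sets M.
           Lp_norm q M (\<lambda>x. indicator F x * T z (\<lambda>y. indicator E y * f y) x) \<le>
           ennreal (C * diam_cap (space M) (cmod z) powr (n / q - n / s)
                      * (1 + setdist E F / cmod z) powr (- \<gamma>))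
           * Lp_norm s M (\<lambda>y. indicator E y * f y)))"

definition square_function_estimates ::
    "'a measure \<Rightarrow> real \<Rightarrow> complex set \<Rightarrow>
     (complex \<Rightarrow> ('a \<Rightarrow> complex) \<Rightarrow> ('a \<Rightarrow> complex)) \<Rightarrow> bool" where
  "square_function_estimates M p U T \<longleftrightarrow>
     (\<exists>C::real. 0 \<le> C \<and>
        (\<forall>k::nat. \<forall>z :: nat \<Rightarrow> complex. \<forall>f :: nat \<Rightarrow> 'a \<Rightarrow> complex.
           1 \<le> k \<longrightarrow> (\<forall>j\<in>{1..k}. z j \<in> U \<and> f j \<in> Lp_space p M \<inter> Lp_space 2 M) \<longrightarrow>
           Lp_norm p M (\<lambda>x. sqrt (\<Sum>j=1..k. (cmod (T (z j) (f j) x))\<^sup>2)) \<le>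
           ennreal C * Lp_norm p M (\<lambda>x. sqrt (\<Sum>j=1..k. (cmod (f j x))\<^sup>2))))"

end

theory Submission
  imports Defs
begin

text \<open>
  Put \<open>r = |z|\<close> and let \<open>v r\<close> be the capped radius to the power \<open>n\<close>, so that every ball of
  radius \<open>r\<close> has measure comparable to \<open>v r\<close>. Cutting \<open>f\<close> along the dyadic annuli
  around a ball \<open>B(x, r)\<close> and summing the off-diagonal estimates turns them into a pointwise
  comparison of averages (\<open>off_diagonal_imp_locally_dominated\<close>): the \<open>L\<^sup>q\<close> average of
  \<open>T(z) f\<close> on \<open>B(x, r)\<close> is at most a sum over \<open>k\<close> of
  \<open>2^(k (n/s - \<gamma>))\<close>, up to an arbitrarily small loss in the exponent,
  times the \<open>L\<^sup>s\<close> average of \<open>f\<close> on the ball with \<open>2\<^sup>k\<close> times the radius. The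
  hypothesis \<open>\<gamma> > n/s\<close> makes this series converge. From here on the argument concerns pairs
  of functions that are related by such a comparison.

  The comparison self-improves to weighted \<open>L\<^sup>2\<close> inequalities with constants that do not
  depend on \<open>z\<close>. Let \<open>M\<close> be the Hardy-Littlewood maximal operator, and write
  \<open>g = |T(z) f|\<close>. For every weight \<open>w\<close>,
  \<^item> \<open>\<integral> g\<^sup>2 w \<le> C \<integral> |f|\<^sup>2 V\<close> with \<open>V = M(M(w^t)^(1/t))\<close>, where
    \<open>t = q/(q-2)\<close> is conjugate to \<open>q/2\<close> (\<open>weighted_large_exponent\<close>);
  \<^item> \<open>\<integral> g\<^sup>2/W \<le> C \<integral> |f|\<^sup>2/w\<close> with \<open>W = M(w^t)^(1/t)\<close>, where
    \<open>t = s/(2-s)\<close> is the exponent that comes from comparing \<open>L\<^sup>s\<close> with weighted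
    \<open>L\<^sup>2\<close> averages (\<open>weighted_small_exponent\<close>).

  Weighted \<open>L\<^sup>2\<close> inequalities with one and the same weight can be added up, so they hold for the
  square functions \<open>G = \<Sum> |T(z\<^sub>j) f\<^sub>j|\<^sup>2\<close> and \<open>F = \<Sum> |f\<^sub>j|\<^sup>2\<close> in place of
  \<open>g\<^sup>2\<close> and \<open>|f|\<^sup>2\<close>. The integral of \<open>G^(p/2)\<close> is recovered by a suitable choice of \<open>w\<close>:
  for \<open>p > 2\<close> by duality, with \<open>w = G^(p/2 - 1)\<close>, suitably truncated;
  for \<open>p < 2\<close> by the reversed duality, with \<open>w = F^(1 - p/2)\<close>;
  for \<open>p = 2\<close> with \<open>w = 1\<close>. The maximal theorem (\<open>maximal_function_strong_type\<close>)
  controls the norms of \<open>V\<close> and \<open>W\<close>, and the conditions for it to apply to the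
  exponents that occur are exactly \<open>p < q\<close> in the first case and \<open>p > s\<close> in the second.

  All integrals are taken over functions with values in \<open>[0, \<infinity>]\<close>, so that finiteness
  has to be discussed only where a quantity is divided out. Averages over all balls of radius \<open>r\<close> are
  replaced by sums over a countable net, so that no product measure on \<open>X \<times> X\<close> enters.
\<close>

section \<open>Powers and Hoelder's inequality on the extended half line\<close>

definition epow :: "ennreal \<Rightarrow> real \<Rightarrow> ennreal" where
  "epow x a = (if x = top then top else ennreal (enn2real x powr a))"

lemma epow_ennreal: "0 \<le> r \<Longrightarrow> epow (ennreal r) a = ennreal (r powr a)"
  by (simp add: epow_def)

lemma epow_top [simp]: "epow top a = top"
  by (simp add: epow_def)

lemma epow_0 [simp]: "epow 0 a = 0"
  by (simp add: epow_def)

lemma epow_1 [simp]: "epow 1 a = 1"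
  by (simp add: epow_def)

lemma epow_eq_top_iff [simp]: "epow x a = top \<longleftrightarrow> x = top"
  by (simp add: epow_def)

lemma epow_less_top_iff [simp]: "epow x a < top \<longleftrightarrow> x < top"
  by (simp add: epow_def less_top[symmetric])

lemma epow_eq_0_iff [simp]: "epow x a = 0 \<longleftrightarrow> x = 0"
  by (cases x) (auto simp: epow_def)

lemma epow_measurable [measurable]:
  assumes [measurable]: "f \<in> borel_measurable M"
  shows "(\<lambda>x. epow (f x) a) \<in> borel_measurable M"
  unfolding epow_def by measurable

lemma epow_mono: "x \<le> y \<Longrightarrow> 0 \<le> a \<Longrightarrow> epow x a \<le> epow y a"
  by (cases x; cases y) (simp_all add: epow_ennreal top_unique powr_mono2)

lemma epow_mult: "epow (x * y) a = epow x a * epow y a"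
proof -
  consider "x = 0 \<or> y = 0" | "x = top" "y \<noteq> 0" | "y = top" "x \<noteq> 0"
    | "x \<noteq> top" "y \<noteq> top" by blast
  then show ?thesis
  proof cases
    case 4
    then obtain r s where "x = ennreal r" "y = ennreal s" "0 \<le> r" "0 \<le> s"
      by (metis ennreal_cases)
    then show ?thesis
      by (simp add: epow_ennreal ennreal_mult[symmetric] powr_mult)
  qed (auto simp: ennreal_top_mult ennreal_mult_top)
qed

lemma epow_epow: "epow (epow x a) b = epow x (a * b)"
  by (cases x) (auto simp: epow_ennreal powr_powr)

lemma epow_one [simp]: "epow x 1 = x"
  by (cases x) (auto simp: epow_ennreal)

lemma epow_add: "epow x a * epow x b = epow x (a + b)"
  by (cases x) (auto simp: epow_ennreal ennreal_mult[symmetric] powr_add ennreal_top_mult)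

lemma epow_sum_split: "a + b = 1 \<Longrightarrow> epow x a * epow x b = x"
  by (simp add: epow_add)

lemma epow_2: "epow x 2 = x\<^sup>2"
  by (metis epow_add epow_one one_add_one power2_eq_square)

lemma epow_le_cancel: 
  assumes "epow x a \<le> y" "0 < a"
  shows "x \<le> epow y (1 / a)"
  using epow_mono[OF assms(1), of "1 / a"] assms(2) by (simp add: epow_epow)

lemma epow_Young:
  assumes "0 < \<theta>" "\<theta> < 1"
  shows "epow u \<theta> * epow w (1 - \<theta>) \<le> ennreal \<theta> * u + ennreal (1 - \<theta>) * w"
proof -
  consider "u = 0 \<or> w = 0" | "u = top" | "w = top"
    | "u \<noteq> top" "w \<noteq> top" "u \<noteq> 0" "w \<noteq> 0" by blast
  then show ?thesis
  proof cases
    case 4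
    then obtain r s where rs: "u = ennreal r" "w = ennreal s" "0 < r" "0 < s"
      by (metis ennreal_cases ennreal_0 order_le_less)
    have "r powr \<theta> * s powr (1 - \<theta>) \<le> \<theta> * r + (1 - \<theta>) * s"
      using Youngs_inequality_0[of \<theta> "1 - \<theta>" r s] assms rs by simp
    then show ?thesis
      using rs assms by (simp add: epow_ennreal ennreal_mult[symmetric] ennreal_plus[symmetric] del: ennreal_plus)
  qed (use assms in \<open>auto simp: ennreal_mult_top\<close>)
qed

lemma ennreal_mult_divide_cancel: "0 < a \<Longrightarrow> ennreal a * (x / ennreal a) = x"
  by (metis ennreal_eq_0_iff ennreal_neq_top ennreal_times_divide linorder_not_less
      mult.commute mult_divide_eq_ennreal)

text \<open>After normalising both integrals to 1 this is the pointwise Young inequality; the cases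
  in which an integral is 0 or infinite are absorbed by \<open>0 \<cdot> \<infinity> = 0\<close>.\<close>

theorem nn_integral_Hoelder:
  assumes [measurable]: "f \<in> borel_measurable M" "g \<in> borel_measurable M"
    and \<theta>: "0 < \<theta>" "\<theta> < 1"
  shows "(\<integral>\<^sup>+x. epow (f x) \<theta> * epow (g x) (1 - \<theta>) \<partial>M)
           \<le> epow (\<integral>\<^sup>+x. f x \<partial>M) \<theta> * epow (\<integral>\<^sup>+x. g x \<partial>M) (1 - \<theta>)"
proof -
  let ?I = "\<integral>\<^sup>+x. f x \<partial>M" and ?J = "\<integral>\<^sup>+x. g x \<partial>M"
  consider "?I = 0 \<or> ?J = 0" | "?I = top" "?J \<noteq> 0" | "?J = top" "?I \<noteq> 0"
    | "?I \<noteq> top" "?J \<noteq> top" "?I \<noteq> 0" "?J \<noteq> 0" by blast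
  then show ?thesis
  proof cases
    case 1
    then have "AE x in M. f x = 0 \<or> g x = 0"
      by (auto simp: nn_integral_0_iff_AE elim: eventually_mono)
    then have "AE x in M. epow (f x) \<theta> * epow (g x) (1 - \<theta>) = 0"
      by eventually_elim auto
    then have "(\<integral>\<^sup>+x. epow (f x) \<theta> * epow (g x) (1 - \<theta>) \<partial>M) = 0"
      by (simp add: nn_integral_0_iff_AE)
    then show ?thesis by (simp only: zero_le)
  next
    case 4
    then obtain a b where ab: "?I = ennreal a" "?J = ennreal b" "0 < a" "0 < b"
      by (metis ennreal_cases ennreal_0 order_le_less)
    let ?c = "a powr \<theta> * b powr (1 - \<theta>)"
    have split: "epow (f x) \<theta> * epow (g x) (1 - \<theta>)
        = ennreal ?c * (epow (f x / ennreal a) \<theta> * epow (g x / ennreal b) (1 - \<theta>))" for x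
    proof -
      have "f x = ennreal a * (f x / ennreal a)" "g x = ennreal b * (g x / ennreal b)"
        using ab by (simp_all only: ennreal_mult_divide_cancel)
      then have "epow (f x) \<theta> * epow (g x) (1 - \<theta>)
         = epow (ennreal a * (f x / ennreal a)) \<theta> * epow (ennreal b * (g x / ennreal b)) (1 - \<theta>)"
        by simp
      also have "\<dots> = ennreal ?c * (epow (f x / ennreal a) \<theta> * epow (g x / ennreal b) (1 - \<theta>))"
        unfolding epow_mult using ab by (simp add: epow_ennreal ennreal_mult mult_ac)
      finally show ?thesis .
    qed
    have "(\<integral>\<^sup>+x. epow (f x) \<theta> * epow (g x) (1 - \<theta>) \<partial>M)
        = ennreal ?c * (\<integral>\<^sup>+x. epow (f x / ennreal a) \<theta> * epow (g x / ennreal b) (1 - \<theta>) \<partial>M)"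
      unfolding split by (rule nn_integral_cmult) measurable
    also have "\<dots> \<le> ennreal ?c * (\<integral>\<^sup>+x. ennreal \<theta> * (f x / ennreal a) + ennreal (1 - \<theta>) * (g x / ennreal b) \<partial>M)"
      by (intro mult_left_mono nn_integral_mono epow_Young \<theta>) simp
    also have "(\<integral>\<^sup>+x. ennreal \<theta> * (f x / ennreal a) + ennreal (1 - \<theta>) * (g x / ennreal b) \<partial>M)
        = ennreal \<theta> * (?I / ennreal a) + ennreal (1 - \<theta>) * (?J / ennreal b)"
      by (simp add: nn_integral_add nn_integral_cmult nn_integral_divide)
    also have "\<dots> = 1"
      using ab \<theta> by (simp add: divide_ennreal ennreal_plus[symmetric] del: ennreal_plus)
    finally show ?thesis
      using ab by (simp add: epow_ennreal ennreal_mult)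
  qed (use \<theta> in \<open>auto simp: ennreal_top_mult ennreal_mult_top\<close>)
qed

lemma sum_Hoelder_epow:
  assumes "finite A" "0 < \<theta>" "\<theta> < 1"
  shows "(\<Sum>k\<in>A. epow (f k) \<theta> * epow (g k) (1 - \<theta>))
           \<le> epow (\<Sum>k\<in>A. f k) \<theta> * epow (\<Sum>k\<in>A. g k) (1 - \<theta>)"
  using nn_integral_Hoelder[of f "count_space A" g \<theta>] assms
  by (simp add: nn_integral_count_space_finite)

text \<open>Write \<open>(x + y)^\<theta> = x (x + y)^(\<theta> - 1) + y (x + y)^(\<theta> - 1)\<close> and use \<open>u (x + y)^(\<theta> - 1) \<le> u^\<theta>\<close> for \<open>u = x\<close>
  and for \<open>u = y\<close>, because the exponent \<open>\<theta> - 1\<close> is not positive.\<close>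

lemma epow_add_le:
  assumes "0 < \<theta>" "\<theta> \<le> 1"
  shows "epow (x + y) \<theta> \<le> epow x \<theta> + epow y \<theta>"
proof (cases "x + y = 0 \<or> x + y = top \<or> \<theta> = 1")
  case True then show ?thesis by auto
next
  case False
  then have \<theta>: "\<theta> < 1" using assms by auto
  have *: "u * epow (x + y) (\<theta> - 1) \<le> epow u \<theta>" if le: "u \<le> x + y" for u
  proof (cases "u = 0")
    case False2: False
    have "x + y < top" using False by (simp add: less_top)
    then obtain s where s: "x + y = ennreal s" "0 \<le> s"
      by (auto simp: less_top_ennreal)
    then obtain r where r: "u = ennreal r" "0 \<le> r" "r \<le> s"
      using le unfolding s(1) le_ennreal_iff[OF s(2)] by auto
    then have "0 < r" using False2 by (cases "r = 0") auto
    note rs = s r this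
    have "r * s powr (\<theta> - 1) \<le> r * r powr (\<theta> - 1)"
      using rs \<theta> by (intro mult_left_mono powr_mono2') auto
    also have "\<dots> = r powr \<theta>"
      using rs by (simp add: powr_diff)
    finally show ?thesis
      using rs by (simp add: epow_ennreal ennreal_mult[symmetric])
  qed auto
  have "epow (x + y) \<theta> = (x + y) * epow (x + y) (\<theta> - 1)"
    using epow_add[of "x + y" 1 "\<theta> - 1"] by simp
  also have "\<dots> = x * epow (x + y) (\<theta> - 1) + y * epow (x + y) (\<theta> - 1)"
    by (simp add: distrib_right)
  also have "\<dots> \<le> epow x \<theta> + epow y \<theta>"
    by (intro add_mono *) auto
  finally show ?thesis .
qed

lemma epow_sum_le:
  assumes "0 < \<theta>" "\<theta> \<le> 1"
  shows "epow (\<Sum>k\<in>A. f k) \<theta> \<le> (\<Sum>k\<in>A. epow (f k) \<theta>)"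
proof (induction A rule: infinite_finite_induct)
  case (insert a A)
  then show ?case
    using epow_add_le[OF assms, of "f a" "sum f A"] by (simp add: order_trans add_left_mono)
qed auto

section \<open>Selection of disjoint balls\<close>

lemma finite_disjoint_family_mass_bounded_below:
  assumes "\<And>i. i \<in> A \<Longrightarrow> S i \<in> sets N" and "disjoint_family_on S A"
    and "\<And>i. i \<in> A \<Longrightarrow> c \<le> emeasure N (S i)" and "0 < c"
    and "\<And>i. i \<in> A \<Longrightarrow> S i \<subseteq> B" and "B \<in> sets N" and "emeasure N B < \<infinity>"
  shows "finite A"
proof (rule ccontr)
  assume "infinite A"
  have "of_nat m * c \<le> emeasure N B" for m
  proof -
    obtain A' where A': "A' \<subseteq> A" "finite A'" "card A' = m"
      using \<open>infinite A\<close> infinite_arbitrarily_large by metis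
    have "of_nat m * c = (\<Sum>i\<in>A'. c)" using A' by simp
    also have "\<dots> \<le> (\<Sum>i\<in>A'. emeasure N (S i))"
      using A' assms by (intro sum_mono) auto
    also have "\<dots> = emeasure N (\<Union>i\<in>A'. S i)"
      using A' assms by (intro sum_emeasure) (auto intro: disjoint_family_on_mono)
    also have "\<dots> \<le> emeasure N B"
    proof (rule emeasure_mono)
      show "(\<Union>i\<in>A'. S i) \<subseteq> B" using A' assms(5) by (intro UN_least) auto
    qed fact
    finally show ?thesis .
  qed
  then have "(SUP m. of_nat m) * c \<le> emeasure N B"
    by (auto simp: SUP_mult_right_ennreal intro: SUP_least)
  then show False
    using \<open>0 < c\<close> \<open>emeasure N B < \<infinity>\<close>
    by (cases "c = 0") (auto simp: ennreal_SUP_of_nat_eq_top top_unique)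
qed

lemma maximal_pairwise_subset:
  assumes "symp R"
  obtains A where "A \<subseteq> G" "pairwise R A" "\<And>x. x \<in> G - A \<Longrightarrow> \<exists>y\<in>A. \<not> R x y"
proof -
  let ?\<A> = "{A. A \<subseteq> G \<and> pairwise R A}"
  have "\<exists>M\<in>?\<A>. \<forall>X\<in>?\<A>. M \<subseteq> X \<longrightarrow> X = M"
  proof (rule subset_Zorn_nonempty)
    show "?\<A> \<noteq> {}" by (auto intro!: exI[of _ "{}"])
    fix \<C> assume "\<C> \<noteq> {}" and ch: "subset.chain ?\<A> \<C>"
    show "\<Union>\<C> \<in> ?\<A>"
    proof (clarsimp, intro conjI)
      show "\<Union>\<C> \<subseteq> G" using ch by (auto simp: subset.chain_def)
      show "pairwise R (\<Union>\<C>)"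
      proof (rule pairwiseI)
        fix x y assume xy: "x \<in> \<Union>\<C>" "y \<in> \<Union>\<C>" "x \<noteq> y"
        then obtain X Y where XY: "X \<in> \<C>" "Y \<in> \<C>" "x \<in> X" "y \<in> Y" by auto
        then have "X \<subseteq> Y \<or> Y \<subseteq> X"
          using ch unfolding subset.chain_def psubset_eq by blast
        moreover have "pairwise R X" "pairwise R Y"
          using ch XY by (auto simp: subset.chain_def)
        ultimately show "R x y"
          using XY xy by (auto simp: pairwise_def)
      qed
    qed
  qed
  then obtain A where A: "A \<subseteq> G" "pairwise R A"
    and max: "\<And>X. X \<subseteq> G \<Longrightarrow> pairwise R X \<Longrightarrow> A \<subseteq> X \<Longrightarrow> X = A" by auto
  show ?thesis
  proof (rule that[OF A])
    fix x assume x: "x \<in> G - A"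
    then have "\<not> pairwise R (insert x A)"
      using max[of "insert x A"] A by auto
    then show "\<exists>y\<in>A. \<not> R x y"
      using A(2) \<open>symp R\<close> by (auto simp: pairwise_insert dest: sympD)
  qed
qed

text \<open>Going from the largest radius to the smallest, a maximal family of disjoint balls that avoid the
  balls chosen so far is added for each radius. A ball thus meets a selected one that is at
  least as large, and doubling the selected balls covers all centres.\<close>

lemma Vitali_finitely_many_radii:
  fixes G :: "('a::metric_space \<times> real) set"
  assumes "finite Rs" and "G \<subseteq> UNIV \<times> Rs" and "\<And>R. R \<in> Rs \<Longrightarrow> 0 < R"
  shows "\<exists>A\<subseteq>G. disjoint_family_on (\<lambda>(y, R). ball y R) A \<and>
           (\<forall>(x, R)\<in>G. \<exists>(y, R')\<in>A. R \<le> R' \<and> ball x R \<inter> ball y R' \<noteq> {})"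
  using assms
proof (induction Rs arbitrary: G rule: finite_linorder_min_induct)
  case empty
  then show ?case by (auto simp: disjoint_family_on_def)
next
  case (insert b Rs)
  let ?B = "\<lambda>(y::'a, R). ball y R"
  define G' where "G' = {p \<in> G. snd p \<in> Rs}"
  obtain A where A: "A \<subseteq> G'" "disjoint_family_on ?B A"
    "\<forall>(x, R)\<in>G'. \<exists>(y, R')\<in>A. R \<le> R' \<and> ball x R \<inter> ball y R' \<noteq> {}"
    using insert.IH[of G'] insert.prems by (force simp: G'_def)
  define H where "H = {p \<in> G. snd p = b \<and> (\<forall>q\<in>A. ?B p \<inter> ?B q = {})}"
  obtain D where D: "D \<subseteq> H" "pairwise (\<lambda>p q. ?B p \<inter> ?B q = {}) D"
    "\<And>x. x \<in> H - D \<Longrightarrow> \<exists>y\<in>D. ?B x \<inter> ?B y \<noteq> {}"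
    using maximal_pairwise_subset[of "\<lambda>p q. ?B p \<inter> ?B q = {}" H]
    by (auto simp: symp_def Int_commute)
  show ?case
  proof (intro exI[of _ "A \<union> D"] conjI)
    show "A \<union> D \<subseteq> G" using A D by (auto simp: G'_def H_def)
    show "disjoint_family_on ?B (A \<union> D)"
      unfolding disjoint_family_on_def
    proof (intro ballI impI)
      fix p q assume "p \<in> A \<union> D" "q \<in> A \<union> D" "p \<noteq> q"
      moreover have DA: "?B p \<inter> ?B q = {}" if "p \<in> D" "q \<in> A" for p q
        using D(1) that unfolding H_def by blast
      moreover have "?B p \<inter> ?B q = {}" if "p \<in> A" "q \<in> D" for p q
        using DA[OF that(2,1)] by (simp add: Int_commute)
      ultimately show "?B p \<inter> ?B q = {}"
        using A(2) D(2) unfolding disjoint_family_on_def pairwise_def by blast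
    qed
    show "\<forall>(x, R)\<in>G. \<exists>(y, R')\<in>A \<union> D. R \<le> R' \<and> ball x R \<inter> ball y R' \<noteq> {}"
    proof clarify
      fix x R assume xR: "(x, R) \<in> G"
      then have R: "R = b \<or> R \<in> Rs" "0 < R" using insert.prems by auto
      have hit: "\<exists>p\<in>A \<union> D. R \<le> snd p \<and> ball x R \<inter> ?B p \<noteq> {}"
      proof (cases "R \<in> Rs")
        case True
        then have "(x, R) \<in> G'" using xR by (simp add: G'_def)
        from bspec[OF A(3) this] obtain y R' where
          "(y, R') \<in> A" "R \<le> R'" "ball x R \<inter> ball y R' \<noteq> {}" by blast
        then show ?thesis by (intro bexI[of _ "(y, R')"]) simp_all
      next
        case False
        then have R: "R = b" "0 < R" using R by auto
        show ?thesis
        proof (cases "(x, R) \<in> H")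
          case True
          show ?thesis
          proof (cases "(x, R) \<in> D")
            case True
            then show ?thesis using R by (intro bexI[of _ "(x, R)"]) auto
          next
            case False
            then obtain q where q: "q \<in> D" "?B (x, R) \<inter> ?B q \<noteq> {}"
              using D(3)[of "(x, R)"] \<open>(x, R) \<in> H\<close> by blast
            moreover have "snd q = b" using q D(1) by (auto simp: H_def)
            ultimately show ?thesis using R by (intro bexI[of _ q]) auto
          qed
        next
          case False
          then obtain q where q: "q \<in> A" "?B (x, R) \<inter> ?B q \<noteq> {}"
            using xR R by (auto simp: H_def)
          moreover have "snd q \<in> Rs" using q A(1) by (auto simp: G'_def)
          then have "b \<le> snd q" using insert.hyps by force
          ultimately show ?thesis using R by (intro bexI[of _ q]) auto
        qed
      qed
      then show "\<exists>(y, R')\<in>A \<union> D. R \<le> R' \<and> ball x R \<inter> ball y R' \<noteq> {}"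
        by force
    qed
  qed
qed

section \<open>Spaces whose balls have comparable measure\<close>

text \<open>Only two features of a regular space enter: the measure of a ball depends, up to constants, on
  its radius alone, and the gauge \<open>v\<close> grows at most like the power \<open>n\<close>. The truncation at the diameter is
  hidden in \<open>v\<close>, so bounded and unbounded spaces are treated alike.\<close>

locale regular_space =
  fixes M :: "'a::metric_space measure" and v :: "real \<Rightarrow> real" and n c C :: real
  assumes sets_M: "sets M = sets borel"
    and n_pos: "0 < n" and c_pos: "0 < c" and C_pos: "0 < C"
    and v_pos: "0 < r \<Longrightarrow> 0 < v r"
    and v_scale: "0 < r \<Longrightarrow> 1 \<le> L \<Longrightarrow> v (L * r) \<le> L powr n * v r"
    and ball_lower: "0 < r \<Longrightarrow> ennreal (c * v r) \<le> emeasure M (ball x r)"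
    and ball_upper: "0 < r \<Longrightarrow> emeasure M (ball x r) \<le> ennreal (C * v r)"
begin

lemma space_M [simp]: "space M = UNIV"
  using sets_eq_imp_space_eq[OF sets_M] by simp

lemma superlevel_in_sets_M:
  fixes f :: "'a \<Rightarrow> ennreal"
  assumes [measurable]: "f \<in> borel_measurable M"
  shows "{y. a < f y} \<in> sets M"
proof -
  have "{y \<in> space M. a < f y} \<in> sets M" by measurable
  then show ?thesis by simp
qed

lemma open_in_sets_M: "open S \<Longrightarrow> S \<in> sets M"
  by (simp add: sets_M)

lemma ball_in_sets_M [measurable]: "ball x r \<in> sets M"
  by (simp add: open_in_sets_M)

lemma emeasure_ball_finite: "emeasure M (ball x r) < top"
proof (cases "0 < r")
  case True
  then show ?thesis using ball_upper[OF True, of x] by (auto intro: le_less_trans)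
qed (auto simp: ball_empty)

lemma v_le_scale: "0 < r \<Longrightarrow> r \<le> R \<Longrightarrow> R \<le> L * r \<Longrightarrow> v R \<le> L powr n * v r"
proof -
  assume a: "0 < r" "r \<le> R" "R \<le> L * r"
  have "v (R / r * r) \<le> (R / r) powr n * v r"
    using a by (intro v_scale) auto
  also have "\<dots> \<le> L powr n * v r"
    using a n_pos v_pos[of r] by (intro mult_right_mono powr_mono2) (auto simp: field_simps)
  finally show ?thesis using a by simp
qed

sublocale sigma_finite_measure M
proof
  fix x :: 'a
  let ?\<A> = "range (\<lambda>k::nat. ball x (real k))"
  show "\<exists>A. countable A \<and> A \<subseteq> sets M \<and> \<Union> A = space M \<and> (\<forall>a\<in>A. emeasure M a \<noteq> \<infinity>)"
  proof (intro exI[of _ ?\<A>] conjI ballI)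
    show "\<Union> ?\<A> = space M"
      using reals_Archimedean2 by auto
    fix a assume "a \<in> ?\<A>"
    then show "emeasure M a \<noteq> \<infinity>"
      using emeasure_ball_finite by (auto simp: less_top[symmetric])
  qed auto
qed

lemma emeasure_density_ball:
  "h \<in> borel_measurable M \<Longrightarrow>
    emeasure (density M h) (ball y R) = (\<integral>\<^sup>+x\<in>ball y R. h x \<partial>M)"
  by (simp add: emeasure_density)

text \<open>A ball is exhausted by smaller concentric balls, and those remain inside it
  when the centre of the larger one moves slightly. Hence ball integrals are lower semicontinuous in the centre; this
  is what makes maximal functions measurable.\<close>

lemma open_superlevel_ball_integral:
  assumes [measurable]: "h \<in> borel_measurable M"
  shows "open {y. a < (\<integral>\<^sup>+x\<in>ball y R. h x \<partial>M)}"
proof -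
  let ?N = "density M h"
  have "open {y. a < emeasure ?N (ball y R)}"
  proof (rule openI)
    fix y assume "y \<in> {y. a < emeasure ?N (ball y R)}"
    moreover have "(\<Union>j. ball y (R - 1 / Suc j)) = ball y R"
    proof -
      have "\<exists>j. dist y z < R - 1 / Suc j" if z: "dist y z < R" for z
      proof -
        obtain j where "1 / Suc j < R - dist y z"
          using z nat_approx_posE[of "R - dist y z"] by auto
        then show ?thesis by (intro exI[of _ j]) linarith
      qed
      moreover have "ball y (R - 1 / Suc j) \<subseteq> ball y R" for j
        by (rule subset_ball) simp
      ultimately show ?thesis
        by (intro equalityI subsetI UN_least) (blast, simp)
    qed
    moreover have "(SUP j. emeasure ?N (ball y (R - 1 / Suc j))) = emeasure ?N (\<Union>j. ball y (R - 1 / Suc j))"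
      by (intro SUP_emeasure_incseq) (auto simp: incseq_def frac_le intro!: subset_ball frac_le)
    ultimately have "a < (SUP j. emeasure ?N (ball y (R - 1 / Suc j)))"
      by simp
    then obtain j where j: "a < emeasure ?N (ball y (R - 1 / Suc j))"
      unfolding less_SUP_iff by blast
    show "\<exists>e>0. ball y e \<subseteq> {y. a < emeasure ?N (ball y R)}"
    proof (intro exI[of _ "1 / Suc j"] conjI subsetI)
      fix y' assume "y' \<in> ball y (1 / Suc j)"
      then have y': "dist y y' < 1 / Suc j" by simp
      have "ball y (R - 1 / Suc j) \<subseteq> ball y' R"
      proof
        fix z assume "z \<in> ball y (R - 1 / Suc j)"
        then have "dist y z < R - 1 / Suc j" by simp
        with y' dist_triangle[of y' z y] show "z \<in> ball y' R"
          by (simp add: dist_commute)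
      qed
      then have "emeasure ?N (ball y (R - 1 / Suc j)) \<le> emeasure ?N (ball y' R)"
        by (intro emeasure_mono) auto
      with j show "y' \<in> {y. a < emeasure ?N (ball y R)}" by auto
    qed auto
  qed
  then show ?thesis by (simp add: emeasure_density_ball)
qed

lemma ball_integral_measurable [measurable]:
  assumes "h \<in> borel_measurable M"
  shows "(\<lambda>y. \<integral>\<^sup>+x\<in>ball y R. h x \<partial>M) \<in> borel_measurable M"
  using open_superlevel_ball_integral[OF assms]
  by (intro borel_measurableI_greater) (auto intro: open_in_sets_M)

text \<open>The supremum that defines the maximal function runs over rational radii, which keeps it countable; by the
  growth condition on \<open>v\<close> this costs only a factor \<open>2\<^sup>n\<close>.\<close>

definition radii :: "real set" where "radii = {R \<in> \<rat>. 0 < R}"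

lemma countable_radii: "countable radii"
  unfolding radii_def using countable_rat by (rule countable_subset[rotated]) auto

definition maximal_function :: "('a \<Rightarrow> ennreal) \<Rightarrow> 'a \<Rightarrow> ennreal" where
  "maximal_function h y = (SUP R\<in>radii. (\<integral>\<^sup>+x\<in>ball y R. h x \<partial>M) / ennreal (v R))"

lemma maximal_function_measurable [measurable]:
  assumes [measurable]: "h \<in> borel_measurable M"
  shows "maximal_function h \<in> borel_measurable M"
  unfolding maximal_function_def using countable_radii by measurable

lemma ball_integral_le_maximal_function:
  assumes "0 < R"
  shows "(\<integral>\<^sup>+x\<in>ball y R. h x \<partial>M) \<le> ennreal (2 powr n * v R) * maximal_function h y"
proof -
  obtain R' where R': "R' \<in> \<rat>" "R < R'" "R' < 2 * R"
    using Rats_dense_in_real[of R "2 * R"] assms by auto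
  then have rad: "R' \<in> radii" "0 < v R'" using assms by (auto simp: radii_def intro: v_pos)
  have "(\<integral>\<^sup>+x\<in>ball y R. h x \<partial>M) \<le> (\<integral>\<^sup>+x\<in>ball y R'. h x \<partial>M)"
    using R' by (intro nn_integral_mono mult_left_mono) (auto simp: indicator_def)
  also have "\<dots> = ennreal (v R') * ((\<integral>\<^sup>+x\<in>ball y R'. h x \<partial>M) / ennreal (v R'))"
    using rad by (simp add: ennreal_mult_divide_cancel)
  also have "\<dots> \<le> ennreal (2 powr n * v R) * maximal_function h y"
    unfolding maximal_function_def
    using R' rad assms by (intro mult_mono ennreal_leI v_le_scale SUP_upper) auto
  finally show ?thesis .
qed

end

section \<open>The Hardy-Littlewood maximal theorem\<close>

text \<open>The layer cake formula for a single number \<open>u\<close>; integrating it over the space and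
  exchanging the integrals gives the formula for functions.\<close>

lemma nn_integral_powr_below:
  assumes "0 < a"
  shows "(\<integral>\<^sup>+t. ennreal (t powr (a - 1)) * indicator {t. 0 < t \<and> ennreal t < u} t \<partial>lborel)
           = ennreal (1 / a) * epow u a"
proof -
  let ?I = "\<lambda>u. \<integral>\<^sup>+t. ennreal (t powr (a - 1)) * indicator {t. 0 < t \<and> ennreal t < u} t \<partial>lborel"
  have fin: "?I (ennreal r) = ennreal (r powr a / a)" if r: "0 \<le> r" for r
  proof -
    have "((\<lambda>t. t powr (a - 1)) has_integral (r powr a / a)) {0..r}"
      using has_integral_powr_from_0[of "a - 1" r] assms r by simp
    then have "(\<integral>\<^sup>+t. ennreal (t powr (a - 1)) * indicator {0..r} t \<partial>lborel) = ennreal (r powr a / a)"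
      using nn_integral_has_integral_lebesgue[of "{0..r}" "\<lambda>t. t powr (a - 1)" "r powr a / a"]
      by (simp add: nn_integral_completion ennreal_indicator[symmetric] ennreal_mult[symmetric] mult.commute)
    moreover have "?I (ennreal r) = (\<integral>\<^sup>+t. ennreal (t powr (a - 1)) * indicator {0..r} t \<partial>lborel)"
      using AE_lborel_singleton[of 0] AE_lborel_singleton[of r]
      by (intro nn_integral_cong_AE, eventually_elim) (auto simp: indicator_def ennreal_less_iff)
    ultimately show ?thesis by simp
  qed
  show ?thesis
  proof (cases u)
    case (real r)
    then show ?thesis
      using fin[of r] assms by (simp add: epow_ennreal ennreal_mult[symmetric])
  next
    case top
    have "of_nat m \<le> ?I top" for m
    proof -
      let ?r = "(a * real m) powr (1 / a)"
      have "of_nat m = ?I (ennreal ?r)"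
        using assms by (subst fin) (auto simp: powr_powr ennreal_of_nat_eq_real_of_nat)
      also have "\<dots> \<le> ?I top"
        by (intro nn_integral_mono mult_left_mono) (auto simp: indicator_def)
      finally show ?thesis .
    qed
    then have "(SUP m. of_nat m) \<le> ?I top" by (rule SUP_least)
    then have "?I top = top" unfolding ennreal_SUP_of_nat_eq_top top_unique .
    then show ?thesis using assms top by (simp add: ennreal_mult_top)
  qed
qed

context regular_space
begin

text \<open>The balls that witness a large average are thinned out to a disjoint family. This family is finite,
  as each of its members carries a fixed amount of the finite mass of \<open>h\<close>, and doubling its radii recovers the
  whole superlevel set.\<close>

lemma weak_type_finitely_many_radii:
  assumes [measurable]: "h \<in> borel_measurable M" and fin: "(\<integral>\<^sup>+x. h x \<partial>M) < top"
    and Rs: "finite Rs" "\<And>R. R \<in> Rs \<Longrightarrow> 0 < R" and "0 < \<tau>"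
  shows "ennreal \<tau> * emeasure M {y. \<exists>R\<in>Rs. ennreal (\<tau> * v R) < (\<integral>\<^sup>+x\<in>ball y R. h x \<partial>M)}
           \<le> ennreal (C * 2 powr n) * (\<integral>\<^sup>+x. h x \<partial>M)"
proof (cases "Rs = {}")
  case True
  then show ?thesis by simp
next
  case False
  let ?N = "density M h" and ?B = "\<lambda>(y::'a, R). ball y R"
  let ?E = "{y. \<exists>R\<in>Rs. ennreal (\<tau> * v R) < (\<integral>\<^sup>+x\<in>ball y R. h x \<partial>M)}"
  define G where "G = {(y, R). R \<in> Rs \<and> ennreal (\<tau> * v R) < emeasure ?N (ball y R)}"
  have "G \<subseteq> UNIV \<times> Rs" by (auto simp: G_def)
  from Vitali_finitely_many_radii[OF Rs(1) this Rs(2)]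
  obtain A where A: "A \<subseteq> G" "disjoint_family_on ?B A"
    "\<forall>(x, R)\<in>G. \<exists>(y, R')\<in>A. R \<le> R' \<and> ball x R \<inter> ball y R' \<noteq> {}"
    by auto
  have meas: "?B p \<in> sets M" for p by (cases p) simp
  have "finite A"
  proof (rule finite_disjoint_family_mass_bounded_below[of A ?B ?N "ennreal (\<tau> * Min (v ` Rs))" UNIV])
    fix p assume "p \<in> A"
    then obtain y R where p: "p = (y, R)" "R \<in> Rs" "ennreal (\<tau> * v R) < emeasure ?N (ball y R)"
      using A(1) by (auto simp: G_def)
    have "ennreal (\<tau> * Min (v ` Rs)) \<le> ennreal (\<tau> * v R)"
      using Rs(1) p(2) \<open>0 < \<tau>\<close> by (intro ennreal_leI mult_left_mono) auto
    with p show "ennreal (\<tau> * Min (v ` Rs)) \<le> emeasure ?N (?B p)" by simp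
  next
    have "0 < Min (v ` Rs)"
      using Rs False v_pos by (subst Min_gr_iff) auto
    then show "0 < ennreal (\<tau> * Min (v ` Rs))" using \<open>0 < \<tau>\<close> by simp
    show "emeasure ?N UNIV < \<infinity>" using fin sets.top[of M] by (simp add: emeasure_density)
    show "UNIV \<in> sets ?N" using sets.top[of M] by simp
  qed (use A(2) meas in auto)
  have cover: "?E \<subseteq> (\<Union>p\<in>A. ball (fst p) (2 * snd p))"
  proof
    fix x assume "x \<in> ?E"
    then obtain R where "R \<in> Rs" "ennreal (\<tau> * v R) < (\<integral>\<^sup>+z\<in>ball x R. h z \<partial>M)" by auto
    then have "(x, R) \<in> G" by (simp add: G_def emeasure_density_ball)
    from bspec[OF A(3) this] obtain y R' where
      yR: "(y, R') \<in> A" "R \<le> R'" "ball x R \<inter> ball y R' \<noteq> {}" by blast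
    then obtain z where "dist x z < R" "dist y z < R'" by auto
    then have "x \<in> ball y (2 * R')"
      using yR(2) dist_triangle[of y x z] by (simp add: dist_commute)
    with yR(1) show "x \<in> (\<Union>p\<in>A. ball (fst p) (2 * snd p))" by force
  qed
  have each: "ennreal \<tau> * emeasure M (ball (fst p) (2 * snd p))
      \<le> ennreal (C * 2 powr n) * emeasure ?N (?B p)" if pA: "p \<in> A" for p
  proof -
    obtain y R where p: "p = (y, R)" "R \<in> Rs" "ennreal (\<tau> * v R) < emeasure ?N (ball y R)"
      using A(1) pA by (auto simp: G_def)
    then have "0 < R" using Rs by auto
    have "ennreal \<tau> * emeasure M (ball y (2 * R)) \<le> ennreal \<tau> * ennreal (C * (2 powr n * v R))"
      using ball_upper[of "2 * R" y] v_scale[of R 2] \<open>0 < R\<close> C_pos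
      by (intro mult_left_mono order_trans[OF ball_upper] ennreal_leI) auto
    also have "\<dots> = ennreal (C * 2 powr n) * ennreal (\<tau> * v R)"
      using \<open>0 < \<tau>\<close> C_pos v_pos[OF \<open>0 < R\<close>] by (simp add: ennreal_mult[symmetric] mult_ac)
    also have "\<dots> \<le> ennreal (C * 2 powr n) * emeasure ?N (ball y R)"
      using p by (intro mult_left_mono) auto
    finally show ?thesis by (simp add: p)
  qed
  have "ennreal \<tau> * emeasure M ?E \<le> ennreal \<tau> * emeasure M (\<Union>p\<in>A. ball (fst p) (2 * snd p))"
    using cover \<open>finite A\<close> by (intro mult_left_mono emeasure_mono) auto
  also have "\<dots> \<le> ennreal \<tau> * (\<Sum>p\<in>A. emeasure M (ball (fst p) (2 * snd p)))"
    using \<open>finite A\<close> by (intro mult_left_mono emeasure_subadditive_finite) auto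
  also have "\<dots> \<le> (\<Sum>p\<in>A. ennreal (C * 2 powr n) * emeasure ?N (?B p))"
    unfolding sum_distrib_left by (intro sum_mono each)
  also have "\<dots> = ennreal (C * 2 powr n) * emeasure ?N (\<Union>p\<in>A. ?B p)"
    unfolding sum_distrib_left[symmetric]
    using \<open>finite A\<close> A(2) meas by (subst sum_emeasure) auto
  also have "\<dots> \<le> ennreal (C * 2 powr n) * emeasure ?N (space ?N)"
    by (intro mult_left_mono emeasure_space) auto
  also have "\<dots> = ennreal (C * 2 powr n) * (\<integral>\<^sup>+x. h x \<partial>M)"
    using sets.top[of M] by (simp add: emeasure_density)
  finally show ?thesis .
qed

lemma maximal_function_weak_type:
  assumes [measurable]: "h \<in> borel_measurable M" and "0 < \<tau>"
  shows "ennreal \<tau> * emeasure M {y. ennreal \<tau> < maximal_function h y}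
           \<le> ennreal (C * 2 powr n) * (\<integral>\<^sup>+x. h x \<partial>M)"
proof (cases "(\<integral>\<^sup>+x. h x \<partial>M) < top")
  case False
  then have "(\<integral>\<^sup>+x. h x \<partial>M) = top" by (simp add: less_top[symmetric])
  then show ?thesis using C_pos by (simp add: ennreal_mult_top)
next
  case True
  have ne: "radii \<noteq> {}" by (auto simp: radii_def intro!: exI[of _ 1])
  define e where "e = from_nat_into radii"
  have e: "e i \<in> radii" "0 < e i" for i
    using from_nat_into[OF ne, of i] by (auto simp: e_def radii_def)
  have range_e: "range e = radii"
    unfolding e_def using ne countable_radii by (rule range_from_nat_into)
  define E where "E N = {y. \<exists>R\<in>e ` {..N}. ennreal (\<tau> * v R) < (\<integral>\<^sup>+x\<in>ball y R. h x \<partial>M)}" for N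
  have openE: "open (E N)" for N
  proof -
    have "E N = (\<Union>i\<le>N. {y. ennreal (\<tau> * v (e i)) < (\<integral>\<^sup>+x\<in>ball y (e i). h x \<partial>M)})"
      by (auto simp: E_def)
    then show ?thesis
      by (simp only:) (intro open_UN ballI open_superlevel_ball_integral assms(1))
  qed
  have inc: "incseq E" unfolding incseq_def E_def by (auto intro: order_trans)
  have lt: "ennreal \<tau> < a / ennreal (v R) \<longleftrightarrow> ennreal (\<tau> * v R) < a" if "0 < R" for a R
  proof -
    have "ennreal \<tau> < a / ennreal (v R) \<longleftrightarrow> \<not> a / ennreal (v R) \<le> ennreal \<tau>" by auto
    also have "a / ennreal (v R) \<le> ennreal \<tau> \<longleftrightarrow> ennreal (v R) * (a / ennreal (v R)) \<le> ennreal (v R) * ennreal \<tau>"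
      using v_pos[OF that] by (subst ennreal_mult_le_mult_iff) auto
    also have "\<dots> \<longleftrightarrow> a \<le> ennreal (\<tau> * v R)"
      using v_pos[OF that] \<open>0 < \<tau>\<close>
      by (simp add: ennreal_mult_divide_cancel ennreal_mult[symmetric] mult.commute)
    finally show ?thesis by auto
  qed
  have "{y. ennreal \<tau> < maximal_function h y} = (\<Union>N. E N)"
    unfolding maximal_function_def less_SUP_iff range_e[symmetric] E_def
    using e(2) by (auto simp: lt intro: order_refl)
  then have "emeasure M {y. ennreal \<tau> < maximal_function h y} = (SUP N. emeasure M (E N))"
    using inc openE by (simp add: SUP_emeasure_incseq image_subset_iff open_in_sets_M)
  then have "ennreal \<tau> * emeasure M {y. ennreal \<tau> < maximal_function h y} = (SUP N. ennreal \<tau> * emeasure M (E N))"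
    by (simp add: SUP_mult_left_ennreal)
  also have "\<dots> \<le> ennreal (C * 2 powr n) * (\<integral>\<^sup>+x. h x \<partial>M)"
    unfolding E_def using e(2) \<open>0 < \<tau>\<close> True
    by (intro SUP_least weak_type_finitely_many_radii) auto
  finally show ?thesis .
qed

text \<open>The part of \<open>h\<close> below \<open>\<tau>/(2C)\<close> has averages at most \<open>\<tau>/2\<close>, because an
  average here is normalised by \<open>v\<close> and the measure of a ball is at most \<open>C v\<close>.\<close>

lemma maximal_function_truncation:
  assumes [measurable]: "h \<in> borel_measurable M" and "0 < \<tau>"
  defines "h' \<equiv> \<lambda>x. h x * indicator {x. ennreal (\<tau> / (2 * C)) < h x} x"
  shows "maximal_function h y \<le> maximal_function h' y + ennreal (\<tau> / 2)"
  unfolding maximal_function_def[of h]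
proof (rule SUP_least)
  fix R assume R: "R \<in> radii"
  then have "0 < R" by (simp add: radii_def)
  note vR = v_pos[OF this]
  have [measurable]: "h' \<in> borel_measurable M" unfolding h'_def by measurable
  have "(\<integral>\<^sup>+x\<in>ball y R. h x \<partial>M)
      \<le> (\<integral>\<^sup>+x. h' x * indicator (ball y R) x + ennreal (\<tau> / (2 * C)) * indicator (ball y R) x \<partial>M)"
    by (intro nn_integral_mono) (auto simp: h'_def indicator_def)
  also have "\<dots> = (\<integral>\<^sup>+x\<in>ball y R. h' x \<partial>M) + ennreal (\<tau> / (2 * C)) * emeasure M (ball y R)"
    by (simp add: nn_integral_add nn_integral_cmult)
  also have "\<dots> \<le> (\<integral>\<^sup>+x\<in>ball y R. h' x \<partial>M) + ennreal (\<tau> / (2 * C)) * ennreal (C * v R)"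
    by (intro add_left_mono mult_left_mono ball_upper \<open>0 < R\<close>) simp
  also have "ennreal (\<tau> / (2 * C)) * ennreal (C * v R) = ennreal (\<tau> / 2) * ennreal (v R)"
    using \<open>0 < \<tau>\<close> C_pos vR by (simp add: ennreal_mult[symmetric])
  finally have "(\<integral>\<^sup>+x\<in>ball y R. h x \<partial>M) / ennreal (v R)
      \<le> ((\<integral>\<^sup>+x\<in>ball y R. h' x \<partial>M) + ennreal (\<tau> / 2) * ennreal (v R)) / ennreal (v R)"
    by (rule divide_right_mono_ennreal)
  also have "\<dots> = (\<integral>\<^sup>+x\<in>ball y R. h' x \<partial>M) / ennreal (v R) + ennreal (\<tau> / 2)"
    using vR by (simp add: add_divide_distrib_ennreal mult_divide_eq_ennreal)
  also have "\<dots> \<le> maximal_function h' y + ennreal (\<tau> / 2)"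
    unfolding maximal_function_def using R by (intro add_right_mono SUP_upper)
  finally show "(\<integral>\<^sup>+x\<in>ball y R. h x \<partial>M) / ennreal (v R) \<le> maximal_function h' y + ennreal (\<tau> / 2)" .
qed

definition maximal_const :: "real \<Rightarrow> real" where
  "maximal_const a = 2 * a * (C * 2 powr n) * (2 * C) powr (a - 1) / (a - 1)"

text \<open>Marcinkiewicz interpolation between the weak type inequality and the trivial bound for bounded
  functions: at height \<open>t\<close> the weak type inequality is applied to the part of \<open>h\<close> above a fixed multiple
  of \<open>t\<close>. For \<open>a > 1\<close> the remaining integral in \<open>t\<close> converges at 0.\<close>

theorem maximal_function_strong_type:
  assumes [measurable]: "h \<in> borel_measurable M" and a: "1 < a"
  shows "(\<integral>\<^sup>+x. epow (maximal_function h x) a \<partial>M)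
           \<le> ennreal (maximal_const a) * (\<integral>\<^sup>+x. epow (h x) a \<partial>M)"
proof -
  interpret pair_sigma_finite M "lborel :: real measure" ..
  let ?D = "C * 2 powr n"
  let ?w = "\<lambda>t::real. ennreal (t powr (a - 1)) * indicator {0<..} t"
  have D: "0 < ?D" using C_pos by simp
  have level: "?w t * emeasure M {y. ennreal t < maximal_function h y}
      \<le> ennreal (2 * ?D) * (\<integral>\<^sup>+x. ennreal (t powr (a - 2)) * indicator {0<..} t
          * (h x * indicator {x. ennreal (t / (2 * C)) < h x} x) \<partial>M)" for t
  proof (cases "0 < t")
    case True
    let ?h = "\<lambda>x. h x * indicator {x. ennreal (t / (2 * C)) < h x} x"
    have [measurable]: "?h \<in> borel_measurable M" by measurable
    have [measurable]: "{y. ennreal (t / 2) < maximal_function ?h y} \<in> sets M"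
      by (rule superlevel_in_sets_M) measurable
    have "{y. ennreal t < maximal_function h y} \<subseteq> {y. ennreal (t / 2) < maximal_function ?h y}"
    proof (rule subsetI, rule ccontr)
      fix y assume y: "y \<in> {y. ennreal t < maximal_function h y}"
        "y \<notin> {y. ennreal (t / 2) < maximal_function ?h y}"
      then have "maximal_function ?h y \<le> ennreal (t / 2)" by (simp add: linorder_not_less)
      then have "maximal_function h y \<le> ennreal (t / 2) + ennreal (t / 2)"
        by (rule order_trans[OF maximal_function_truncation[OF assms(1) True] add_right_mono])
      also have "\<dots> = ennreal t" using True by (simp add: ennreal_plus[symmetric] del: ennreal_plus)
      finally show False using y by auto
    qed
    then have "ennreal (t / 2) * emeasure M {y. ennreal t < maximal_function h y}
        \<le> ennreal (t / 2) * emeasure M {y. ennreal (t / 2) < maximal_function ?h y}"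
      by (intro mult_left_mono emeasure_mono) auto
    also have "\<dots> \<le> ennreal ?D * (\<integral>\<^sup>+x. ?h x \<partial>M)"
      using True by (intro maximal_function_weak_type) auto
    finally have w: "ennreal (t / 2) * emeasure M {y. ennreal t < maximal_function h y}
        \<le> ennreal ?D * (\<integral>\<^sup>+x. ?h x \<partial>M)" .
    have "t powr (a - 1) = 2 * t powr (a - 2) * (t / 2)"
      using True powr_add[of t "a - 2" 1] by simp
    then have "?w t * emeasure M {y. ennreal t < maximal_function h y}
        = ennreal (2 * t powr (a - 2)) * (ennreal (t / 2) * emeasure M {y. ennreal t < maximal_function h y})"
      using True by (simp only: ennreal_mult) (simp add: ennreal_mult[symmetric] mult.assoc[symmetric])
    also have "\<dots> \<le> ennreal (2 * t powr (a - 2)) * (ennreal ?D * (\<integral>\<^sup>+x. ?h x \<partial>M))"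
      by (intro mult_left_mono w) simp
    also have "\<dots> = ennreal (2 * ?D) * (\<integral>\<^sup>+x. ennreal (t powr (a - 2)) * indicator {0<..} t * ?h x \<partial>M)"
      using True C_pos by (subst nn_integral_cmult) (auto simp: ennreal_mult mult_ac)
    finally show ?thesis .
  qed simp
  have inner: "(\<integral>\<^sup>+t. ennreal (t powr (a - 2)) * indicator {0<..} t
          * (h x * indicator {x. ennreal (t / (2 * C)) < h x} x) \<partial>lborel)
      = ennreal ((2 * C) powr (a - 1) / (a - 1)) * epow (h x) a" for x
  proof -
    have iff: "ennreal (t / (2 * C)) < h x \<longleftrightarrow> ennreal t < ennreal (2 * C) * h x" if "0 < t" for t
    proof -
      have "ennreal t = ennreal (2 * C) * ennreal (t / (2 * C))"
        using that C_pos by (simp add: ennreal_mult[symmetric])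
      then show ?thesis
        using C_pos ennreal_mult_le_mult_iff[of "ennreal (2 * C)" "h x" "ennreal (t / (2 * C))"]
        by (simp add: linorder_not_le[symmetric])
    qed
    have "(\<integral>\<^sup>+t. ennreal (t powr (a - 2)) * indicator {0<..} t
          * (h x * indicator {x. ennreal (t / (2 * C)) < h x} x) \<partial>lborel)
      = (\<integral>\<^sup>+t. h x * (ennreal (t powr (a - 1 - 1)) * indicator {t. 0 < t \<and> ennreal t < ennreal (2 * C) * h x} t) \<partial>lborel)"
    proof (rule nn_integral_cong)
      fix t :: real
      show "ennreal (t powr (a - 2)) * indicator {0<..} t * (h x * indicator {x. ennreal (t / (2 * C)) < h x} x)
          = h x * (ennreal (t powr (a - 1 - 1)) * indicator {t. 0 < t \<and> ennreal t < ennreal (2 * C) * h x} t)"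
        using iff[of t] by (cases "0 < t") (auto simp: indicator_def mult_ac)
    qed
    also have "\<dots> = h x * (ennreal (1 / (a - 1)) * epow (ennreal (2 * C) * h x) (a - 1))"
    proof -
      have pos: "0 < a - 1" using a by simp
      have m: "(\<lambda>t. ennreal (t powr (a - 1 - 1)) * indicator {t. 0 < t \<and> ennreal t < ennreal (2 * C) * h x} t)
          \<in> borel_measurable lborel" by measurable
      show ?thesis by (simp only: nn_integral_cmult[OF m] nn_integral_powr_below[OF pos])
    qed
    also have "\<dots> = ennreal ((2 * C) powr (a - 1) / (a - 1)) * (epow (h x) 1 * epow (h x) (a - 1))"
    proof -
      have "ennreal ((2 * C) powr (a - 1) / (a - 1)) = ennreal ((2 * C) powr (a - 1)) * ennreal (1 / (a - 1))"
        using a by (simp add: ennreal_mult[symmetric])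
      then show ?thesis
        using C_pos by (simp add: epow_mult epow_ennreal) (simp only: mult_ac)
    qed
    also have "epow (h x) 1 * epow (h x) (a - 1) = epow (h x) a"
      unfolding epow_add by simp
    finally show ?thesis .
  qed
  have "(\<integral>\<^sup>+x. epow (maximal_function h x) a \<partial>M)
      = ennreal a * (\<integral>\<^sup>+x. ennreal (1 / a) * epow (maximal_function h x) a \<partial>M)"
    using a by (simp add: nn_integral_cmult mult.assoc[symmetric] ennreal_mult[symmetric])
  also have "\<dots> = ennreal a * (\<integral>\<^sup>+x. \<integral>\<^sup>+t. ennreal (t powr (a - 1)) * indicator {t. 0 < t \<and> ennreal t < maximal_function h x} t \<partial>lborel \<partial>M)"
    using a by (simp add: nn_integral_powr_below)
  also have "\<dots> = ennreal a * (\<integral>\<^sup>+t. \<integral>\<^sup>+x. ennreal (t powr (a - 1)) * indicator {t. 0 < t \<and> ennreal t < maximal_function h x} t \<partial>M \<partial>lborel)"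
    by (subst Fubini') measurable
  also have "\<dots> = ennreal a * (\<integral>\<^sup>+t. ?w t * emeasure M {y. ennreal t < maximal_function h y} \<partial>lborel)"
  proof (intro arg_cong2[where f = "(*)"] refl nn_integral_cong)
    fix t :: real
    have "(\<integral>\<^sup>+x. ennreal (t powr (a - 1)) * indicator {t. 0 < t \<and> ennreal t < maximal_function h x} t \<partial>M)
        = (\<integral>\<^sup>+x. ?w t * indicator {y. ennreal t < maximal_function h y} x \<partial>M)"
      by (intro nn_integral_cong) (auto simp: indicator_def)
    also have "\<dots> = ?w t * emeasure M {y. ennreal t < maximal_function h y}"
      by (intro nn_integral_cmult_indicator superlevel_in_sets_M) measurable
    finally show "(\<integral>\<^sup>+x. ennreal (t powr (a - 1)) * indicator {t. 0 < t \<and> ennreal t < maximal_function h x} t \<partial>M)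
        = ?w t * emeasure M {y. ennreal t < maximal_function h y}" .
  qed
  also have "\<dots> \<le> ennreal a * (\<integral>\<^sup>+t. ennreal (2 * ?D) * (\<integral>\<^sup>+x. ennreal (t powr (a - 2)) * indicator {0<..} t
          * (h x * indicator {x. ennreal (t / (2 * C)) < h x} x) \<partial>M) \<partial>lborel)"
    by (intro mult_left_mono nn_integral_mono level) simp
  also have "\<dots> = ennreal a * (ennreal (2 * ?D) * (\<integral>\<^sup>+t. \<integral>\<^sup>+x. ennreal (t powr (a - 2)) * indicator {0<..} t
          * (h x * indicator {x. ennreal (t / (2 * C)) < h x} x) \<partial>M \<partial>lborel))"
    by (subst nn_integral_cmult) measurable
  also have "\<dots> = ennreal a * (ennreal (2 * ?D) * (\<integral>\<^sup>+x. \<integral>\<^sup>+t. ennreal (t powr (a - 2)) * indicator {0<..} t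
          * (h x * indicator {x. ennreal (t / (2 * C)) < h x} x) \<partial>lborel \<partial>M))"
    by (subst Fubini') measurable
  also have "\<dots> = ennreal a * (ennreal (2 * ?D) * (ennreal ((2 * C) powr (a - 1) / (a - 1)) * (\<integral>\<^sup>+x. epow (h x) a \<partial>M)))"
    unfolding inner by (simp add: nn_integral_cmult)
  also have "\<dots> = ennreal (maximal_const a) * (\<integral>\<^sup>+x. epow (h x) a \<partial>M)"
    using a D C_pos unfolding maximal_const_def
    by (simp add: mult.assoc[symmetric] ennreal_mult[symmetric]) (simp add: mult_ac)
  finally show ?thesis .
qed

end

section \<open>Nets and dyadically decaying domination\<close>

lemma epow_indicator: "epow (x * indicator A y) a = epow x a * indicator A y"
  by (auto simp: indicator_def)

lemma nn_integral_count_space_disjoint_indicator: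
  assumes "disjoint_family_on S A"
  shows "(\<integral>\<^sup>+a. indicator (S a) x \<partial>count_space A) \<le> (1::ennreal)"
proof (cases "\<exists>a\<in>A. x \<in> S a")
  case True
  then obtain a0 where a0: "a0 \<in> A" "x \<in> S a0" by blast
  have "(\<integral>\<^sup>+a. indicator (S a) x \<partial>count_space A) \<le> (\<integral>\<^sup>+a. indicator {a0} a \<partial>count_space A)"
    using a0 assms by (intro nn_integral_mono) (auto simp: indicator_def disjoint_family_on_def)
  also have "\<dots> = 1" using a0 by simp
  finally show ?thesis .
next
  case False
  then have "(\<integral>\<^sup>+a. indicator (S a) x \<partial>count_space A) = (\<integral>\<^sup>+a. 0 \<partial>count_space A)"
    by (intro nn_integral_cong) auto
  then show ?thesis by simp
qed

definition dyadic_series :: "real \<Rightarrow> real" where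
  "dyadic_series \<rho> = (\<Sum>k. (2 ^ k) powr (- \<rho>))"

lemma dyadic_summable: "0 < \<rho> \<Longrightarrow> summable (\<lambda>k. (2 ^ k :: real) powr (- \<rho>))"
proof -
  assume "0 < \<rho>"
  have "(2 ^ k :: real) powr (- \<rho>) = (2 powr (- \<rho>)) ^ k" for k
    by (simp add: powr_powr powr_realpow[symmetric] mult.commute)
  then show ?thesis
    using \<open>0 < \<rho>\<close> by (simp add: summable_geometric powr_minus inverse_less_1_iff)
qed

lemma suminf_dyadic: "0 < \<rho> \<Longrightarrow> (\<Sum>k. ennreal ((2 ^ k) powr (- \<rho>))) = ennreal (dyadic_series \<rho>)"
  unfolding dyadic_series_def by (rule suminf_ennreal2) (auto intro: dyadic_summable)

lemma dyadic_series_nonneg: "0 < \<rho> \<Longrightarrow> 0 \<le> dyadic_series \<rho>"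
  unfolding dyadic_series_def by (intro suminf_nonneg dyadic_summable) auto

context regular_space
begin

text \<open>A maximal family of points with disjoint balls of radius \<open>r/2\<close> covers the space by balls of
  radius \<open>r\<close>. It is countable since only finitely many of the disjoint balls, whose measures
  are bounded below, fit into a given ball.\<close>

lemma exists_net:
  assumes "0 < r"
  obtains A :: "'a set" where "countable A" "(\<Union>a\<in>A. ball a r) = UNIV" "disjoint_family_on (\<lambda>a. ball a (r / 2)) A"
proof -
  obtain A :: "'a set" where A: "pairwise (\<lambda>x y. ball x (r / 2) \<inter> ball y (r / 2) = {}) A"
    "\<And>x. x \<in> UNIV - A \<Longrightarrow> \<exists>y\<in>A. ball x (r / 2) \<inter> ball y (r / 2) \<noteq> {}"
    using maximal_pairwise_subset[of "\<lambda>x y. ball x (r / 2) \<inter> ball y (r / 2) = {}" UNIV]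
    by (auto simp: symp_def Int_commute)
  have dis: "disjoint_family_on (\<lambda>a. ball a (r / 2)) A"
    using A(1) by (auto simp: pairwise_def disjoint_family_on_def)
  have cover: "(\<Union>a\<in>A. ball a r) = UNIV"
  proof -
    have "\<exists>a\<in>A. x \<in> ball a r" for x
    proof (cases "x \<in> A")
      case True
      then show ?thesis using assms by (intro bexI[of _ x]) auto
    next
      case False
      then obtain y z where yz: "y \<in> A" "dist x z < r / 2" "dist y z < r / 2"
        using A(2)[of x] by auto
      then show ?thesis
        using dist_triangle[of y x z] by (intro bexI[of _ y]) (auto simp: dist_commute)
    qed
    then show ?thesis by auto
  qed
  obtain x0 :: 'a where True by blast
  have "finite (A \<inter> ball x0 (real k))" for k :: nat
  proof (rule finite_disjoint_family_mass_bounded_below)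
    show "disjoint_family_on (\<lambda>a. ball a (r / 2)) (A \<inter> ball x0 (real k))"
      using dis by (rule disjoint_family_on_mono[rotated]) auto
    show "0 < ennreal (c * v (r / 2))" using c_pos v_pos[of "r / 2"] assms by simp
    show "emeasure M (ball x0 (real k + r)) < \<infinity>" using emeasure_ball_finite by simp
    fix a assume a: "a \<in> A \<inter> ball x0 (real k)"
    show "ball a (r / 2) \<subseteq> ball x0 (real k + r)"
    proof
      fix z assume "z \<in> ball a (r / 2)"
      with a assms dist_triangle[of x0 z a] show "z \<in> ball x0 (real k + r)" by auto
    qed
    show "ennreal (c * v (r / 2)) \<le> emeasure M (ball a (r / 2))"
      using assms by (intro ball_lower) auto
  qed auto
  then have "countable (\<Union>k::nat. A \<inter> ball x0 (real k))"
    by (intro countable_UN) (auto intro: countable_finite)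
  moreover have "(\<Union>k::nat. A \<inter> ball x0 (real k)) = A"
    using reals_Archimedean2 by auto
  ultimately have "countable A" by simp
  then show ?thesis using cover dis by (rule that)
qed

lemma integral_le_sum_over_net:
  assumes [measurable]: "f \<in> borel_measurable M"
    and "countable A" and cover: "(\<Union>a\<in>A. ball a r) = UNIV"
  shows "(\<integral>\<^sup>+x. f x \<partial>M) \<le> (\<integral>\<^sup>+a. (\<integral>\<^sup>+x\<in>ball a r. f x \<partial>M) \<partial>count_space A)"
proof -
  have "(\<integral>\<^sup>+x. f x \<partial>M) \<le> (\<integral>\<^sup>+x. (\<integral>\<^sup>+a. f x * indicator (ball a r) x \<partial>count_space A) \<partial>M)"
  proof (rule nn_integral_mono)
    fix x
    obtain a where "a \<in> A" "x \<in> ball a r" using cover by blast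
    then show "f x \<le> (\<integral>\<^sup>+a. f x * indicator (ball a r) x \<partial>count_space A)"
      using nn_integral_ge_point[of a A "\<lambda>a. f x * indicator (ball a r) x"] by simp
  qed
  also have "\<dots> = (\<integral>\<^sup>+a. (\<integral>\<^sup>+x\<in>ball a r. f x \<partial>M) \<partial>count_space A)"
    by (rule nn_integral_count_space_nn_integral[OF \<open>countable A\<close>]) measurable
  finally show ?thesis .
qed

text \<open>The bounded overlap of the balls over a net, with coefficients: each coefficient is
  at most the average of \<open>H\<close> over a small ball around its net point, and those small balls are disjoint and
  lie in \<open>B(y, R + r)\<close>. With \<open>H = 1\<close> this counts the net points near \<open>y\<close>.\<close>

lemma net_sum_le_ball_integral:
  assumes [measurable]: "H \<in> borel_measurable M" and "countable A" and "0 < r"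
    and dis: "disjoint_family_on (\<lambda>a. ball a (r / 2)) A"
    and le: "\<And>a x. a \<in> A \<Longrightarrow> x \<in> ball a (r / 2) \<Longrightarrow> b a \<le> H x"
  shows "ennreal (c * v r) * (\<integral>\<^sup>+a. b a * indicator (ball a R) y \<partial>count_space A)
           \<le> ennreal (2 powr n) * (\<integral>\<^sup>+x\<in>ball y (R + r). H x \<partial>M)"
proof -
  have "0 < r / 2" using assms by simp
  have vr: "c * v r \<le> 2 powr n * (c * v (r / 2))"
    using v_scale[OF \<open>0 < r / 2\<close>, of 2] c_pos by simp
  have each: "ennreal (c * v (r / 2)) * (b a * indicator (ball a R) y)
      \<le> (\<integral>\<^sup>+x. H x * indicator (ball y (R + r)) x * indicator (ball a (r / 2)) x \<partial>M)"
    if a: "a \<in> A" for a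
  proof (cases "y \<in> ball a R")
    case True
    have sub: "x \<in> ball y (R + r)" if x: "x \<in> ball a (r / 2)" for x
      using x True \<open>0 < r\<close> dist_triangle[of y x a] by (simp add: dist_commute)
    have "ennreal (c * v (r / 2)) * (b a * indicator (ball a R) y) \<le> emeasure M (ball a (r / 2)) * b a"
      using True by (simp add: mult_right_mono ball_lower[OF \<open>0 < r / 2\<close>])
    also have "\<dots> = (\<integral>\<^sup>+x. b a * indicator (ball a (r / 2)) x \<partial>M)"
      by (simp add: nn_integral_cmult_indicator mult.commute)
    also have "\<dots> \<le> (\<integral>\<^sup>+x. H x * indicator (ball y (R + r)) x * indicator (ball a (r / 2)) x \<partial>M)"
      using le[OF a] sub by (intro nn_integral_mono) (auto simp: indicator_def)
    finally show ?thesis .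
  qed simp
  have "ennreal (c * v r) * (\<integral>\<^sup>+a. b a * indicator (ball a R) y \<partial>count_space A)
      \<le> ennreal (2 powr n * (c * v (r / 2))) * (\<integral>\<^sup>+a. b a * indicator (ball a R) y \<partial>count_space A)"
    by (intro mult_right_mono ennreal_leI vr) simp
  also have "\<dots> = ennreal (2 powr n) * (\<integral>\<^sup>+a. ennreal (c * v (r / 2)) * (b a * indicator (ball a R) y) \<partial>count_space A)"
    using c_pos v_pos[OF \<open>0 < r / 2\<close>] by (simp add: ennreal_mult nn_integral_cmult mult.assoc)
  also have "\<dots> \<le> ennreal (2 powr n) * (\<integral>\<^sup>+a. (\<integral>\<^sup>+x. H x * indicator (ball y (R + r)) x * indicator (ball a (r / 2)) x \<partial>M) \<partial>count_space A)"
    by (intro mult_left_mono nn_integral_mono each) auto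
  also have "(\<integral>\<^sup>+a. (\<integral>\<^sup>+x. H x * indicator (ball y (R + r)) x * indicator (ball a (r / 2)) x \<partial>M) \<partial>count_space A)
      = (\<integral>\<^sup>+x. (\<integral>\<^sup>+a. H x * indicator (ball y (R + r)) x * indicator (ball a (r / 2)) x \<partial>count_space A) \<partial>M)"
    by (rule nn_integral_count_space_nn_integral[OF \<open>countable A\<close>, symmetric]) measurable
  also have "\<dots> \<le> (\<integral>\<^sup>+x. H x * indicator (ball y (R + r)) x * 1 \<partial>M)"
    using nn_integral_count_space_disjoint_indicator[OF dis]
    by (intro nn_integral_mono) (simp add: nn_integral_cmult mult_left_mono del: mult_1_right)
  finally show ?thesis by (simp add: mult_left_mono)
qed

text \<open>Averages of \<open>g\<close> at scale \<open>r\<close> are controlled by averages of \<open>f\<close> at all larger dyadic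
  scales, with decay \<open>2^(-\<kappa> k)\<close>. The integrals are not normalised; the power of \<open>v r\<close> in front accounts for
  the normalisation at scale \<open>r\<close> on both sides. Everything is squared so that it can be paired with \<open>L\<^sup>2\<close>
  integrals directly.\<close>

definition locally_dominated ::
    "real \<Rightarrow> real \<Rightarrow> real \<Rightarrow> real \<Rightarrow> real \<Rightarrow> ('a \<Rightarrow> ennreal) \<Rightarrow> ('a \<Rightarrow> ennreal) \<Rightarrow> bool" where
  "locally_dominated K s q \<kappa> r g f \<longleftrightarrow>
     (\<forall>x. epow (\<integral>\<^sup>+y\<in>ball x r. epow (g y) q \<partial>M) (2 / q) \<le>
        ennreal (K * v r powr (2 / q - 2 / s)) *
        (\<Sum>k. ennreal ((2 ^ k) powr (- 2 * \<kappa>)) *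
               epow (\<integral>\<^sup>+y\<in>ball x (2 ^ (k + 1) * r). epow (f y) s \<partial>M) (2 / s)))"

definition dominates_averages :: "('a \<Rightarrow> ennreal) \<Rightarrow> ('a \<Rightarrow> ennreal) \<Rightarrow> bool" where
  "dominates_averages H h \<longleftrightarrow>
     (\<forall>y. \<forall>R>0. (\<integral>\<^sup>+x\<in>ball y R. h x \<partial>M) \<le> ennreal (2 powr n * v R) * H y)"

lemma maximal_function_dominates_averages: "dominates_averages (maximal_function h) h"
  unfolding dominates_averages_def using ball_integral_le_maximal_function by blast

lemma dominates_averages_ball:
  assumes "dominates_averages H h" and "0 < r" and "1 \<le> L" and "ball x R \<subseteq> ball y (L * r)"
  shows "(\<integral>\<^sup>+z\<in>ball x R. h z \<partial>M) \<le> ennreal (2 powr n * L powr n * v r) * H y"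
proof -
  have "(\<integral>\<^sup>+z\<in>ball x R. h z \<partial>M) \<le> (\<integral>\<^sup>+z\<in>ball y (L * r). h z \<partial>M)"
    using assms(4) by (intro nn_integral_mono mult_left_mono) (auto simp: indicator_def)
  also have "\<dots> \<le> ennreal (2 powr n * v (L * r)) * H y"
    using assms by (auto simp: dominates_averages_def)
  also have "\<dots> \<le> ennreal (2 powr n * L powr n * v r) * H y"
    using v_scale[OF assms(2,3)] by (intro mult_right_mono ennreal_leI) auto
  finally show ?thesis .
qed

text \<open>This passes from \<open>L\<^sup>s\<close> to \<open>L\<^sup>2\<close> on a set. With \<open>\<eta> = 1\<close> it is the usual comparison of
  averages; with \<open>\<psi> = f\<^sup>2/w\<close> and \<open>\<eta>\<close> the power of \<open>w\<close> that makes the pointwise hypothesis an equality, it is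
  the weighted version.\<close>

lemma Hoelder_ball_power:
  assumes s: "0 < s" "s < 2" and [measurable]: "\<psi> \<in> borel_measurable M" "\<eta> \<in> borel_measurable M"
      "B \<in> sets M"
    and le: "\<And>x. epow (f x) s \<le> epow (\<psi> x) (s / 2) * epow (\<eta> x) (1 - s / 2)"
  shows "epow (\<integral>\<^sup>+x\<in>B. epow (f x) s \<partial>M) (2 / s)
           \<le> (\<integral>\<^sup>+x\<in>B. \<psi> x \<partial>M) * epow (\<integral>\<^sup>+x\<in>B. \<eta> x \<partial>M) (2 / s - 1)"
proof -
  have "(\<integral>\<^sup>+x\<in>B. epow (f x) s \<partial>M)
      \<le> (\<integral>\<^sup>+x. epow (\<psi> x * indicator B x) (s / 2) * epow (\<eta> x * indicator B x) (1 - s / 2) \<partial>M)"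
    using le by (intro nn_integral_mono) (auto simp: indicator_def)
  also have "\<dots> \<le> epow (\<integral>\<^sup>+x\<in>B. \<psi> x \<partial>M) (s / 2) * epow (\<integral>\<^sup>+x\<in>B. \<eta> x \<partial>M) (1 - s / 2)"
    using s by (intro nn_integral_Hoelder) auto
  finally have "epow (\<integral>\<^sup>+x\<in>B. epow (f x) s \<partial>M) (2 / s)
      \<le> epow (epow (\<integral>\<^sup>+x\<in>B. \<psi> x \<partial>M) (s / 2) * epow (\<integral>\<^sup>+x\<in>B. \<eta> x \<partial>M) (1 - s / 2)) (2 / s)"
    using s by (intro epow_mono) auto
  also have "\<dots> = (\<integral>\<^sup>+x\<in>B. \<psi> x \<partial>M) * epow (\<integral>\<^sup>+x\<in>B. \<eta> x \<partial>M) ((1 - s / 2) * (2 / s))"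
    using s by (simp add: epow_mult epow_epow)
  also have "(1 - s / 2) * (2 / s) = 2 / s - 1" using s by (simp add: field_simps)
  finally show ?thesis .
qed

lemma Hoelder_ball_weight:
  assumes q: "2 < q" and [measurable]: "g \<in> borel_measurable M" "h \<in> borel_measurable M"
  shows "(\<integral>\<^sup>+x\<in>ball a r. epow (g x) 2 * epow (h x) (1 - 2 / q) \<partial>M)
           \<le> epow (\<integral>\<^sup>+x\<in>ball a r. epow (g x) q \<partial>M) (2 / q) * epow (\<integral>\<^sup>+x\<in>ball a r. h x \<partial>M) (1 - 2 / q)"
proof -
  have "(\<integral>\<^sup>+x\<in>ball a r. epow (g x) 2 * epow (h x) (1 - 2 / q) \<partial>M)
      = (\<integral>\<^sup>+x. epow (epow (g x) q * indicator (ball a r) x) (2 / q) * epow (h x * indicator (ball a r) x) (1 - 2 / q) \<partial>M)"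
    using q by (intro nn_integral_cong) (auto simp: indicator_def epow_epow)
  also have "\<dots> \<le> epow (\<integral>\<^sup>+x\<in>ball a r. epow (g x) q \<partial>M) (2 / q) * epow (\<integral>\<^sup>+x\<in>ball a r. h x \<partial>M) (1 - 2 / q)"
    using q by (intro nn_integral_Hoelder) auto
  finally show ?thesis .
qed

text \<open>The bookkeeping shared by both weighted inequalities. At the dyadic scale \<open>k\<close> the sum over
  the net loses \<open>2^(2kn/s)\<close>, the domination gains \<open>2^(2k\<kappa>)\<close>, and \<open>\<kappa> > n/s\<close> makes
  the series over \<open>k\<close> converge.\<close>

lemma sum_over_net_locally_dominated:
  assumes dom: "locally_dominated K s q \<kappa> r g f" and "n / s < \<kappa>" and "0 \<le> K" "0 \<le> \<Gamma>" "0 < s"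
    and each: "\<And>k::nat. (\<integral>\<^sup>+a. b a * (ennreal (v r powr (2 / q - 2 / s)) *
                   epow (\<integral>\<^sup>+y\<in>ball a (2 ^ (k + 1) * r). epow (f y) s \<partial>M) (2 / s)) \<partial>count_space A)
                 \<le> ennreal (\<Gamma> * (2 ^ k) powr (2 * n / s)) * X"
  shows "(\<integral>\<^sup>+a. b a * epow (\<integral>\<^sup>+y\<in>ball a r. epow (g y) q \<partial>M) (2 / q) \<partial>count_space A)
           \<le> ennreal (K * \<Gamma> * dyadic_series (2 * (\<kappa> - n / s))) * X"
proof -
  define Y where "Y k a = b a * (ennreal (v r powr (2 / q - 2 / s)) *
                   epow (\<integral>\<^sup>+y\<in>ball a (2 ^ (k + 1) * r). epow (f y) s \<partial>M) (2 / s))" for k :: nat and a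
  have "b a * epow (\<integral>\<^sup>+y\<in>ball a r. epow (g y) q \<partial>M) (2 / q)
      \<le> (\<Sum>k. ennreal K * ennreal ((2 ^ k) powr (- 2 * \<kappa>)) * Y k a)" for a
  proof -
    have "b a * epow (\<integral>\<^sup>+y\<in>ball a r. epow (g y) q \<partial>M) (2 / q)
      \<le> b a * (ennreal (K * v r powr (2 / q - 2 / s)) *
        (\<Sum>k. ennreal ((2 ^ k) powr (- 2 * \<kappa>)) *
               epow (\<integral>\<^sup>+y\<in>ball a (2 ^ (k + 1) * r). epow (f y) s \<partial>M) (2 / s)))"
      using dom unfolding locally_dominated_def by (intro mult_left_mono) auto
    also have "\<dots> = (\<Sum>k. ennreal K * ennreal ((2 ^ k) powr (- 2 * \<kappa>)) * Y k a)"
      unfolding ennreal_suminf_cmult[symmetric] Y_def using \<open>0 \<le> K\<close>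
      by (intro suminf_cong) (simp add: ennreal_mult mult_ac)
    finally show ?thesis .
  qed
  then have "(\<integral>\<^sup>+a. b a * epow (\<integral>\<^sup>+y\<in>ball a r. epow (g y) q \<partial>M) (2 / q) \<partial>count_space A)
      \<le> (\<integral>\<^sup>+a. (\<Sum>k. ennreal K * ennreal ((2 ^ k) powr (- 2 * \<kappa>)) * Y k a) \<partial>count_space A)"
    by (intro nn_integral_mono)
  also have "\<dots> = (\<Sum>k. ennreal K * ennreal ((2 ^ k) powr (- 2 * \<kappa>)) * (\<integral>\<^sup>+a. Y k a \<partial>count_space A))"
    by (simp add: nn_integral_suminf nn_integral_cmult)
  also have "\<dots> \<le> (\<Sum>k. ennreal K * ennreal ((2 ^ k) powr (- 2 * \<kappa>)) * (ennreal (\<Gamma> * (2 ^ k) powr (2 * n / s)) * X))"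
    using each unfolding Y_def by (intro suminf_le mult_left_mono) auto
  also have "\<dots> = (\<Sum>k. ennreal (K * \<Gamma>) * X * ennreal ((2 ^ k) powr (- (2 * (\<kappa> - n / s)))))"
  proof (rule suminf_cong)
    fix k :: nat
    have "(2 ^ k :: real) powr (- (2 * (\<kappa> - n / s))) = (2 ^ k) powr (- 2 * \<kappa>) * (2 ^ k) powr (2 * n / s)"
      by (simp add: powr_add[symmetric] algebra_simps)
    then show "ennreal K * ennreal ((2 ^ k) powr (- 2 * \<kappa>)) * (ennreal (\<Gamma> * (2 ^ k) powr (2 * n / s)) * X)
        = ennreal (K * \<Gamma>) * X * ennreal ((2 ^ k) powr (- (2 * (\<kappa> - n / s))))"
      using \<open>0 \<le> K\<close> \<open>0 \<le> \<Gamma>\<close> by (simp only: ennreal_mult powr_ge_zero) (simp add: mult_ac)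
  qed
  also have "\<dots> = ennreal (K * \<Gamma> * dyadic_series (2 * (\<kappa> - n / s))) * X"
  proof -
    have pos: "0 < 2 * (\<kappa> - n / s)" using \<open>n / s < \<kappa>\<close> by simp
    show ?thesis
      unfolding ennreal_suminf_cmult suminf_dyadic[OF pos]
      using \<open>0 \<le> K\<close> \<open>0 \<le> \<Gamma>\<close> dyadic_series_nonneg[OF pos]
      by (simp only: ennreal_mult mult_nonneg_nonneg) (simp only: mult_ac)
  qed
  finally show ?thesis .
qed

end

section \<open>Weighted inequalities\<close>

context regular_space
begin

definition large_exponent_const :: "real \<Rightarrow> real \<Rightarrow> real" where
  "large_exponent_const s q = (C * 2 powr n) powr (2 / s - 1) * (2 powr n / c)
     * (2 powr n * 2 powr n) powr (1 - 2 / q) * (2 powr n * 4 powr n)"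

text \<open>On each ball \<open>B(a, r)\<close> of a net, Hoelder's inequality with the exponents \<open>q/2\<close> and its conjugate
  separates \<open>g\<close> from the weight. Up to constants, the weight then contributes the average of \<open>h\<close> over \<open>B(a, r)\<close> to the
  power \<open>1 - 2/q\<close>, which is bounded by the same power of \<open>H\<close> at every point near \<open>a\<close>. Summing over the net points within
  distance \<open>2^(k+1) r\<close> of a point gives an average of that power over a ball of comparable radius, hence \<open>V\<close>.\<close>

lemma weighted_large_exponent:
  assumes s: "0 < s" "s < 2" and q: "2 < q" and \<kappa>: "n / s < \<kappa>" and K: "0 \<le> K" and r: "0 < r"
    and [measurable]: "f \<in> borel_measurable M" "g \<in> borel_measurable M" "h \<in> borel_measurable M"
      "H \<in> borel_measurable M" "V \<in> borel_measurable M"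
    and dom: "locally_dominated K s q \<kappa> r g f"
    and H: "dominates_averages H h" and V: "dominates_averages V (\<lambda>x. epow (H x) (1 - 2 / q))"
  shows "(\<integral>\<^sup>+x. epow (g x) 2 * epow (h x) (1 - 2 / q) \<partial>M)
           \<le> ennreal (K * large_exponent_const s q * dyadic_series (2 * (\<kappa> - n / s))) *
             (\<integral>\<^sup>+x. epow (f x) 2 * V x \<partial>M)"
proof -
  let ?\<tau> = "1 - 2 / q"
  obtain A :: "'a set" where A: "countable A" "(\<Union>a\<in>A. ball a r) = UNIV" "disjoint_family_on (\<lambda>a. ball a (r / 2)) A"
    by (rule exists_net[OF r])
  note vr = v_pos[OF r]
  have \<tau>: "0 < ?\<tau>" using q by simp
  have s': "0 < 2 / s - 1" using s by simp
  \<comment> \<open>The power of \<open>H\<close> is scaled so as to dominate \<open>b\<close>, whose integrals are not normalised.\<close>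
  define b where "b a = epow (\<integral>\<^sup>+x\<in>ball a r. h x \<partial>M) ?\<tau>" for a
  define W where "W x = ennreal ((2 powr n * 2 powr n * v r) powr ?\<tau>) * epow (H x) ?\<tau>" for x
  have [measurable]: "W \<in> borel_measurable M" unfolding W_def by measurable
  have bW: "b a \<le> W x" if x: "x \<in> ball a (r / 2)" for a x
  proof -
    have sub: "ball a r \<subseteq> ball x (2 * r)"
    proof
      fix z assume "z \<in> ball a r"
      with x r dist_triangle[of x z a] show "z \<in> ball x (2 * r)" by (simp add: dist_commute)
    qed
    have "(\<integral>\<^sup>+x\<in>ball a r. h x \<partial>M) \<le> ennreal (2 powr n * 2 powr n * v r) * H x"
      by (rule dominates_averages_ball[OF H r _ sub]) simp
    then have "b a \<le> epow (ennreal (2 powr n * 2 powr n * v r) * H x) ?\<tau>"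
      unfolding b_def using \<tau> by (intro epow_mono) auto
    then show ?thesis using vr by (simp add: W_def epow_mult epow_ennreal)
  qed
  have each: "(\<integral>\<^sup>+a. b a * (ennreal (v r powr (2 / q - 2 / s)) *
         epow (\<integral>\<^sup>+y\<in>ball a (2 ^ (k + 1) * r). epow (f y) s \<partial>M) (2 / s)) \<partial>count_space A)
       \<le> ennreal (large_exponent_const s q * (2 ^ k) powr (2 * n / s)) * (\<integral>\<^sup>+x. epow (f x) 2 * V x \<partial>M)" for k :: nat
  proof -
    define t where "t = (2 ^ k :: real)"
    have t: "1 \<le> t" "0 < t" by (simp_all add: t_def)
    define R where "R = 2 * t * r"
    have R: "0 < R" "2 ^ (k + 1) * r = R" using t r by (simp_all add: R_def t_def)
    let ?m = "C * ((2 * t) powr n * v r)"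
    let ?D = "v r powr (2 / q - 2 / s) * ?m powr (2 / s - 1)"
      and ?O = "2 powr n / (c * v r) * (2 powr n * 2 powr n * v r) powr ?\<tau> * (2 powr n * (4 * t) powr n * v r)"
    have ball_f: "epow (\<integral>\<^sup>+y\<in>ball a R. epow (f y) s \<partial>M) (2 / s)
        \<le> ennreal (?m powr (2 / s - 1)) * (\<integral>\<^sup>+x\<in>ball a R. epow (f x) 2 \<partial>M)" for a
    proof -
      have "epow (\<integral>\<^sup>+y\<in>ball a R. epow (f y) s \<partial>M) (2 / s)
          \<le> (\<integral>\<^sup>+x\<in>ball a R. epow (f x) 2 \<partial>M) * epow (\<integral>\<^sup>+x\<in>ball a R. 1 \<partial>M) (2 / s - 1)"
        by (intro Hoelder_ball_power s) (auto simp: epow_epow)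
      also have "(\<integral>\<^sup>+x\<in>ball a R. 1 \<partial>M) = emeasure M (ball a R)" by simp
      also have "epow (emeasure M (ball a R)) (2 / s - 1) \<le> epow (ennreal ?m) (2 / s - 1)"
      proof (intro epow_mono)
        have "emeasure M (ball a R) \<le> ennreal (C * v R)" by (rule ball_upper[OF R(1)])
        also have "\<dots> \<le> ennreal ?m"
          unfolding R_def using r t C_pos v_scale[of r "2 * t"] by (intro ennreal_leI mult_left_mono) auto
        finally show "emeasure M (ball a R) \<le> ennreal ?m" .
      qed (use s' in simp)
      also have "epow (ennreal ?m) (2 / s - 1) = ennreal (?m powr (2 / s - 1))"
        using C_pos vr by (simp add: epow_ennreal)
      finally have "epow (\<integral>\<^sup>+y\<in>ball a R. epow (f y) s \<partial>M) (2 / s)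
          \<le> (\<integral>\<^sup>+x\<in>ball a R. epow (f x) 2 \<partial>M) * ennreal (?m powr (2 / s - 1))"
        by (simp add: mult_left_mono)
      then show ?thesis by (simp only: mult.commute)
    qed
    have overlap: "(\<integral>\<^sup>+a. b a * indicator (ball a R) x \<partial>count_space A)
        \<le> ennreal (2 powr n / (c * v r) * (2 powr n * 2 powr n * v r) powr ?\<tau> * (2 powr n * (4 * t) powr n * v r)) * V x" for x
    proof -
      have sub: "ball x (R + r) \<subseteq> ball x (4 * t * r)"
        using t r by (intro subset_ball) (simp add: R_def)
      have "ennreal (c * v r) * (\<integral>\<^sup>+a. b a * indicator (ball a R) x \<partial>count_space A)
          \<le> ennreal (2 powr n) * (\<integral>\<^sup>+z\<in>ball x (R + r). W z \<partial>M)"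
        by (intro net_sum_le_ball_integral A r bW) auto
      also have "(\<integral>\<^sup>+z\<in>ball x (R + r). W z \<partial>M)
          = ennreal ((2 powr n * 2 powr n * v r) powr ?\<tau>) * (\<integral>\<^sup>+z\<in>ball x (R + r). epow (H z) ?\<tau> \<partial>M)"
        unfolding W_def by (subst nn_integral_cmult[symmetric]) (auto simp: mult.assoc)
      also have "\<dots> \<le> ennreal ((2 powr n * 2 powr n * v r) powr ?\<tau>) * (ennreal (2 powr n * (4 * t) powr n * v r) * V x)"
        using t sub by (intro mult_left_mono dominates_averages_ball V r) auto
      finally have *: "ennreal (c * v r) * (\<integral>\<^sup>+a. b a * indicator (ball a R) x \<partial>count_space A)
          \<le> ennreal (2 powr n) * (ennreal ((2 powr n * 2 powr n * v r) powr ?\<tau>) * (ennreal (2 powr n * (4 * t) powr n * v r) * V x))"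
        by (simp add: mult_left_mono)
      have "(\<integral>\<^sup>+a. b a * indicator (ball a R) x \<partial>count_space A)
          = ennreal (1 / (c * v r)) * (ennreal (c * v r) * (\<integral>\<^sup>+a. b a * indicator (ball a R) x \<partial>count_space A))"
        using c_pos vr by (simp add: mult.assoc[symmetric] ennreal_mult[symmetric])
      also have "\<dots> \<le> ennreal (1 / (c * v r)) * (ennreal (2 powr n) * (ennreal ((2 powr n * 2 powr n * v r) powr ?\<tau>) * (ennreal (2 powr n * (4 * t) powr n * v r) * V x)))"
        by (intro mult_left_mono *) simp
      also have "\<dots> = ennreal (2 powr n / (c * v r) * (2 powr n * 2 powr n * v r) powr ?\<tau> * (2 powr n * (4 * t) powr n * v r)) * V x"
        using c_pos vr by (simp add: mult.assoc[symmetric] ennreal_mult[symmetric])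
      finally show ?thesis .
    qed
    have "(\<integral>\<^sup>+a. b a * (ennreal (v r powr (2 / q - 2 / s)) *
         epow (\<integral>\<^sup>+y\<in>ball a R. epow (f y) s \<partial>M) (2 / s)) \<partial>count_space A)
       \<le> (\<integral>\<^sup>+a. b a * (ennreal (v r powr (2 / q - 2 / s)) *
         (ennreal (?m powr (2 / s - 1)) * (\<integral>\<^sup>+x\<in>ball a R. epow (f x) 2 \<partial>M))) \<partial>count_space A)"
      by (intro nn_integral_mono mult_left_mono ball_f) auto
    also have "\<dots> = ennreal (v r powr (2 / q - 2 / s) * ?m powr (2 / s - 1)) *
        (\<integral>\<^sup>+a. b a * (\<integral>\<^sup>+x\<in>ball a R. epow (f x) 2 \<partial>M) \<partial>count_space A)"
      by (subst nn_integral_cmult[symmetric]) (auto intro!: nn_integral_cong simp: ennreal_mult mult_ac)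
    also have "(\<integral>\<^sup>+a. b a * (\<integral>\<^sup>+x\<in>ball a R. epow (f x) 2 \<partial>M) \<partial>count_space A)
        = (\<integral>\<^sup>+a. (\<integral>\<^sup>+x. epow (f x) 2 * (b a * indicator (ball a R) x) \<partial>M) \<partial>count_space A)"
      by (intro nn_integral_cong, subst nn_integral_cmult[symmetric]) (auto intro!: nn_integral_cong simp: mult_ac)
    also have "\<dots> = (\<integral>\<^sup>+x. (\<integral>\<^sup>+a. epow (f x) 2 * (b a * indicator (ball a R) x) \<partial>count_space A) \<partial>M)"
      by (rule nn_integral_count_space_nn_integral[OF A(1), symmetric]) measurable
    also have "\<dots> = (\<integral>\<^sup>+x. epow (f x) 2 * (\<integral>\<^sup>+a. b a * indicator (ball a R) x \<partial>count_space A) \<partial>M)"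
      by (simp add: nn_integral_cmult)
    also have "\<dots> \<le> (\<integral>\<^sup>+x. epow (f x) 2 * (ennreal (2 powr n / (c * v r) * (2 powr n * 2 powr n * v r) powr ?\<tau> * (2 powr n * (4 * t) powr n * v r)) * V x) \<partial>M)"
      by (intro nn_integral_mono mult_left_mono overlap) auto
    also have "\<dots> = ennreal (2 powr n / (c * v r) * (2 powr n * 2 powr n * v r) powr ?\<tau> * (2 powr n * (4 * t) powr n * v r)) * (\<integral>\<^sup>+x. epow (f x) 2 * V x \<partial>M)"
      by (subst nn_integral_cmult[symmetric]) (auto intro!: nn_integral_cong simp: mult_ac)
    finally have "(\<integral>\<^sup>+a. b a * (ennreal (v r powr (2 / q - 2 / s)) *
         epow (\<integral>\<^sup>+y\<in>ball a R. epow (f y) s \<partial>M) (2 / s)) \<partial>count_space A)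
       \<le> ennreal ?D * (ennreal ?O * (\<integral>\<^sup>+x. epow (f x) 2 * V x \<partial>M))"
      by (simp add: mult_left_mono)
    also have "\<dots> = ennreal (?D * ?O) * (\<integral>\<^sup>+x. epow (f x) 2 * V x \<partial>M)"
      using c_pos C_pos vr t by (subst ennreal_mult[of ?D ?O]) (auto simp: mult.assoc)
    also have "?D * ?O = large_exponent_const s q * t powr (2 * n / s)"
    proof -
      have e1: "?m powr (2 / s - 1) = (C * 2 powr n) powr (2 / s - 1) * t powr (n * (2 / s - 1)) * v r powr (2 / s - 1)"
        using C_pos t vr by (simp add: powr_mult powr_powr mult.assoc)
      have e2: "(2 powr n * 2 powr n * v r) powr ?\<tau> = (2 powr n * 2 powr n) powr ?\<tau> * v r powr ?\<tau>"
        using vr by (simp add: powr_mult)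
      have e3: "(4 * t) powr n = 4 powr n * t powr n" using t by (simp add: powr_mult)
      have v1: "v r powr (2 / q - 2 / s) * (v r powr (2 / s - 1) * v r powr ?\<tau>) = 1"
        using vr by (simp add: powr_add[symmetric])
      have t1: "t powr (n * (2 / s - 1)) * t powr n = t powr (2 * n / s)"
        using s by (simp add: powr_add[symmetric] field_simps)
      have alg: "p1 * (E * x1 * p2) * (N / (c * v r) * (D * p3) * (N * (F * x2) * v r))
          = E * (N / c) * D * (N * F) * (x1 * x2) * (p1 * (p2 * p3))" for p1 p2 p3 E x1 x2 N D F :: real
        using vr c_pos by (simp add: field_simps)
      show ?thesis
        unfolding e1 unfolding e2 e3 alg t1 v1 large_exponent_const_def by simp
    qed
    finally show ?thesis unfolding R t_def .
  qed
  have "(\<integral>\<^sup>+x. epow (g x) 2 * epow (h x) ?\<tau> \<partial>M)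
      \<le> (\<integral>\<^sup>+a. (\<integral>\<^sup>+x\<in>ball a r. epow (g x) 2 * epow (h x) ?\<tau> \<partial>M) \<partial>count_space A)"
    by (intro integral_le_sum_over_net A) measurable
  also have "\<dots> \<le> (\<integral>\<^sup>+a. b a * epow (\<integral>\<^sup>+x\<in>ball a r. epow (g x) q \<partial>M) (2 / q) \<partial>count_space A)"
    unfolding b_def using Hoelder_ball_weight[OF q, of g h]
    by (intro nn_integral_mono) (simp add: mult.commute)
  also have "\<dots> \<le> ennreal (K * large_exponent_const s q * dyadic_series (2 * (\<kappa> - n / s))) * (\<integral>\<^sup>+x. epow (f x) 2 * V x \<partial>M)"
    using c_pos by (intro sum_over_net_locally_dominated[OF dom \<kappa> K] each s) (auto simp: large_exponent_const_def)
  finally show ?thesis .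
qed

definition small_exponent_const :: "real \<Rightarrow> real \<Rightarrow> real" where
  "small_exponent_const s q = C powr (1 - 2 / q) * (2 powr n * 4 powr n) powr (2 / s - 1)
     * (2 powr n / c) * (C * 4 powr n)"

text \<open>Here the factor \<open>1/W\<close> on the left absorbs the weight that arises on the right when the
  \<open>L\<^sup>s\<close> average over a large ball is replaced by a weighted \<open>L\<^sup>2\<close> average: every point of \<open>B(a, r)\<close> sees the
  large ball around \<open>a\<close> inside a ball of comparable radius, so \<open>H\<close> there dominates the average of \<open>h\<close>, and \<open>W\<close> is the
  power \<open>2/s - 1\<close> of \<open>H\<close>. The
  conventions \<open>0 \<cdot> \<infinity> = 0\<close> and \<open>1/0 = \<infinity>\<close> are harmless because \<open>h\<close> is finite and \<open>f\<close> vanishes where \<open>h\<close> does.\<close>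

lemma weighted_small_exponent:
  assumes s: "0 < s" "s < 2" and q: "2 < q" and \<kappa>: "n / s < \<kappa>" and K: "0 \<le> K" and r: "0 < r"
    and [measurable]: "f \<in> borel_measurable M" "g \<in> borel_measurable M" "h \<in> borel_measurable M"
      "H \<in> borel_measurable M"
    and dom: "locally_dominated K s q \<kappa> r g f"
    and H: "dominates_averages H h"
    and h_fin: "\<And>x. h x < top" and f0: "\<And>x. h x = 0 \<Longrightarrow> f x = 0"
  shows "(\<integral>\<^sup>+x. epow (g x) 2 * inverse (epow (H x) (2 / s - 1)) \<partial>M)
           \<le> ennreal (K * small_exponent_const s q * dyadic_series (2 * (\<kappa> - n / s))) *
             (\<integral>\<^sup>+x. epow (f x) 2 * inverse (epow (h x) (2 / s - 1)) \<partial>M)"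
proof -
  let ?\<sigma> = "2 / s - 1" and ?\<tau> = "1 - 2 / q"
  obtain A :: "'a set" where A: "countable A" "(\<Union>a\<in>A. ball a r) = UNIV" "disjoint_family_on (\<lambda>a. ball a (r / 2)) A"
    by (rule exists_net[OF r])
  note vr = v_pos[OF r]
  have \<tau>: "0 < ?\<tau>" using q by simp
  have \<sigma>: "0 < ?\<sigma>" using s by simp
  \<comment> \<open>The weight on the left is frozen at its supremum on each net ball; the bound \<open>weight\<close> below is uniform in the point.\<close>
  define W where "W a = (SUP y\<in>ball a r. inverse (epow (H y) ?\<sigma>))" for a
  define b where "b a = ennreal ((C * v r) powr ?\<tau>) * W a" for a
  let ?F = "\<lambda>x. epow (f x) 2 * inverse (epow (h x) ?\<sigma>)"
  have cell: "(\<integral>\<^sup>+x\<in>ball a r. epow (g x) 2 * inverse (epow (H x) ?\<sigma>) \<partial>M)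
      \<le> b a * epow (\<integral>\<^sup>+x\<in>ball a r. epow (g x) q \<partial>M) (2 / q)" for a
  proof -
    have "(\<integral>\<^sup>+x\<in>ball a r. epow (g x) 2 * inverse (epow (H x) ?\<sigma>) \<partial>M)
        \<le> (\<integral>\<^sup>+x. W a * (epow (g x) 2 * epow 1 ?\<tau> * indicator (ball a r) x) \<partial>M)"
    proof (rule nn_integral_mono)
      fix x
      show "epow (g x) 2 * inverse (epow (H x) ?\<sigma>) * indicator (ball a r) x
          \<le> W a * (epow (g x) 2 * epow 1 ?\<tau> * indicator (ball a r) x)"
      proof (cases "x \<in> ball a r")
        case True
        then have "inverse (epow (H x) ?\<sigma>) \<le> W a" unfolding W_def by (rule SUP_upper)
        with True show ?thesis by (simp add: mult.commute[of "W a"] mult_left_mono)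
      qed simp
    qed
    also have "\<dots> = W a * (\<integral>\<^sup>+x\<in>ball a r. epow (g x) 2 * epow 1 ?\<tau> \<partial>M)"
      by (rule nn_integral_cmult) measurable
    also have "\<dots> \<le> W a * (epow (\<integral>\<^sup>+x\<in>ball a r. epow (g x) q \<partial>M) (2 / q) * epow (\<integral>\<^sup>+x\<in>ball a r. 1 \<partial>M) ?\<tau>)"
      by (intro mult_left_mono Hoelder_ball_weight q) auto
    also have "epow (\<integral>\<^sup>+x\<in>ball a r. 1 \<partial>M) ?\<tau> \<le> epow (ennreal (C * v r)) ?\<tau>"
      using ball_upper[OF r, of a] \<tau> by (intro epow_mono) auto
    also have "epow (ennreal (C * v r)) ?\<tau> = ennreal ((C * v r) powr ?\<tau>)"
      using C_pos vr by (simp add: epow_ennreal)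
    finally have "(\<integral>\<^sup>+x\<in>ball a r. epow (g x) 2 * inverse (epow (H x) ?\<sigma>) \<partial>M)
        \<le> W a * (epow (\<integral>\<^sup>+x\<in>ball a r. epow (g x) q \<partial>M) (2 / q) * ennreal ((C * v r) powr ?\<tau>))"
      by (simp add: mult_left_mono)
    then show ?thesis unfolding b_def by (simp only: mult_ac)
  qed
  have pointwise: "epow (f x) s \<le> epow (?F x) (s / 2) * epow (h x) (1 - s / 2)" for x
  proof (cases "h x = 0")
    case False
    obtain u where u: "h x = ennreal u" "0 < u"
      using False h_fin[of x] by (cases "h x") (auto simp: ennreal_less_zero_iff[symmetric] zero_less_iff_neq_zero)
    have "epow (?F x) (s / 2) * epow (h x) (1 - s / 2)
        = epow (f x) s * (epow (inverse (epow (h x) ?\<sigma>)) (s / 2) * epow (h x) (1 - s / 2))"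
      by (simp add: epow_mult epow_epow mult.assoc)
    also have "epow (inverse (epow (h x) ?\<sigma>)) (s / 2) * epow (h x) (1 - s / 2) = 1"
    proof -
      have "inverse (epow (h x) ?\<sigma>) = ennreal (u powr (- ?\<sigma>))"
        unfolding powr_minus using u by (simp add: epow_ennreal inverse_ennreal)
      then have "epow (inverse (epow (h x) ?\<sigma>)) (s / 2) = ennreal (u powr (- (?\<sigma> * (s / 2))))"
        by (simp only: epow_ennreal powr_ge_zero powr_powr mult_minus_left)
      moreover have "- (?\<sigma> * (s / 2)) + (1 - s / 2) = 0" using s by (simp add: field_simps)
      then have "u powr (- (?\<sigma> * (s / 2))) * u powr (1 - s / 2) = 1"
        using u by (simp only: powr_add[symmetric]) simp
      ultimately show ?thesis
        using u by (simp only: epow_ennreal ennreal_mult[symmetric] powr_ge_zero less_imp_le) simp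
    qed
    finally show ?thesis by simp
  qed (simp add: f0)
  have each: "(\<integral>\<^sup>+a. b a * (ennreal (v r powr (2 / q - 2 / s)) *
         epow (\<integral>\<^sup>+y\<in>ball a (2 ^ (k + 1) * r). epow (f y) s \<partial>M) (2 / s)) \<partial>count_space A)
       \<le> ennreal (small_exponent_const s q * (2 ^ k) powr (2 * n / s)) * (\<integral>\<^sup>+x. ?F x \<partial>M)" for k :: nat
  proof -
    define t where "t = (2 ^ k :: real)"
    have t: "1 \<le> t" "0 < t" by (simp_all add: t_def)
    define R where "R = 2 * t * r"
    have R: "0 < R" "2 ^ (k + 1) * r = R" using t r by (simp_all add: R_def t_def)
    let ?m = "2 powr n * (4 * t) powr n * v r"
    have weight: "W a * epow (\<integral>\<^sup>+x\<in>ball a R. h x \<partial>M) ?\<sigma> \<le> ennreal (?m powr ?\<sigma>)" for a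
      unfolding W_def SUP_mult_right_ennreal
    proof (rule SUP_least)
      fix y assume y: "y \<in> ball a r"
      have sub: "ball a R \<subseteq> ball y (4 * t * r)"
      proof
        fix z assume "z \<in> ball a R"
        then have "dist a z < 2 * t * r" "dist a y < r" "r \<le> t * r"
          using y t r by (simp_all add: R_def)
        then have "dist y z < 4 * t * r"
          using dist_triangle[of y z a] t r mult_pos_pos[of t r] unfolding dist_commute[of y a] by linarith
        then show "z \<in> ball y (4 * t * r)" by simp
      qed
      have "(\<integral>\<^sup>+x\<in>ball a R. h x \<partial>M) \<le> ennreal ?m * H y"
        by (rule dominates_averages_ball[OF H r _ sub]) (use t in simp)
      then have "epow (\<integral>\<^sup>+x\<in>ball a R. h x \<partial>M) ?\<sigma> \<le> epow (ennreal ?m * H y) ?\<sigma>"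
        using \<sigma> by (intro epow_mono) auto
      also have "\<dots> = ennreal (?m powr ?\<sigma>) * epow (H y) ?\<sigma>"
        using vr by (simp add: epow_mult epow_ennreal)
      finally have "inverse (epow (H y) ?\<sigma>) * epow (\<integral>\<^sup>+x\<in>ball a R. h x \<partial>M) ?\<sigma>
          \<le> inverse (epow (H y) ?\<sigma>) * (ennreal (?m powr ?\<sigma>) * epow (H y) ?\<sigma>)"
        by (rule mult_left_mono) simp
      also have "\<dots> = ennreal (?m powr ?\<sigma>) * (epow (H y) ?\<sigma> * inverse (epow (H y) ?\<sigma>))"
        by (simp add: mult_ac)
      also have "\<dots> \<le> ennreal (?m powr ?\<sigma>) * 1"
      proof (rule mult_left_mono)
        have "u * inverse u \<le> 1" for u :: ennreal
        proof (cases "u = 0 \<or> u = top")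
          case False
          then have "u / u = 1" by (intro ennreal_divide_self) (auto simp: less_top[symmetric])
          then show ?thesis by (simp add: divide_ennreal_def)
        qed auto
        then show "epow (H y) ?\<sigma> * inverse (epow (H y) ?\<sigma>) \<le> 1" .
      qed simp
      finally show "inverse (epow (H y) ?\<sigma>) * epow (\<integral>\<^sup>+x\<in>ball a R. h x \<partial>M) ?\<sigma> \<le> ennreal (?m powr ?\<sigma>)"
        by simp
    qed
    have term_le: "b a * (ennreal (v r powr (2 / q - 2 / s)) * epow (\<integral>\<^sup>+y\<in>ball a R. epow (f y) s \<partial>M) (2 / s))
        \<le> ennreal ((C * v r) powr ?\<tau> * v r powr (2 / q - 2 / s) * ?m powr ?\<sigma>) * (\<integral>\<^sup>+x\<in>ball a R. ?F x \<partial>M)" for a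
    proof -
      have "epow (\<integral>\<^sup>+y\<in>ball a R. epow (f y) s \<partial>M) (2 / s)
          \<le> (\<integral>\<^sup>+x\<in>ball a R. ?F x \<partial>M) * epow (\<integral>\<^sup>+x\<in>ball a R. h x \<partial>M) ?\<sigma>"
        by (intro Hoelder_ball_power s pointwise) measurable
      then have "b a * (ennreal (v r powr (2 / q - 2 / s)) * epow (\<integral>\<^sup>+y\<in>ball a R. epow (f y) s \<partial>M) (2 / s))
          \<le> b a * (ennreal (v r powr (2 / q - 2 / s)) * ((\<integral>\<^sup>+x\<in>ball a R. ?F x \<partial>M) * epow (\<integral>\<^sup>+x\<in>ball a R. h x \<partial>M) ?\<sigma>))"
        by (intro mult_left_mono) auto
      also have "\<dots> = ennreal ((C * v r) powr ?\<tau>) * ennreal (v r powr (2 / q - 2 / s)) * (\<integral>\<^sup>+x\<in>ball a R. ?F x \<partial>M)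
          * (W a * epow (\<integral>\<^sup>+x\<in>ball a R. h x \<partial>M) ?\<sigma>)"
        unfolding b_def by (simp only: mult_ac)
      also have "\<dots> \<le> ennreal ((C * v r) powr ?\<tau>) * ennreal (v r powr (2 / q - 2 / s)) * (\<integral>\<^sup>+x\<in>ball a R. ?F x \<partial>M)
          * ennreal (?m powr ?\<sigma>)"
        by (intro mult_left_mono weight) auto
      also have "\<dots> = ennreal ((C * v r) powr ?\<tau> * v r powr (2 / q - 2 / s) * ?m powr ?\<sigma>) * (\<integral>\<^sup>+x\<in>ball a R. ?F x \<partial>M)"
        by (simp only: ennreal_mult powr_ge_zero mult_nonneg_nonneg) (simp only: mult_ac)
      finally show ?thesis .
    qed
    have overlap: "(\<integral>\<^sup>+a. indicator (ball a R) x \<partial>count_space A) \<le> ennreal (2 powr n / (c * v r) * (C * ((4 * t) powr n * v r)))" for x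
    proof -
      have "ennreal (c * v r) * (\<integral>\<^sup>+a. 1 * indicator (ball a R) x \<partial>count_space A)
          \<le> ennreal (2 powr n) * (\<integral>\<^sup>+z\<in>ball x (R + r). 1 \<partial>M)"
        by (intro net_sum_le_ball_integral A r) auto
      also have "(\<integral>\<^sup>+z\<in>ball x (R + r). 1 \<partial>M) \<le> emeasure M (ball x (4 * t * r))"
        using t r by (simp, intro emeasure_mono subset_ball) (auto simp: R_def)
      also have "\<dots> \<le> ennreal (C * v (4 * t * r))" using t r by (intro ball_upper) simp
      also have "\<dots> \<le> ennreal (C * ((4 * t) powr n * v r))"
        using t r C_pos v_scale[of r "4 * t"] by (intro ennreal_leI mult_left_mono) auto
      finally have *: "ennreal (c * v r) * (\<integral>\<^sup>+a. indicator (ball a R) x \<partial>count_space A)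
          \<le> ennreal (2 powr n) * ennreal (C * ((4 * t) powr n * v r))"
        by (simp add: mult_left_mono)
      have "(\<integral>\<^sup>+a. indicator (ball a R) x \<partial>count_space A)
          = ennreal (1 / (c * v r)) * (ennreal (c * v r) * (\<integral>\<^sup>+a. indicator (ball a R) x \<partial>count_space A))"
        using c_pos vr by (simp add: mult.assoc[symmetric] ennreal_mult[symmetric])
      also have "\<dots> \<le> ennreal (1 / (c * v r)) * (ennreal (2 powr n) * ennreal (C * ((4 * t) powr n * v r)))"
        by (intro mult_left_mono *) simp
      also have "\<dots> = ennreal (2 powr n / (c * v r) * (C * ((4 * t) powr n * v r)))"
        using c_pos C_pos vr by (simp add: ennreal_mult[symmetric])
      finally show ?thesis .
    qed
    let ?D = "(C * v r) powr ?\<tau> * v r powr (2 / q - 2 / s) * ?m powr ?\<sigma>"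
      and ?O = "2 powr n / (c * v r) * (C * ((4 * t) powr n * v r))"
    have "(\<integral>\<^sup>+a. b a * (ennreal (v r powr (2 / q - 2 / s)) *
         epow (\<integral>\<^sup>+y\<in>ball a R. epow (f y) s \<partial>M) (2 / s)) \<partial>count_space A)
       \<le> (\<integral>\<^sup>+a. ennreal ?D * (\<integral>\<^sup>+x\<in>ball a R. ?F x \<partial>M) \<partial>count_space A)"
      by (intro nn_integral_mono term_le)
    also have "\<dots> = ennreal ?D * (\<integral>\<^sup>+a. (\<integral>\<^sup>+x\<in>ball a R. ?F x \<partial>M) \<partial>count_space A)"
      by (rule nn_integral_cmult) simp
    also have "(\<integral>\<^sup>+a. (\<integral>\<^sup>+x\<in>ball a R. ?F x \<partial>M) \<partial>count_space A)
        = (\<integral>\<^sup>+x. (\<integral>\<^sup>+a. ?F x * indicator (ball a R) x \<partial>count_space A) \<partial>M)"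
      by (rule nn_integral_count_space_nn_integral[OF A(1), symmetric]) measurable
    also have "\<dots> = (\<integral>\<^sup>+x. ?F x * (\<integral>\<^sup>+a. indicator (ball a R) x \<partial>count_space A) \<partial>M)"
      by (simp add: nn_integral_cmult)
    also have "\<dots> \<le> (\<integral>\<^sup>+x. ?F x * ennreal ?O \<partial>M)"
      by (intro nn_integral_mono mult_left_mono overlap) auto
    also have "\<dots> = (\<integral>\<^sup>+x. ?F x \<partial>M) * ennreal ?O"
      by (rule nn_integral_multc) measurable
    finally have "(\<integral>\<^sup>+a. b a * (ennreal (v r powr (2 / q - 2 / s)) *
         epow (\<integral>\<^sup>+y\<in>ball a R. epow (f y) s \<partial>M) (2 / s)) \<partial>count_space A)
       \<le> ennreal ?D * ((\<integral>\<^sup>+x. ?F x \<partial>M) * ennreal ?O)"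
      by (simp add: mult_left_mono)
    also have "\<dots> = ennreal (?D * ?O) * (\<integral>\<^sup>+x. ?F x \<partial>M)"
      using c_pos C_pos vr by (subst ennreal_mult) (auto simp: mult_ac)
    also have "?D * ?O = small_exponent_const s q * t powr (2 * n / s)"
    proof -
      have e1: "?m powr ?\<sigma> = (2 powr n * 4 powr n) powr ?\<sigma> * t powr (n * ?\<sigma>) * v r powr ?\<sigma>"
        using t vr by (simp add: powr_mult powr_powr mult.assoc)
      have e2: "(C * v r) powr ?\<tau> = C powr ?\<tau> * v r powr ?\<tau>"
        using C_pos vr by (simp add: powr_mult)
      have e3: "(4 * t) powr n = 4 powr n * t powr n" using t by (simp add: powr_mult)
      have v1: "v r powr ?\<tau> * (v r powr (2 / q - 2 / s) * v r powr ?\<sigma>) = 1"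
        using vr by (simp add: powr_add[symmetric])
      have t1: "t powr (n * ?\<sigma>) * t powr n = t powr (2 * n / s)"
        using s by (simp add: powr_add[symmetric] field_simps)
      have alg: "(E * p1) * p2 * (D * x1 * p3) * (N / (c * v r) * (C * ((F * x2) * v r)))
          = E * D * (N / c) * (C * F) * (x1 * x2) * (p1 * (p2 * p3))" for p1 p2 p3 E x1 x2 N D F :: real
        using vr c_pos by (simp add: field_simps)
      show ?thesis
        unfolding e1 unfolding e2 e3 alg t1 v1 small_exponent_const_def by simp
    qed
    finally show ?thesis unfolding R t_def .
  qed
  have "(\<integral>\<^sup>+x. epow (g x) 2 * inverse (epow (H x) ?\<sigma>) \<partial>M)
      \<le> (\<integral>\<^sup>+a. (\<integral>\<^sup>+x\<in>ball a r. epow (g x) 2 * inverse (epow (H x) ?\<sigma>) \<partial>M) \<partial>count_space A)"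
    by (intro integral_le_sum_over_net A) measurable
  also have "\<dots> \<le> (\<integral>\<^sup>+a. b a * epow (\<integral>\<^sup>+x\<in>ball a r. epow (g x) q \<partial>M) (2 / q) \<partial>count_space A)"
    by (intro nn_integral_mono cell)
  also have "\<dots> \<le> ennreal (K * small_exponent_const s q * dyadic_series (2 * (\<kappa> - n / s))) * (\<integral>\<^sup>+x. ?F x \<partial>M)"
    using c_pos C_pos by (intro sum_over_net_locally_dominated[OF dom \<kappa> K] each s) (auto simp: small_exponent_const_def)
  finally show ?thesis .
qed

end

section \<open>Square functions\<close>

lemma epow_mult_inverse_le:
  "x \<noteq> top \<Longrightarrow> x * inverse (epow x (1 - a)) \<le> epow x a"
proof (cases x)
  case (real u)
  show ?thesis
  proof (cases "u = 0")
    case False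
    then have "0 < u" using real by simp
    then have "x * inverse (epow x (1 - a)) = ennreal (u * inverse (u powr (1 - a)))"
      using real by (simp add: epow_ennreal inverse_ennreal ennreal_mult)
    also have "u * inverse (u powr (1 - a)) = u powr a"
      using \<open>0 < u\<close> by (simp add: powr_diff)
    finally show ?thesis using real by (simp add: epow_ennreal)
  qed (use real in simp)
qed simp

lemma epow_le_mult_cancel:
  assumes "y \<noteq> top" "0 < \<theta>" "y \<le> z * epow y (1 - \<theta>)"
  shows "y \<le> epow z (1 / \<theta>)"
proof (cases "y = 0")
  case False
  have "epow y (1 - \<theta>) * epow y \<theta> \<le> epow y (1 - \<theta>) * z"
    using assms(3) by (simp add: epow_add mult.commute)
  then have "epow y \<theta> \<le> z"
    using False assms(1) by (subst (asm) ennreal_mult_le_mult_iff) auto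
  then show ?thesis using assms(2) by (rule epow_le_cancel)
qed simp

lemma epow_divide_cancel: "b \<noteq> 0 \<Longrightarrow> epow (epow x (a / b)) b = epow x a"
  by (simp add: epow_epow)

context regular_space
begin

definition small_weight_const :: "real \<Rightarrow> real \<Rightarrow> real \<Rightarrow> real \<Rightarrow> real" where
  "small_weight_const K s q \<kappa> = K * small_exponent_const s q * dyadic_series (2 * (\<kappa> - n / s))"

definition large_weight_const :: "real \<Rightarrow> real \<Rightarrow> real \<Rightarrow> real \<Rightarrow> real" where
  "large_weight_const K s q \<kappa> = K * large_exponent_const s q * dyadic_series (2 * (\<kappa> - n / s))"

lemma dyadic_series_pos: "0 < \<rho> \<Longrightarrow> 0 < dyadic_series \<rho>"
  unfolding dyadic_series_def by (intro suminf_pos dyadic_summable) auto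

lemma small_weight_const_pos: "0 < K \<Longrightarrow> n / s < \<kappa> \<Longrightarrow> 0 < small_weight_const K s q \<kappa>"
  using C_pos c_pos unfolding small_weight_const_def small_exponent_const_def
  by (intro mult_pos_pos dyadic_series_pos divide_pos_pos) auto

lemma large_weight_const_nonneg: "0 \<le> K \<Longrightarrow> n / s < \<kappa> \<Longrightarrow> 0 \<le> large_weight_const K s q \<kappa>"
  using C_pos c_pos unfolding large_weight_const_def large_exponent_const_def
  by (intro mult_nonneg_nonneg dyadic_series_nonneg divide_nonneg_nonneg) auto

lemma maximal_const_pos: "1 < a \<Longrightarrow> 0 < maximal_const a"
  using C_pos unfolding maximal_const_def
  by (intro mult_pos_pos divide_pos_pos) auto

text \<open>Reversed duality: with \<open>w = F^(1 - p/2)\<close> the weighted inequality bounds \<open>\<integral> G/W\<close> by a multiple of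
  \<open>\<integral> F^(p/2)\<close>, and Hoelder's inequality recovers \<open>\<integral> G^(p/2)\<close> from \<open>\<integral> G/W\<close> and
  \<open>\<integral> W^(p/(2 - p))\<close>. The maximal theorem is applied with the exponent \<open>(2/s - 1) p/(2 - p)\<close>, which is
  greater than 1 exactly if \<open>p > s\<close>.\<close>

lemma square_function_below_2:
  assumes s: "0 < s" "s < 2" and q: "2 < q" and \<kappa>: "n / s < \<kappa>" and K: "0 < K"
    and p: "s < p" "p < 2" and J: "finite J"
    and r: "\<And>j. j \<in> J \<Longrightarrow> 0 < r j"
    and meas: "\<And>j. j \<in> J \<Longrightarrow> f j \<in> borel_measurable M" "\<And>j. j \<in> J \<Longrightarrow> g j \<in> borel_measurable M"
    and fin: "\<And>j x. j \<in> J \<Longrightarrow> f j x < top"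
    and dom: "\<And>j. j \<in> J \<Longrightarrow> locally_dominated K s q \<kappa> (r j) (g j) (f j)"
  shows "(\<integral>\<^sup>+x. epow (\<Sum>j\<in>J. epow (g j x) 2) (p / 2) \<partial>M)
    \<le> ennreal (small_weight_const K s q \<kappa> powr (p / 2) * maximal_const ((2 / s - 1) * (p / (2 - p))) powr (1 - p / 2))
      * (\<integral>\<^sup>+x. epow (\<Sum>j\<in>J. epow (f j x) 2) (p / 2) \<partial>M)"
proof -
  define F where "F x = (\<Sum>j\<in>J. epow (f j x) 2)" for x
  define G where "G x = (\<Sum>j\<in>J. epow (g j x) 2)" for x
  note [measurable] = meas
  have [measurable]: "F \<in> borel_measurable M" "G \<in> borel_measurable M"
    unfolding F_def G_def by measurable
  have F_fin: "F x < top" for x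
    unfolding F_def using fin J by simp
  let ?\<sigma> = "2 / s - 1"
  have \<sigma>: "0 < ?\<sigma>" using s by simp
  let ?a = "?\<sigma> * (p / (2 - p))"
  have a: "1 < ?a"
    using s p by (simp add: field_simps)
  let ?D = "small_weight_const K s q \<kappa>" and ?m = "maximal_const ?a"
  have D: "0 < ?D" and m: "0 < ?m"
    using small_weight_const_pos[OF K \<kappa>] maximal_const_pos[OF a] by blast+
  define h where "h x = epow (F x) ((1 - p / 2) / ?\<sigma>)" for x
  define W where "W x = epow (maximal_function h x) ?\<sigma>" for x
  have [measurable]: "h \<in> borel_measurable M" unfolding h_def by measurable
  have [measurable]: "W \<in> borel_measurable M" unfolding W_def by measurable
  have h\<sigma>: "epow (h x) ?\<sigma> = epow (F x) (1 - p / 2)" for x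
    unfolding h_def by (rule epow_divide_cancel) (use \<sigma> in linarith)
  let ?X = "\<integral>\<^sup>+x. epow (F x) (p / 2) \<partial>M"
  have weighted: "(\<integral>\<^sup>+x. G x * inverse (W x) \<partial>M) \<le> ennreal ?D * ?X"
  proof -
    have "(\<integral>\<^sup>+x. G x * inverse (W x) \<partial>M) = (\<Sum>j\<in>J. \<integral>\<^sup>+x. epow (g j x) 2 * inverse (W x) \<partial>M)"
      unfolding G_def sum_distrib_right using J by (intro nn_integral_sum) measurable
    also have "\<dots> \<le> (\<Sum>j\<in>J. ennreal ?D * (\<integral>\<^sup>+x. epow (f j x) 2 * inverse (epow (h x) ?\<sigma>) \<partial>M))"
    proof (rule sum_mono)
      fix j assume j: "j \<in> J"
      have "f j x = 0" if "h x = 0" for x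
        using that j J by (simp add: h_def F_def)
      moreover have "h x < top" for x using F_fin by (simp add: h_def)
      ultimately show "(\<integral>\<^sup>+x. epow (g j x) 2 * inverse (W x) \<partial>M)
          \<le> ennreal ?D * (\<integral>\<^sup>+x. epow (f j x) 2 * inverse (epow (h x) ?\<sigma>) \<partial>M)"
        unfolding W_def small_weight_const_def using j
        by (intro weighted_small_exponent[where r = "r j"] s q \<kappa> less_imp_le[OF K] r meas dom maximal_function_dominates_averages) auto
    qed
    also have "\<dots> = ennreal ?D * (\<integral>\<^sup>+x. F x * inverse (epow (F x) (1 - p / 2)) \<partial>M)"
      unfolding h\<sigma> sum_distrib_left[symmetric] F_def sum_distrib_right using J
      by (subst nn_integral_sum) auto
    also have "\<dots> \<le> ennreal ?D * ?X"
      by (intro mult_left_mono nn_integral_mono epow_mult_inverse_le less_imp_neq[OF F_fin]) simp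
    finally show ?thesis .
  qed
  have max: "(\<integral>\<^sup>+x. epow (W x) (p / (2 - p)) \<partial>M) \<le> ennreal ?m * ?X"
  proof -
    have "(\<integral>\<^sup>+x. epow (W x) (p / (2 - p)) \<partial>M) = (\<integral>\<^sup>+x. epow (maximal_function h x) ?a \<partial>M)"
      by (simp add: W_def epow_epow)
    also have "\<dots> \<le> ennreal ?m * (\<integral>\<^sup>+x. epow (h x) ?a \<partial>M)"
      by (rule maximal_function_strong_type[OF _ a]) measurable
    also have "(\<integral>\<^sup>+x. epow (h x) ?a \<partial>M) = ?X"
    proof -
      have cancel: "x / z * (z * y) = x * y" if "z \<noteq> 0" for x y z :: real
        using that by simp
      have "(1 - p / 2) / ?\<sigma> * ?a = (1 - p / 2) * (p / (2 - p))"
        by (rule cancel) (use \<sigma> in linarith)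
      also have "\<dots> = p / 2" using p by (simp add: field_simps)
      finally show ?thesis by (simp only: h_def epow_epow)
    qed
    finally show ?thesis .
  qed
  show ?thesis
  proof (cases "?X < top")
    case False
    then have X: "?X = top" by (simp add: less_top[symmetric])
    then show ?thesis using D m unfolding F_def by (simp add: ennreal_mult_top)
  next
    case True
    then have "ennreal ?D * ?X < top" "ennreal ?m * ?X < top"
      by (simp_all add: ennreal_mult_less_top)
    from le_less_trans[OF weighted this(1)] le_less_trans[OF max this(2)]
    have fin_int: "(\<integral>\<^sup>+x. G x * inverse (W x) \<partial>M) \<noteq> \<infinity>" "(\<integral>\<^sup>+x. epow (W x) (p / (2 - p)) \<partial>M) \<noteq> \<infinity>"
      by simp_all
    \<comment> \<open>Where \<open>W = 0\<close>, finiteness of \<open>G/W\<close> forces \<open>G = 0\<close>, so that \<open>G = (G/W) W\<close> almost everywhere.\<close>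
    have "AE x in M. G x * inverse (W x) \<noteq> \<infinity>"
      by (rule nn_integral_PInf_AE[OF _ fin_int(1)]) measurable
    moreover have "AE x in M. epow (W x) (p / (2 - p)) \<noteq> \<infinity>"
      by (rule nn_integral_PInf_AE[OF _ fin_int(2)]) measurable
    ultimately have "AE x in M. epow (G x) (p / 2)
        \<le> epow (G x * inverse (W x)) (p / 2) * epow (epow (W x) (p / (2 - p))) (1 - p / 2)"
    proof eventually_elim
      case (elim x)
      show ?case
      proof (cases "W x = 0")
        case True
        then have "G x = 0" using elim(1) by (simp add: ennreal_mult_top split: if_splits)
        then show ?thesis by simp
      next
        case False
        with elim(2) obtain u where u: "W x = ennreal u" "0 < u"
          by (cases "W x") (auto simp: less_le)
        have e: "p / (2 - p) * (1 - p / 2) = p / 2" using p by (simp add: field_simps)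
        have "inverse (W x) * W x = 1"
          using u by (simp add: inverse_ennreal ennreal_mult[symmetric])
        then have "epow (G x) (p / 2) = epow (G x * inverse (W x) * W x) (p / 2)"
          by (simp add: mult.assoc)
        then show ?thesis unfolding epow_epow e by (simp only: epow_mult order_refl)
      qed
    qed
    then have "(\<integral>\<^sup>+x. epow (G x) (p / 2) \<partial>M)
        \<le> (\<integral>\<^sup>+x. epow (G x * inverse (W x)) (p / 2) * epow (epow (W x) (p / (2 - p))) (1 - p / 2) \<partial>M)"
      by (rule nn_integral_mono_AE)
    also have "\<dots> \<le> epow (\<integral>\<^sup>+x. G x * inverse (W x) \<partial>M) (p / 2) * epow (\<integral>\<^sup>+x. epow (W x) (p / (2 - p)) \<partial>M) (1 - p / 2)"
      using s p by (intro nn_integral_Hoelder) auto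
    also have "\<dots> \<le> epow (ennreal ?D * ?X) (p / 2) * epow (ennreal ?m * ?X) (1 - p / 2)"
      using s p by (intro mult_mono epow_mono weighted max) auto
    also have "\<dots> = ennreal (?D powr (p / 2)) * ennreal (?m powr (1 - p / 2)) * (epow ?X (p / 2) * epow ?X (1 - p / 2))"
      using D m by (simp add: epow_mult epow_ennreal mult_ac)
    also have "\<dots> = ennreal (?D powr (p / 2) * ?m powr (1 - p / 2)) * ?X"
      by (simp add: epow_sum_split ennreal_mult)
    finally show ?thesis unfolding F_def G_def .
  qed
qed

lemma square_function_at_2:
  assumes s: "0 < s" "s < 2" and q: "2 < q" and \<kappa>: "n / s < \<kappa>" and K: "0 < K" and J: "finite J"
    and r: "\<And>j. j \<in> J \<Longrightarrow> 0 < r j"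
    and meas: "\<And>j. j \<in> J \<Longrightarrow> f j \<in> borel_measurable M" "\<And>j. j \<in> J \<Longrightarrow> g j \<in> borel_measurable M"
    and dom: "\<And>j. j \<in> J \<Longrightarrow> locally_dominated K s q \<kappa> (r j) (g j) (f j)"
  shows "(\<integral>\<^sup>+x. (\<Sum>j\<in>J. epow (g j x) 2) \<partial>M)
    \<le> ennreal (C powr (2 / s - 1) * small_weight_const K s q \<kappa>) * (\<integral>\<^sup>+x. (\<Sum>j\<in>J. epow (f j x) 2) \<partial>M)"
proof -
  let ?\<sigma> = "2 / s - 1" and ?D = "small_weight_const K s q \<kappa>"
  note D = small_weight_const_pos[OF K \<kappa>, of q]
  have C: "0 < C powr ?\<sigma>" using C_pos by simp
  have "dominates_averages (\<lambda>_. ennreal C) (\<lambda>_. 1)"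
    unfolding dominates_averages_def
  proof (intro allI impI)
    fix y R :: _ assume "0 < (R::real)"
    then have "(\<integral>\<^sup>+x\<in>ball y R. 1 \<partial>M) \<le> ennreal (C * v R)" using ball_upper[of R y] by simp
    also have "\<dots> \<le> ennreal (2 powr n * v R) * ennreal C"
      using C_pos v_pos[OF \<open>0 < R\<close>] n_pos ge_one_powr_ge_zero[of 2 n]
      by (subst ennreal_mult[symmetric]) (auto intro!: ennreal_leI)
    finally show "(\<integral>\<^sup>+x\<in>ball y R. 1 \<partial>M) \<le> ennreal (2 powr n * v R) * ennreal C" .
  qed
  then have each: "(\<integral>\<^sup>+x. epow (g j x) 2 \<partial>M) \<le> ennreal (C powr ?\<sigma> * ?D) * (\<integral>\<^sup>+x. epow (f j x) 2 \<partial>M)"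
    if j: "j \<in> J" for j
  proof -
    note [measurable] = meas[OF j]
    have "(\<integral>\<^sup>+x. epow (g j x) 2 * inverse (epow (ennreal C) ?\<sigma>) \<partial>M)
        \<le> ennreal ?D * (\<integral>\<^sup>+x. epow (f j x) 2 * inverse (epow 1 ?\<sigma>) \<partial>M)"
      unfolding small_weight_const_def using \<open>dominates_averages _ _\<close>
      by (intro weighted_small_exponent[where r = "r j"] s q \<kappa> less_imp_le[OF K] r j meas dom) auto
    then have *: "(\<integral>\<^sup>+x. epow (g j x) 2 \<partial>M) * ennreal (1 / C powr ?\<sigma>) \<le> ennreal ?D * (\<integral>\<^sup>+x. epow (f j x) 2 \<partial>M)"
      using C C_pos by (simp add: epow_ennreal inverse_ennreal nn_integral_multc inverse_eq_divide)
    have "(\<integral>\<^sup>+x. epow (g j x) 2 \<partial>M) = ennreal (C powr ?\<sigma>) * ((\<integral>\<^sup>+x. epow (g j x) 2 \<partial>M) * ennreal (1 / C powr ?\<sigma>))"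
    proof -
      have "ennreal (C powr ?\<sigma>) * ennreal (1 / C powr ?\<sigma>) = 1"
        using C by (simp add: ennreal_mult[symmetric])
      then have "(\<integral>\<^sup>+x. epow (g j x) 2 \<partial>M)
          = ennreal (C powr ?\<sigma>) * ennreal (1 / C powr ?\<sigma>) * (\<integral>\<^sup>+x. epow (g j x) 2 \<partial>M)" by simp
      then show ?thesis by (simp only: mult_ac)
    qed
    also have "\<dots> \<le> ennreal (C powr ?\<sigma>) * (ennreal ?D * (\<integral>\<^sup>+x. epow (f j x) 2 \<partial>M))"
      by (intro mult_left_mono *) simp
    finally show ?thesis using D by (simp add: ennreal_mult mult.assoc)
  qed
  have "(\<integral>\<^sup>+x. (\<Sum>j\<in>J. epow (g j x) 2) \<partial>M) = (\<Sum>j\<in>J. \<integral>\<^sup>+x. epow (g j x) 2 \<partial>M)"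
    using meas by (intro nn_integral_sum) auto
  also have "\<dots> \<le> (\<Sum>j\<in>J. ennreal (C powr ?\<sigma> * ?D) * (\<integral>\<^sup>+x. epow (f j x) 2 \<partial>M))"
    by (intro sum_mono each)
  also have "\<dots> = ennreal (C powr ?\<sigma> * ?D) * (\<integral>\<^sup>+x. (\<Sum>j\<in>J. epow (f j x) 2) \<partial>M)"
    using meas by (subst nn_integral_sum) (auto simp: sum_distrib_left)
  finally show ?thesis .
qed

text \<open>Duality: testing \<open>G\<close> against \<open>w = G^(p/2 - 1)\<close> gives \<open>\<integral> G^(p/2)\<close>. The integral of
  \<open>w^(p/(p - 2))\<close> on the right is again \<open>\<integral> G^(p/2)\<close>, to a power less than 1, and has to be divided out; as it is
  not known to be finite, \<open>G\<close> is first truncated in height and in space. The maximal theorem is used with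
  the exponents \<open>p/(p - 2)\<close> and \<open>(1 - 2/q) p/(p - 2)\<close>; the second one is greater than 1 because \<open>p < q\<close>.\<close>

lemma square_function_above_2:
  assumes s: "0 < s" "s < 2" and q: "p < q" and \<kappa>: "n / s < \<kappa>" and K: "0 < K"
    and p: "2 < p" and J: "finite J"
    and r: "\<And>j. j \<in> J \<Longrightarrow> 0 < r j"
    and meas: "\<And>j. j \<in> J \<Longrightarrow> f j \<in> borel_measurable M" "\<And>j. j \<in> J \<Longrightarrow> g j \<in> borel_measurable M"
    and fin: "\<And>j x. j \<in> J \<Longrightarrow> g j x < top"
    and dom: "\<And>j. j \<in> J \<Longrightarrow> locally_dominated K s q \<kappa> (r j) (g j) (f j)"
  shows "(\<integral>\<^sup>+x. epow (\<Sum>j\<in>J. epow (g j x) 2) (p / 2) \<partial>M)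
    \<le> ennreal ((large_weight_const K s q \<kappa> *
          (maximal_const (p / (p - 2)) * maximal_const ((1 - 2 / q) * (p / (p - 2)))) powr (1 - 2 / p)) powr (p / 2))
      * (\<integral>\<^sup>+x. epow (\<Sum>j\<in>J. epow (f j x) 2) (p / 2) \<partial>M)"
proof -
  define F where "F x = (\<Sum>j\<in>J. epow (f j x) 2)" for x
  define G where "G x = (\<Sum>j\<in>J. epow (g j x) 2)" for x
  note [measurable] = meas
  have [measurable]: "F \<in> borel_measurable M" "G \<in> borel_measurable M"
    unfolding F_def G_def by measurable
  have G_fin: "G x < top" for x
    unfolding G_def using fin J by simp
  have q2: "2 < q" using p q by simp
  let ?\<tau> = "1 - 2 / q" and ?b = "p / (p - 2)"
  have \<tau>: "0 < ?\<tau>" using q2 by simp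
  have b: "1 < ?b" "1 < ?\<tau> * ?b"
    using p q q2 by (simp_all add: field_simps)
  let ?D = "large_weight_const K s q \<kappa>" and ?m = "maximal_const ?b * maximal_const (?\<tau> * ?b)"
  let ?X = "\<integral>\<^sup>+x. epow (F x) (p / 2) \<partial>M"
  note D = large_weight_const_nonneg[OF less_imp_le[OF K] \<kappa>, of q]
  have m: "0 \<le> ?m" using b by (simp add: maximal_const_pos less_imp_le)
  have weighted: "(\<integral>\<^sup>+x. G x * w x \<partial>M)
      \<le> ennreal (?D * ?m powr (1 - 2 / p)) * epow ?X (2 / p) * epow (\<integral>\<^sup>+x. epow (w x) ?b \<partial>M) (1 - 2 / p)"
    if [measurable]: "w \<in> borel_measurable M" for w
  proof -
    define h where "h x = epow (w x) (1 / ?\<tau>)" for x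
    define W where "W x = epow (maximal_function h x) ?\<tau>" for x
    define V where "V = maximal_function W"
    have [measurable]: "h \<in> borel_measurable M" unfolding h_def by measurable
    have [measurable]: "W \<in> borel_measurable M" unfolding W_def by measurable
    have [measurable]: "V \<in> borel_measurable M" unfolding V_def by measurable
    have h\<tau>: "epow (h x) ?\<tau> = w x" for x
      unfolding h_def by (rule trans[OF epow_divide_cancel]) (use \<tau> in linarith, simp)
    have "(\<integral>\<^sup>+x. G x * w x \<partial>M) = (\<Sum>j\<in>J. \<integral>\<^sup>+x. epow (g j x) 2 * epow (h x) ?\<tau> \<partial>M)"
      unfolding G_def sum_distrib_right h\<tau> using J by (intro nn_integral_sum) measurable
    also have "\<dots> \<le> (\<Sum>j\<in>J. ennreal ?D * (\<integral>\<^sup>+x. epow (f j x) 2 * V x \<partial>M))"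
    proof (rule sum_mono)
      fix j assume j: "j \<in> J"
      show "(\<integral>\<^sup>+x. epow (g j x) 2 * epow (h x) ?\<tau> \<partial>M) \<le> ennreal ?D * (\<integral>\<^sup>+x. epow (f j x) 2 * V x \<partial>M)"
        unfolding large_weight_const_def V_def W_def using j
        by (intro weighted_large_exponent[where r = "r j" and H = "maximal_function h"]
            s q2 \<kappa> less_imp_le[OF K] r meas dom maximal_function_dominates_averages) auto
    qed
    also have "\<dots> = ennreal ?D * (\<integral>\<^sup>+x. F x * V x \<partial>M)"
      unfolding sum_distrib_left[symmetric] F_def sum_distrib_right using J
      by (subst nn_integral_sum) auto
    also have "(\<integral>\<^sup>+x. F x * V x \<partial>M)
        = (\<integral>\<^sup>+x. epow (epow (F x) (p / 2)) (2 / p) * epow (epow (V x) ?b) (1 - 2 / p) \<partial>M)"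
    proof -
      have "?b * (1 - 2 / p) = 1" using p by (simp add: field_simps)
      then show ?thesis using p by (simp add: epow_epow)
    qed
    also have "\<dots> \<le> epow ?X (2 / p) * epow (\<integral>\<^sup>+x. epow (V x) ?b \<partial>M) (1 - 2 / p)"
      using p by (intro nn_integral_Hoelder) auto
    finally have 1: "(\<integral>\<^sup>+x. G x * w x \<partial>M) \<le> ennreal ?D * (epow ?X (2 / p) * epow (\<integral>\<^sup>+x. epow (V x) ?b \<partial>M) (1 - 2 / p))"
      by (simp add: mult_left_mono)
    have "(\<integral>\<^sup>+x. epow (V x) ?b \<partial>M) \<le> ennreal (maximal_const ?b) * (\<integral>\<^sup>+x. epow (W x) ?b \<partial>M)"
      unfolding V_def by (intro maximal_function_strong_type b) measurable
    also have "(\<integral>\<^sup>+x. epow (W x) ?b \<partial>M) = (\<integral>\<^sup>+x. epow (maximal_function h x) (?\<tau> * ?b) \<partial>M)"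
      by (simp add: W_def epow_epow)
    also have "\<dots> \<le> ennreal (maximal_const (?\<tau> * ?b)) * (\<integral>\<^sup>+x. epow (h x) (?\<tau> * ?b) \<partial>M)"
      by (intro maximal_function_strong_type b) measurable
    also have "(\<integral>\<^sup>+x. epow (h x) (?\<tau> * ?b) \<partial>M) = (\<integral>\<^sup>+x. epow (w x) ?b \<partial>M)"
      unfolding epow_epow[symmetric] h\<tau> ..
    finally have 2: "(\<integral>\<^sup>+x. epow (V x) ?b \<partial>M) \<le> ennreal ?m * (\<integral>\<^sup>+x. epow (w x) ?b \<partial>M)"
      using b by (simp add: mult_left_mono ennreal_mult maximal_const_pos less_imp_le mult.assoc)
    have "(\<integral>\<^sup>+x. G x * w x \<partial>M) \<le> ennreal ?D * (epow ?X (2 / p) * epow (ennreal ?m * (\<integral>\<^sup>+x. epow (w x) ?b \<partial>M)) (1 - 2 / p))"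
      using p by (intro order_trans[OF 1] mult_left_mono epow_mono 2) auto
    also have "\<dots> = ennreal (?D * ?m powr (1 - 2 / p)) * epow ?X (2 / p) * epow (\<integral>\<^sup>+x. epow (w x) ?b \<partial>M) (1 - 2 / p)"
      using D m by (simp only: epow_mult epow_ennreal[OF m] ennreal_mult powr_ge_zero) (simp only: mult_ac)
    finally show ?thesis .
  qed
  obtain x0 :: 'a where True by blast
  \<comment> \<open>Truncating in height and in space makes the integral that is divided out finite.\<close>
  define w where "w N x = epow (min (G x) (of_nat N)) (p / 2 - 1) * indicator (ball x0 (real N)) x" for N :: nat and x
  have [measurable]: "w N \<in> borel_measurable M" for N unfolding w_def by measurable
  define Y where "Y N = (\<integral>\<^sup>+x. epow (w N x) ?b \<partial>M)" for N
  have wb: "epow (w N x) ?b = epow (min (G x) (of_nat N)) (p / 2) * indicator (ball x0 (real N)) x" for N x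
  proof -
    have "(p / 2 - 1) * ?b = p / 2" using p by (simp add: field_simps)
    then show ?thesis by (simp only: w_def epow_indicator epow_epow)
  qed
  have Y_le: "Y N \<le> ennreal ((?D * ?m powr (1 - 2 / p)) powr (p / 2)) * ?X" for N
  proof -
    have "Y N \<le> (\<integral>\<^sup>+x. epow (of_nat N) (p / 2) * indicator (ball x0 (real N)) x \<partial>M)"
      unfolding Y_def wb using p by (intro nn_integral_mono mult_right_mono epow_mono) auto
    also have "\<dots> = epow (of_nat N) (p / 2) * emeasure M (ball x0 (real N))"
      by (rule nn_integral_cmult_indicator) measurable
    also have "\<dots> < top"
      using emeasure_ball_finite by (simp add: ennreal_mult_less_top of_nat_less_top)
    finally have fin: "Y N \<noteq> top" by simp
    have "Y N \<le> (\<integral>\<^sup>+x. G x * w N x \<partial>M)"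
      unfolding Y_def
    proof (rule nn_integral_mono)
      fix x
      have "epow (min (G x) (of_nat N)) (p / 2) = min (G x) (of_nat N) * epow (min (G x) (of_nat N)) (p / 2 - 1)"
        using epow_add[of "min (G x) (of_nat N)" 1 "p / 2 - 1"] by simp
      also have "\<dots> \<le> G x * epow (min (G x) (of_nat N)) (p / 2 - 1)"
        by (intro mult_right_mono) auto
      finally show "epow (w N x) ?b \<le> G x * w N x"
        unfolding wb unfolding w_def by (simp add: indicator_def)
    qed
    also have "\<dots> \<le> ennreal (?D * ?m powr (1 - 2 / p)) * epow ?X (2 / p) * epow (Y N) (1 - 2 / p)"
      unfolding Y_def by (rule weighted) measurable
    finally have "Y N \<le> epow (ennreal (?D * ?m powr (1 - 2 / p)) * epow ?X (2 / p)) (1 / (2 / p))"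
      using p fin by (intro epow_le_mult_cancel) auto
    also have "\<dots> = ennreal ((?D * ?m powr (1 - 2 / p)) powr (p / 2)) * ?X"
      using p D by (simp add: epow_mult epow_epow epow_ennreal)
    finally show ?thesis .
  qed
  have inc: "incseq (\<lambda>N x. epow (w N x) ?b)"
    unfolding wb using p
    by (auto simp: incseq_def le_fun_def indicator_def intro!: epow_mono min.mono)
  have "(\<integral>\<^sup>+x. epow (G x) (p / 2) \<partial>M) \<le> (\<integral>\<^sup>+x. (SUP N. epow (w N x) ?b) \<partial>M)"
  proof (rule nn_integral_mono)
    fix x
    obtain N1 :: nat where N1: "G x < of_nat N1" using ennreal_Ex_less_of_nat[OF G_fin] by blast
    obtain N2 :: nat where N2: "dist x0 x < real N2" using reals_Archimedean2 by blast
    let ?N = "max N1 N2"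
    have "G x \<le> of_nat ?N" using N1 by (intro order_trans[OF less_imp_le[OF N1]]) simp
    then have "epow (w ?N x) ?b = epow (G x) (p / 2)" using N2 by (simp add: wb min_absorb1)
    then show "epow (G x) (p / 2) \<le> (SUP N. epow (w N x) ?b)"
      by (intro SUP_upper2[of ?N]) auto
  qed
  also have "\<dots> = (SUP N. Y N)"
    unfolding Y_def by (rule nn_integral_monotone_convergence_SUP[OF inc]) measurable
  also have "\<dots> \<le> ennreal ((?D * ?m powr (1 - 2 / p)) powr (p / 2)) * ?X"
    by (intro SUP_least Y_le)
  finally show ?thesis unfolding F_def G_def .
qed

theorem square_function_bound:
  assumes s: "0 < s" "s < 2" and q: "2 < q" and \<kappa>: "n / s < \<kappa>" and K: "0 < K"
    and p: "s < p" "p < q"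
  obtains \<Gamma> :: real where "0 \<le> \<Gamma>"
    "\<And>(J :: nat set) r f g. finite J \<Longrightarrow> (\<And>j. j \<in> J \<Longrightarrow> 0 < r j) \<Longrightarrow>
       (\<And>j. j \<in> J \<Longrightarrow> f j \<in> borel_measurable M) \<Longrightarrow> (\<And>j. j \<in> J \<Longrightarrow> g j \<in> borel_measurable M) \<Longrightarrow>
       (\<And>j x. j \<in> J \<Longrightarrow> f j x < top) \<Longrightarrow> (\<And>j x. j \<in> J \<Longrightarrow> g j x < top) \<Longrightarrow>
       (\<And>j. j \<in> J \<Longrightarrow> locally_dominated K s q \<kappa> (r j) (g j) (f j)) \<Longrightarrow>
       (\<integral>\<^sup>+x. epow (\<Sum>j\<in>J. epow (g j x) 2) (p / 2) \<partial>M)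
         \<le> ennreal \<Gamma> * (\<integral>\<^sup>+x. epow (\<Sum>j\<in>J. epow (f j x) 2) (p / 2) \<partial>M)"
proof -
  consider "p < 2" | "p = 2" | "2 < p" by linarith
  then show ?thesis
  proof cases
    case 1
    show ?thesis
      by (rule that[of "small_weight_const K s q \<kappa> powr (p / 2) * maximal_const ((2 / s - 1) * (p / (2 - p))) powr (1 - p / 2)"])
        (simp, rule square_function_below_2[OF s q \<kappa> K p(1) 1], assumption+)
  next
    case 2
    show ?thesis
    proof (rule that[of "C powr (2 / s - 1) * small_weight_const K s q \<kappa>"])
      show "0 \<le> C powr (2 / s - 1) * small_weight_const K s q \<kappa>"
        by (intro mult_nonneg_nonneg less_imp_le[OF small_weight_const_pos] K \<kappa>) simp
      fix J :: "nat set" and r f g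
      assume "finite J" "\<And>j. j \<in> J \<Longrightarrow> 0 < r j" "\<And>j. j \<in> J \<Longrightarrow> f j \<in> borel_measurable M"
        "\<And>j. j \<in> J \<Longrightarrow> g j \<in> borel_measurable M"
        "\<And>j. j \<in> J \<Longrightarrow> locally_dominated K s q \<kappa> (r j) (g j) (f j)"
      from square_function_at_2[OF s q \<kappa> K this]
      show "(\<integral>\<^sup>+x. epow (\<Sum>j\<in>J. epow (g j x) 2) (p / 2) \<partial>M)
          \<le> ennreal (C powr (2 / s - 1) * small_weight_const K s q \<kappa>) *
            (\<integral>\<^sup>+x. epow (\<Sum>j\<in>J. epow (f j x) 2) (p / 2) \<partial>M)"
        using 2 by simp
    qed
  next
    case 3
    show ?thesis
      by (rule that[of "(large_weight_const K s q \<kappa> *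
          (maximal_const (p / (p - 2)) * maximal_const ((1 - 2 / q) * (p / (p - 2)))) powr (1 - 2 / p)) powr (p / 2)"])
        (simp, rule square_function_above_2[OF s p(2) \<kappa> K 3], assumption+)
  qed
qed

end

section \<open>From off-diagonal estimates to local domination\<close>

lemma Lp_norm_epow: "0 < p \<Longrightarrow> Lp_norm p M f = epow (\<integral>\<^sup>+x. epow (ennreal (norm (f x))) p \<partial>M) (1 / p)"
  by (simp add: Lp_norm_def epow_def Let_def)

lemma Lp_space_iff:
  "0 < p \<Longrightarrow> f \<in> Lp_space p M \<longleftrightarrow>
     f \<in> borel_measurable M \<and> (\<integral>\<^sup>+x. epow (ennreal (cmod (f x))) p \<partial>M) < top"
  by (simp add: Lp_space_def Lp_norm_epow)

lemma Lp_space_cut: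
  assumes "0 < p" "f \<in> Lp_space p M" and [measurable]: "E \<in> sets M"
  shows "(\<lambda>y. indicator E y * f y) \<in> Lp_space p M"
proof -
  have [measurable]: "f \<in> borel_measurable M" and fin: "(\<integral>\<^sup>+x. epow (ennreal (cmod (f x))) p \<partial>M) < top"
    using assms by (simp_all add: Lp_space_iff)
  have "(\<integral>\<^sup>+x. epow (ennreal (cmod (indicator E x * f x))) p \<partial>M) \<le> (\<integral>\<^sup>+x. epow (ennreal (cmod (f x))) p \<partial>M)"
    using assms(1) by (intro nn_integral_mono epow_mono ennreal_leI) (auto simp: indicator_def)
  with fin show ?thesis using assms(1) by (simp add: Lp_space_iff)
qed

lemma Lp_space_2_cut_finite_measure:
  assumes s: "0 < s" "s < 2" and "f \<in> Lp_space 2 M" and [measurable]: "E \<in> sets M" and "emeasure M E < top"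
  shows "(\<lambda>y. indicator E y * f y) \<in> Lp_space s M"
proof -
  have [measurable]: "f \<in> borel_measurable M" and fin: "(\<integral>\<^sup>+x. epow (ennreal (cmod (f x))) 2 \<partial>M) < top"
    using assms by (simp_all add: Lp_space_iff)
  have "(\<integral>\<^sup>+x. epow (ennreal (cmod (indicator E x * f x))) s \<partial>M)
      = (\<integral>\<^sup>+x. epow (epow (ennreal (cmod (f x))) 2) (s / 2) * epow (indicator E x) (1 - s / 2) \<partial>M)"
    by (intro nn_integral_cong) (auto simp: indicator_def epow_epow)
  also have "\<dots> \<le> epow (\<integral>\<^sup>+x. epow (ennreal (cmod (f x))) 2 \<partial>M) (s / 2) * epow (\<integral>\<^sup>+x. indicator E x \<partial>M) (1 - s / 2)"
    using s by (intro nn_integral_Hoelder) auto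
  also have "\<dots> < top" using fin assms(5) by (simp add: ennreal_mult_less_top)
  finally show ?thesis using s by (simp add: Lp_space_iff)
qed

text \<open>A substitute for Minkowski's inequality that acts on \<open>q\<close>-th powers: Hoelder's inequality
  splits off the summable sequence \<open>2^(-\<eta> k)\<close>, which costs an arbitrarily small part of their dyadic decay.\<close>

lemma sum_powr_le_dyadic:
  assumes q: "1 < q" and \<eta>: "0 < \<eta>"
  shows "epow (\<Sum>k<m. a k) q
    \<le> ennreal (dyadic_series \<eta> powr (q - 1)) * (\<Sum>k<m. ennreal ((2 ^ k) powr (\<eta> * q)) * epow (a k) q)"
proof -
  let ?\<delta> = "\<lambda>k. ennreal ((2 ^ k) powr (- \<eta>))" and ?u = "\<lambda>k. ennreal ((2 ^ k) powr (\<eta> * (q - 1))) * epow (a k) q"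
  have split: "a k = epow (?u k) (1 / q) * epow (?\<delta> k) (1 - 1 / q)" for k
  proof -
    have "epow (?u k) (1 / q) * epow (?\<delta> k) (1 - 1 / q)
        = ennreal ((2 ^ k) powr (\<eta> * (q - 1) / q)) * ennreal ((2 ^ k) powr (- \<eta> * (1 - 1 / q))) * a k"
      using q by (simp add: epow_mult epow_epow epow_ennreal powr_powr mult_ac)
    also have "ennreal ((2 ^ k) powr (\<eta> * (q - 1) / q)) * ennreal ((2 ^ k) powr (- \<eta> * (1 - 1 / q))) = 1"
    proof -
      have "\<eta> * (q - 1) / q + (- \<eta> * (1 - 1 / q)) = 0" using q by (simp add: field_simps)
      then have "(2 ^ k :: real) powr (\<eta> * (q - 1) / q) * (2 ^ k) powr (- \<eta> * (1 - 1 / q)) = 1"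
        by (simp only: powr_add[symmetric]) simp
      then show ?thesis by (simp only: ennreal_mult[symmetric] powr_ge_zero) simp
    qed
    finally show ?thesis by simp
  qed
  have "(\<Sum>k<m. ?\<delta> k) \<le> (\<Sum>k. ?\<delta> k)" by (rule sum_le_suminf) auto
  then have \<delta>: "(\<Sum>k<m. ?\<delta> k) \<le> ennreal (dyadic_series \<eta>)" unfolding suminf_dyadic[OF \<eta>] .
  have "(\<Sum>k<m. a k) = (\<Sum>k<m. epow (?u k) (1 / q) * epow (?\<delta> k) (1 - 1 / q))"
    by (intro sum.cong refl split)
  also have "\<dots> \<le> epow (\<Sum>k<m. ?u k) (1 / q) * epow (\<Sum>k<m. ?\<delta> k) (1 - 1 / q)"
    using q by (intro sum_Hoelder_epow) auto
  finally have "epow (\<Sum>k<m. a k) q \<le> epow (epow (\<Sum>k<m. ?u k) (1 / q) * epow (\<Sum>k<m. ?\<delta> k) (1 - 1 / q)) q"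
    using q by (intro epow_mono) auto
  also have "\<dots> = (\<Sum>k<m. ?u k) * epow (\<Sum>k<m. ?\<delta> k) (q - 1)"
    using q by (simp add: epow_mult epow_epow left_diff_distrib)
  also have "\<dots> \<le> (\<Sum>k<m. ennreal ((2 ^ k) powr (\<eta> * q)) * epow (a k) q) * epow (ennreal (dyadic_series \<eta>)) (q - 1)"
    using q \<eta> by (intro mult_mono epow_mono \<delta> sum_mono mult_right_mono ennreal_leI powr_mono) auto
  finally show ?thesis
    using dyadic_series_nonneg[OF \<eta>] by (simp add: epow_ennreal mult.commute)
qed

lemma bounded_L2_operator_integral_bound:
  assumes "bounded_L2_operator M S"
  obtains D :: ennreal where "D < top"
    "\<forall>f\<in>Lp_space 2 M. (\<integral>\<^sup>+x. epow (ennreal (cmod (S f x))) 2 \<partial>M) \<le> D * (\<integral>\<^sup>+x. epow (ennreal (cmod (f x))) 2 \<partial>M)"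
proof -
  obtain C :: real where C: "\<forall>f\<in>Lp_space 2 M. Lp_norm 2 M (S f) \<le> ennreal C * Lp_norm 2 M f"
    using assms unfolding bounded_L2_operator_def by blast
  show ?thesis
  proof (rule that[of "epow (ennreal C) 2"], simp, rule ballI)
    fix f assume "f \<in> Lp_space 2 M"
    with C have "epow (Lp_norm 2 M (S f)) 2 \<le> epow (ennreal C * Lp_norm 2 M f) 2"
      by (intro epow_mono) auto
    then show "(\<integral>\<^sup>+x. epow (ennreal (cmod (S f x))) 2 \<partial>M) \<le> epow (ennreal C) 2 * (\<integral>\<^sup>+x. epow (ennreal (cmod (f x))) 2 \<partial>M)"
      by (simp add: Lp_norm_epow epow_mult epow_epow)
  qed
qed

lemma bounded_L2_operator_add:
  "bounded_L2_operator M S \<Longrightarrow> f \<in> Lp_space 2 M \<Longrightarrow> g \<in> Lp_space 2 M \<Longrightarrow>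
    AE x in M. S (\<lambda>y. f y + g y) x = S f x + S g x"
  unfolding bounded_L2_operator_def by blast

lemma bounded_L2_operator_scale:
  "bounded_L2_operator M S \<Longrightarrow> f \<in> Lp_space 2 M \<Longrightarrow> AE x in M. S (\<lambda>y. a * f y) x = a * S f x"
  unfolding bounded_L2_operator_def by blast

lemma bounded_L2_operator_zero:
  assumes S: "bounded_L2_operator M S"
  shows "AE x in M. S (\<lambda>_. 0) x = 0"
proof -
  have "(\<lambda>_. 0) \<in> Lp_space 2 M" by (simp add: Lp_space_iff)
  from bounded_L2_operator_scale[OF S this, of 0] show ?thesis by simp
qed

lemma bounded_L2_operator_cut_sum:
  fixes A :: "nat \<Rightarrow> 'a set"
  assumes S: "bounded_L2_operator M S" and f: "f \<in> Lp_space 2 M"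
    and A: "\<And>k. A k \<in> sets M" "incseq A" "A 0 = {}"
  shows "AE x in M. S (\<lambda>y. indicator (A m) y * f y) x = (\<Sum>k<m. S (\<lambda>y. indicator (A (Suc k) - A k) y * f y) x)"
proof (induction m)
  case 0
  then show ?case using bounded_L2_operator_zero[OF S] A(3) by simp
next
  case (Suc m)
  have add: "(\<lambda>y. indicator (A (Suc m)) y * f y)
      = (\<lambda>y. indicator (A m) y * f y + indicator (A (Suc m) - A m) y * f y)"
    using incseq_SucD[OF A(2), of m] by (auto simp: indicator_def fun_eq_iff)
  have "AE x in M. S (\<lambda>y. indicator (A (Suc m)) y * f y) x
      = S (\<lambda>y. indicator (A m) y * f y) x + S (\<lambda>y. indicator (A (Suc m) - A m) y * f y) x"
    unfolding add using A(1) by (intro bounded_L2_operator_add[OF S] Lp_space_cut f) auto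
  with Suc.IH show ?case by eventually_elim simp
qed

text \<open>The off-diagonal estimates see only finitely many annuli at a time. The tails of \<open>f\<close> tend to 0 in
  \<open>L\<^sup>2\<close>, so do their images, and a subsequence of the images tends to 0 almost everywhere.\<close>

lemma bounded_L2_operator_exhaustion:
  fixes A :: "nat \<Rightarrow> 'a set"
  assumes S: "bounded_L2_operator M S" and f: "f \<in> Lp_space 2 M"
    and A[measurable]: "\<And>k. A k \<in> sets M" and "incseq A" "(\<Union>k. A k) = space M"
  obtains \<phi> where "strict_mono \<phi>" "AE x in M. (\<lambda>k. S (\<lambda>y. indicator (A (\<phi> k)) y * f y) x) \<longlonglongrightarrow> S f x"
proof -
  have [measurable]: "f \<in> borel_measurable M" and fin: "(\<integral>\<^sup>+x. epow (ennreal (cmod (f x))) 2 \<partial>M) < top"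
    using f by (simp_all add: Lp_space_iff)
  obtain D where D: "D < top"
    "\<forall>f\<in>Lp_space 2 M. (\<integral>\<^sup>+x. epow (ennreal (cmod (S f x))) 2 \<partial>M) \<le> D * (\<integral>\<^sup>+x. epow (ennreal (cmod (f x))) 2 \<partial>M)"
    by (rule bounded_L2_operator_integral_bound[OF S])
  have SL2: "S g \<in> Lp_space 2 M" if "g \<in> Lp_space 2 M" for g
    using S that unfolding bounded_L2_operator_def by blast
  define \<psi> where "\<psi> k = (\<lambda>y. indicator (space M - A k) y * f y)" for k
  have \<psi>: "\<psi> k \<in> Lp_space 2 M" for k
    unfolding \<psi>_def by (intro Lp_space_cut f) auto
  have [measurable]: "S (\<psi> k) \<in> borel_measurable M" for k
    using SL2[OF \<psi>] by (simp add: Lp_space_iff)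
  have \<psi>0: "(\<lambda>k. \<integral>\<^sup>+x. epow (ennreal (cmod (\<psi> k x))) 2 \<partial>M) \<longlonglongrightarrow> (\<integral>\<^sup>+x. 0 \<partial>M)"
  proof (rule nn_integral_dominated_convergence[where w = "\<lambda>x. epow (ennreal (cmod (f x))) 2"])
    show "AE x in M. (\<lambda>k. epow (ennreal (cmod (\<psi> k x))) 2) \<longlonglongrightarrow> 0"
    proof (rule AE_I2)
      fix x assume "x \<in> space M"
      then obtain k0 where "x \<in> A k0" using assms(5) by blast
      then have "x \<in> A k" if "k0 \<le> k" for k using \<open>incseq A\<close> that by (auto simp: incseq_def)
      then have "eventually (\<lambda>k. epow (ennreal (cmod (\<psi> k x))) 2 = 0) sequentially"
        unfolding eventually_sequentially by (intro exI[of _ k0]) (simp add: \<psi>_def)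
      then show "(\<lambda>k. epow (ennreal (cmod (\<psi> k x))) 2) \<longlonglongrightarrow> 0" by (rule tendsto_eventually)
    qed
    show "AE x in M. epow (ennreal (cmod (\<psi> k x))) 2 \<le> epow (ennreal (cmod (f x))) 2" for k
      by (intro AE_I2 epow_mono ennreal_leI) (auto simp: \<psi>_def indicator_def)
  qed (use fin in \<open>auto simp: \<psi>_def\<close>)
  define u where "u k x = (cmod (S (\<psi> k) x))\<^sup>2" for k x
  have [measurable]: "u k \<in> borel_measurable M" for k unfolding u_def by measurable
  have u_nn: "ennreal (u k x) = epow (ennreal (cmod (S (\<psi> k) x))) 2" for k x
    by (simp add: u_def epow_2 ennreal_power)
  have "(\<lambda>k. D * (\<integral>\<^sup>+x. epow (ennreal (cmod (\<psi> k x))) 2 \<partial>M)) \<longlonglongrightarrow> D * 0"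
    using \<psi>0 D(1) by (intro ennreal_tendsto_cmult) auto
  then have upper: "(\<lambda>k. D * (\<integral>\<^sup>+x. epow (ennreal (cmod (\<psi> k x))) 2 \<partial>M)) \<longlonglongrightarrow> 0" by simp
  have "(\<lambda>k. \<integral>\<^sup>+x. ennreal (u k x) \<partial>M) \<longlonglongrightarrow> 0"
  proof (rule tendsto_sandwich[OF _ _ tendsto_const upper])
    show "\<forall>\<^sub>F k in sequentially. (\<integral>\<^sup>+x. ennreal (u k x) \<partial>M) \<le> D * (\<integral>\<^sup>+x. epow (ennreal (cmod (\<psi> k x))) 2 \<partial>M)"
      unfolding u_nn by (intro always_eventually allI D(2)[rule_format] \<psi>)
  qed simp
  then have lim: "(\<lambda>k. enn2real (\<integral>\<^sup>+x. ennreal (u k x) \<partial>M)) \<longlonglongrightarrow> enn2real 0"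
    by (intro tendsto_enn2real) auto
  have int: "(\<integral>x. norm (u k x) \<partial>M) = enn2real (\<integral>\<^sup>+x. ennreal (u k x) \<partial>M)" for k
    by (subst integral_eq_nn_integral) (auto simp: u_def)
  have "integrable M (u k)" for k
  proof (rule integrableI_nonneg)
    show "(\<integral>\<^sup>+x. ennreal (u k x) \<partial>M) < \<infinity>"
      unfolding u_nn using SL2[OF \<psi>] by (simp add: Lp_space_iff)
  qed (auto simp: u_def)
  then obtain \<phi> where \<phi>: "strict_mono \<phi>" "AE x in M. (\<lambda>k. u (\<phi> k) x) \<longlonglongrightarrow> 0"
    using tendsto_L1_AE_subseq[of M u] lim unfolding int by auto
  have "AE x in M. \<forall>k. S f x = S (\<lambda>y. indicator (A k) y * f y) x + S (\<psi> k) x"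
    unfolding AE_all_countable
  proof
    fix k
    have add: "AE x in M. S (\<lambda>y. indicator (A k) y * f y + \<psi> k y) x = S (\<lambda>y. indicator (A k) y * f y) x + S (\<psi> k) x"
      by (intro bounded_L2_operator_add[OF S] Lp_space_cut f \<psi> A) simp
    have cong: "AE x in M. S f x = S g x" if "g \<in> Lp_space 2 M" "AE x in M. f x = g x" for g
      using S f that unfolding bounded_L2_operator_def by blast
    have glue: "indicator (A k) x * f x + \<psi> k x = f x" if "x \<in> space M" for x
      using that by (simp add: \<psi>_def indicator_def)
    have eq: "AE x in M. f x = indicator (A k) x * f x + \<psi> k x"
      using glue by (intro AE_I2) simp
    have "(\<lambda>y. indicator (A k) y * f y + \<psi> k y) \<in> Lp_space 2 M"
    proof -
      have "(\<lambda>y. indicator (A k) y * f y + \<psi> k y) \<in> borel_measurable M"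
        unfolding \<psi>_def by measurable
      moreover have "(\<integral>\<^sup>+x. epow (ennreal (cmod (indicator (A k) x * f x + \<psi> k x))) 2 \<partial>M)
          = (\<integral>\<^sup>+x. epow (ennreal (cmod (f x))) 2 \<partial>M)"
        using glue by (intro nn_integral_cong) simp
      ultimately show ?thesis using fin by (simp add: Lp_space_iff)
    qed
    from cong[OF this eq] add
    show "AE x in M. S f x = S (\<lambda>y. indicator (A k) y * f y) x + S (\<psi> k) x"
      by eventually_elim simp
  qed
  with \<phi>(2) have "AE x in M. (\<lambda>k. S (\<lambda>y. indicator (A (\<phi> k)) y * f y) x) \<longlonglongrightarrow> S f x"
  proof eventually_elim
    case (elim x)
    have "(\<lambda>k. sqrt (u (\<phi> k) x)) \<longlonglongrightarrow> sqrt 0"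
      using elim(1) by (intro tendsto_real_sqrt)
    then have "(\<lambda>k. S (\<psi> (\<phi> k)) x) \<longlonglongrightarrow> 0"
      by (simp add: u_def tendsto_norm_zero_iff)
    then have "(\<lambda>k. S f x - S (\<psi> (\<phi> k)) x) \<longlonglongrightarrow> S f x - 0"
      by (intro tendsto_diff tendsto_const)
    moreover have "S f x - S (\<psi> (\<phi> k)) x = S (\<lambda>y. indicator (A (\<phi> k)) y * f y) x" for k
      using elim(2) by (metis add_diff_cancel_right')
    ultimately show ?case by simp
  qed
  with \<phi>(1) show ?thesis by (rule that)
qed

lemma nn_integral_limit_bound:
  assumes [measurable]: "\<And>k. g k \<in> borel_measurable M" "B \<in> sets M"
    and lim: "AE x in M. (\<lambda>k. g k x) \<longlonglongrightarrow> (G x :: complex)" and q: "0 < q"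
    and le: "\<And>k. (\<integral>\<^sup>+x\<in>B. epow (ennreal (cmod (g k x))) q \<partial>M) \<le> Y"
  shows "(\<integral>\<^sup>+x\<in>B. epow (ennreal (cmod (G x))) q \<partial>M) \<le> Y"
proof -
  have "(\<integral>\<^sup>+x\<in>B. epow (ennreal (cmod (G x))) q \<partial>M)
      \<le> (\<integral>\<^sup>+x. liminf (\<lambda>k. epow (ennreal (cmod (g k x))) q * indicator B x) \<partial>M)"
  proof (rule nn_integral_mono_AE, use lim in eventually_elim)
    case (elim x)
    have "(\<lambda>k. epow (ennreal (cmod (g k x))) q * indicator B x) \<longlonglongrightarrow> epow (ennreal (cmod (G x))) q * indicator B x"
    proof (cases "x \<in> B")
      case True
      have "(\<lambda>k. ennreal (cmod (g k x) powr q)) \<longlonglongrightarrow> ennreal (cmod (G x) powr q)"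
        using elim q by (intro tendsto_ennrealI tendsto_powr2 tendsto_norm tendsto_const) auto
      with True show ?thesis by (simp add: epow_ennreal)
    qed simp
    then have "liminf (\<lambda>k. epow (ennreal (cmod (g k x))) q * indicator B x) = epow (ennreal (cmod (G x))) q * indicator B x"
      by (intro lim_imp_Liminf) auto
    then show ?case by simp
  qed
  also have "\<dots> \<le> liminf (\<lambda>k. \<integral>\<^sup>+x\<in>B. epow (ennreal (cmod (g k x))) q \<partial>M)"
    by (rule nn_integral_liminf) measurable
  also have "\<dots> \<le> liminf (\<lambda>k::nat. Y)"
    by (intro Liminf_mono always_eventually allI le)
  also have "\<dots> = Y" by (simp add: Liminf_const)
  finally show ?thesis .
qed

context regular_space
begin

text \<open>The annulus between the radii \<open>2^k r\<close> and \<open>2^(k+1) r\<close> has distance at least \<open>(2^k - 1) r\<close> from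
  \<open>B(x, r)\<close>, so the off-diagonal factor is at most \<open>2^(-\<gamma> k)\<close>. The finite sums over annuli are bounded
  uniformly, and Fatou's lemma passes to \<open>f\<close> itself, which is only known to be locally in \<open>L\<^sup>s\<close>.\<close>

lemma off_diagonal_imp_locally_dominated:
  assumes s: "0 < s" "s < 2" and q: "2 < q" and r: "0 < r" and \<gamma>: "0 \<le> \<gamma>" and \<eta>: "0 < \<eta>" and C0: "0 \<le> C0"
    and S: "bounded_L2_operator M S" and f: "f \<in> Lp_space 2 M"
    and OD: "\<And>f E F. f \<in> Lp_space s M \<Longrightarrow> f \<in> Lp_space 2 M \<Longrightarrow> E \<in> sets M \<Longrightarrow> F \<in> sets M \<Longrightarrow>
      Lp_norm q M (\<lambda>x. indicator F x * S (\<lambda>y. indicator E y * f y) x) \<le>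
      ennreal (C0 * v r powr (1 / q - 1 / s) * (1 + setdist E F / r) powr (- \<gamma>)) *
      Lp_norm s M (\<lambda>y. indicator E y * f y)"
  shows "locally_dominated (dyadic_series \<eta> powr ((q - 1) * (2 / q)) * C0\<^sup>2) s q (\<gamma> - \<eta>) r
           (\<lambda>x. ennreal (cmod (S f x))) (\<lambda>x. ennreal (cmod (f x)))"
  unfolding locally_dominated_def
proof
  fix x :: 'a
  have s0: "0 < s" and q0: "0 < q" "1 < q" using s q by auto
  have [measurable]: "f \<in> borel_measurable M" using f by (simp add: Lp_space_iff)
  have SL2: "S g \<in> Lp_space 2 M" if "g \<in> Lp_space 2 M" for g
    using S that unfolding bounded_L2_operator_def by blast
  \<comment> \<open>Starting with the empty set makes the first annulus the full ball of radius \<open>2 r\<close>.\<close>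
  define A where "A k = (if k = 0 then {} else ball x (2 ^ k * r))" for k :: nat
  have [measurable]: "A k \<in> sets M" for k by (simp add: A_def)
  have A_fin: "emeasure M (A k) < top" for k by (simp add: A_def emeasure_ball_finite)
  have A_Suc: "A (Suc k) = ball x (2 ^ (k + 1) * r)" for k by (simp add: A_def)
  have inc: "incseq A"
    using r by (intro incseq_SucI) (auto simp: A_def intro!: subset_ball)
  have A_UN: "(\<Union>k. A k) = space M"
  proof -
    have "\<exists>k. y \<in> A k" for y
    proof -
      obtain k where "dist x y / r < 2 ^ k" using real_arch_pow[of 2 "dist x y / r"] by auto
      also have "(2::real) ^ k \<le> 2 ^ (Suc k)" by simp
      finally have "dist x y < 2 ^ (Suc k) * r" using r by (simp add: divide_less_eq)
      then have "y \<in> A (Suc k)" by (simp add: A_Suc)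
      then show ?thesis ..
    qed
    then show ?thesis by auto
  qed
  let ?B = "ball x r"
  define fk where "fk k = (\<lambda>y. indicator (A (Suc k) - A k) y * f y)" for k
  have fk2: "fk k \<in> Lp_space 2 M" for k
    unfolding fk_def by (intro Lp_space_cut f) auto
  have [measurable]: "S (fk k) \<in> borel_measurable M" for k
    using SL2[OF fk2] by (simp add: Lp_space_iff)
  define I where "I k = (\<integral>\<^sup>+y\<in>?B. epow (ennreal (cmod (S (fk k) y))) q \<partial>M)" for k
  define N where "N k = (\<integral>\<^sup>+y\<in>ball x (2 ^ (k + 1) * r). epow (ennreal (cmod (f y))) s \<partial>M)" for k :: nat
  have I_le: "epow (I k) (2 / q) \<le> ennreal (C0\<^sup>2 * v r powr (2 / q - 2 / s) * (2 ^ k) powr (- 2 * \<gamma>)) * epow (N k) (2 / s)" for k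
  proof -
    let ?E = "A (Suc k) - A k"
    define f' where "f' = (\<lambda>y. indicator (A (Suc k)) y * f y)"
    have f': "f' \<in> Lp_space s M" "f' \<in> Lp_space 2 M"
      unfolding f'_def by (intro Lp_space_2_cut_finite_measure s0 s(2) f A_fin, simp) (intro Lp_space_cut f, auto)
    have cut: "(\<lambda>y. indicator ?E y * f' y) = fk k"
      by (auto simp: f'_def fk_def indicator_def fun_eq_iff)
    have Eint: "Lp_norm s M (fk k) = epow (\<integral>\<^sup>+y\<in>?E. epow (ennreal (cmod (f y))) s \<partial>M) (1 / s)"
      using s0 by (simp add: Lp_norm_epow fk_def)
        (intro arg_cong2[where f = epow] nn_integral_cong refl, auto simp: indicator_def)
    have Fint: "Lp_norm q M (\<lambda>y. indicator ?B y * S (fk k) y) = epow (I k) (1 / q)"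
      using q0 by (simp add: Lp_norm_epow I_def)
        (intro arg_cong2[where f = epow] nn_integral_cong refl, auto simp: indicator_def)
    have OD': "epow (I k) (1 / q) \<le> ennreal (C0 * v r powr (1 / q - 1 / s) * (1 + setdist ?E ?B / r) powr (- \<gamma>)) * Lp_norm s M (fk k)"
      using OD[OF f', of ?E ?B] unfolding cut Fint by simp
    have "epow (I k) (1 / q) \<le> ennreal (C0 * v r powr (1 / q - 1 / s) * (2 ^ k) powr (- \<gamma>)) * epow (N k) (1 / s)"
    proof (cases "?E = {}")
      case True
      then have "Lp_norm s M (fk k) = 0" unfolding Eint True by simp
      with OD' show ?thesis by simp
    next
      case False
      have "(2 ^ k - 1) * r \<le> setdist ?E ?B"
      proof (rule le_setdistI)
        fix y z assume yz: "y \<in> ?E" "z \<in> ?B"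
        show "(2 ^ k - 1) * r \<le> dist y z"
        proof (cases "k = 0")
          case False
          then have "2 ^ k * r \<le> dist x y" "dist x z < r" using yz by (auto simp: A_def)
          then show ?thesis
            using dist_triangle[of x y z] by (simp add: left_diff_distrib dist_commute)
        qed simp
      qed (use False r in auto)
      then have "2 ^ k \<le> 1 + setdist ?E ?B / r" using r by (simp add: field_simps)
      then have "(1 + setdist ?E ?B / r) powr (- \<gamma>) \<le> (2 ^ k) powr (- \<gamma>)"
        using \<gamma> by (intro powr_mono2') auto
      moreover have "Lp_norm s M (fk k) \<le> epow (N k) (1 / s)"
        unfolding Eint N_def using s0
        by (intro epow_mono nn_integral_mono mult_left_mono) (auto simp: indicator_def A_Suc)
      ultimately show ?thesis
        using C0 by (intro order_trans[OF OD'] mult_mono ennreal_leI mult_left_mono) auto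
    qed
    then have "epow (epow (I k) (1 / q)) 2 \<le> epow (ennreal (C0 * v r powr (1 / q - 1 / s) * (2 ^ k) powr (- \<gamma>)) * epow (N k) (1 / s)) 2"
      by (intro epow_mono) auto
    also have "\<dots> = ennreal ((C0 * v r powr (1 / q - 1 / s) * (2 ^ k) powr (- \<gamma>)) powr 2) * epow (N k) (2 / s)"
      using C0 by (simp add: epow_mult epow_epow epow_ennreal)
    also have "(C0 * v r powr (1 / q - 1 / s) * (2 ^ k) powr (- \<gamma>)) powr 2 = C0\<^sup>2 * v r powr (2 / q - 2 / s) * (2 ^ k) powr (- 2 * \<gamma>)"
    proof -
      have "(v r powr (1 / q - 1 / s)) powr 2 = v r powr (2 / q - 2 / s)"
        by (simp add: powr_powr left_diff_distrib)
      moreover have "((2 ^ k :: real) powr (- \<gamma>)) powr 2 = (2 ^ k) powr (- 2 * \<gamma>)"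
        by (simp add: powr_powr mult.commute)
      ultimately show ?thesis using C0 by (simp only: powr_mult mult_nonneg_nonneg powr_ge_zero) simp
    qed
    finally show ?thesis by (simp add: epow_epow)
  qed
  let ?K = "dyadic_series \<eta> powr ((q - 1) * (2 / q)) * C0\<^sup>2"
  let ?Y = "ennreal (?K * v r powr (2 / q - 2 / s)) * (\<Sum>k. ennreal ((2 ^ k) powr (- 2 * (\<gamma> - \<eta>))) * epow (N k) (2 / s))"
  define \<phi> where "\<phi> m = (\<lambda>y. indicator (A m) y * f y)" for m
  have \<phi>2: "\<phi> m \<in> Lp_space 2 M" for m
    unfolding \<phi>_def by (intro Lp_space_cut f) auto
  have partial: "(\<integral>\<^sup>+y\<in>?B. epow (ennreal (cmod (S (\<phi> m) y))) q \<partial>M) \<le> epow ?Y (q / 2)" for m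
  proof -
    have "AE y in M. S (\<phi> m) y = (\<Sum>k<m. S (fk k) y)"
      unfolding \<phi>_def fk_def by (rule bounded_L2_operator_cut_sum[OF S f _ inc]) (auto simp: A_def)
    then have "(\<integral>\<^sup>+y\<in>?B. epow (ennreal (cmod (S (\<phi> m) y))) q \<partial>M)
        \<le> (\<integral>\<^sup>+y. ennreal (dyadic_series \<eta> powr (q - 1)) *
             (\<Sum>k<m. ennreal ((2 ^ k) powr (\<eta> * q)) * (epow (ennreal (cmod (S (fk k) y))) q * indicator ?B y)) \<partial>M)"
    proof (intro nn_integral_mono_AE, eventually_elim)
      case (elim y)
      have "ennreal (cmod (S (\<phi> m) y)) \<le> (\<Sum>k<m. ennreal (cmod (S (fk k) y)))"
        unfolding elim by (simp add: norm_sum sum_nonneg)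
      then have "epow (ennreal (cmod (S (\<phi> m) y))) q \<le> epow (\<Sum>k<m. ennreal (cmod (S (fk k) y))) q"
        using q0 by (intro epow_mono) auto
      also have "\<dots> \<le> ennreal (dyadic_series \<eta> powr (q - 1)) * (\<Sum>k<m. ennreal ((2 ^ k) powr (\<eta> * q)) * epow (ennreal (cmod (S (fk k) y))) q)"
        by (rule sum_powr_le_dyadic[OF q0(2) \<eta>])
      finally show ?case by (auto simp: indicator_def)
    qed
    also have "\<dots> = ennreal (dyadic_series \<eta> powr (q - 1)) * (\<Sum>k<m. ennreal ((2 ^ k) powr (\<eta> * q)) * I k)"
      unfolding I_def by (simp add: nn_integral_cmult nn_integral_sum)
    finally have "epow (\<integral>\<^sup>+y\<in>?B. epow (ennreal (cmod (S (\<phi> m) y))) q \<partial>M) (2 / q)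
        \<le> epow (ennreal (dyadic_series \<eta> powr (q - 1)) * (\<Sum>k<m. ennreal ((2 ^ k) powr (\<eta> * q)) * I k)) (2 / q)"
      using q0 by (intro epow_mono) auto
    also have "\<dots> \<le> ennreal (dyadic_series \<eta> powr ((q - 1) * (2 / q))) * (\<Sum>k<m. epow (ennreal ((2 ^ k) powr (\<eta> * q)) * I k) (2 / q))"
      unfolding epow_mult[of _ "\<Sum>k<m. _ k"] using q
      by (intro mult_mono epow_sum_le) (auto simp: epow_ennreal powr_powr)
    also have "\<dots> \<le> ennreal (dyadic_series \<eta> powr ((q - 1) * (2 / q))) *
        (\<Sum>k<m. ennreal (C0\<^sup>2 * v r powr (2 / q - 2 / s)) * (ennreal ((2 ^ k) powr (- 2 * (\<gamma> - \<eta>))) * epow (N k) (2 / s)))"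
    proof (intro mult_left_mono sum_mono)
      fix k
      have "epow (ennreal ((2 ^ k) powr (\<eta> * q)) * I k) (2 / q) = ennreal ((2 ^ k) powr (2 * \<eta>)) * epow (I k) (2 / q)"
        using q0 by (simp add: epow_mult epow_ennreal powr_powr mult.commute)
      also have "\<dots> \<le> ennreal ((2 ^ k) powr (2 * \<eta>)) * (ennreal (C0\<^sup>2 * v r powr (2 / q - 2 / s) * (2 ^ k) powr (- 2 * \<gamma>)) * epow (N k) (2 / s))"
        by (intro mult_left_mono I_le) simp
      also have "\<dots> = ennreal (C0\<^sup>2 * v r powr (2 / q - 2 / s)) * (ennreal ((2 ^ k) powr (2 * \<eta>) * (2 ^ k) powr (- 2 * \<gamma>)) * epow (N k) (2 / s))"
        by (simp only: ennreal_mult powr_ge_zero mult_nonneg_nonneg zero_le_power2) (simp only: mult_ac)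
      also have "(2 ^ k :: real) powr (2 * \<eta>) * (2 ^ k) powr (- 2 * \<gamma>) = (2 ^ k) powr (- 2 * (\<gamma> - \<eta>))"
        by (simp add: powr_add[symmetric] algebra_simps)
      finally show "epow (ennreal ((2 ^ k) powr (\<eta> * q)) * I k) (2 / q)
          \<le> ennreal (C0\<^sup>2 * v r powr (2 / q - 2 / s)) * (ennreal ((2 ^ k) powr (- 2 * (\<gamma> - \<eta>))) * epow (N k) (2 / s))" .
    qed simp
    also have "\<dots> = ennreal (?K * v r powr (2 / q - 2 / s)) * (\<Sum>k<m. ennreal ((2 ^ k) powr (- 2 * (\<gamma> - \<eta>))) * epow (N k) (2 / s))"
      unfolding sum_distrib_left[symmetric]
      by (simp only: ennreal_mult powr_ge_zero mult_nonneg_nonneg zero_le_power2) (simp only: mult_ac)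
    also have "\<dots> \<le> ?Y"
      by (intro mult_left_mono sum_le_suminf) auto
    finally have le: "epow (\<integral>\<^sup>+y\<in>?B. epow (ennreal (cmod (S (\<phi> m) y))) q \<partial>M) (2 / q) \<le> ?Y" .
    have pos: "0 < 2 / q" and inv: "1 / (2 / q) = q / 2" using q0 by auto
    show ?thesis using epow_le_cancel[OF le pos] unfolding inv .
  qed
  obtain \<theta> where "strict_mono \<theta>" and lim: "AE y in M. (\<lambda>k. S (\<phi> (\<theta> k)) y) \<longlonglongrightarrow> S f y"
    unfolding \<phi>_def by (rule bounded_L2_operator_exhaustion[OF S f _ inc A_UN]) auto
  have "(\<integral>\<^sup>+y\<in>?B. epow (ennreal (cmod (S f y))) q \<partial>M) \<le> epow ?Y (q / 2)"
    using SL2[OF \<phi>2] by (intro nn_integral_limit_bound[OF _ _ lim q0(1) partial]) (auto simp: Lp_space_iff)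
  then have "epow (\<integral>\<^sup>+y\<in>?B. epow (ennreal (cmod (S f y))) q \<partial>M) (2 / q) \<le> epow (epow ?Y (q / 2)) (2 / q)"
    using q0 by (intro epow_mono) auto
  then show "epow (\<integral>\<^sup>+y\<in>?B. epow (ennreal (cmod (S f y))) q \<partial>M) (2 / q) \<le> ennreal (?K * v r powr (2 / q - 2 / s)) *
        (\<Sum>k. ennreal ((2 ^ k) powr (- 2 * (\<gamma> - \<eta>))) *
               epow (\<integral>\<^sup>+y\<in>ball x (2 ^ (k + 1) * r). epow (ennreal (cmod (f y))) s \<partial>M) (2 / s))"
    unfolding N_def using q0 by (simp add: epow_epow)
qed

end

section \<open>Square function estimates\<close>

lemma diam_cap_pos:
  assumes "0 < ediameter X" "0 < r"
  shows "0 < diam_cap X r"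
  using assms by (auto simp: diam_cap_def enn2real_positive_iff min_less_iff_disj)

lemma diam_cap_scale:
  assumes "1 \<le> L" "0 < r"
  shows "diam_cap X (L * r) \<le> L * diam_cap X r"
proof -
  have le: "min (ennreal (L * r)) (ediameter X) \<le> ennreal L * min (ennreal r) (ediameter X)"
  proof (cases "ennreal r \<le> ediameter X")
    case True
    then show ?thesis using assms by (simp add: min_absorb1 ennreal_mult min.coboundedI1)
  next
    case False
    have "1 * ediameter X \<le> ennreal L * ediameter X"
      using assms by (intro mult_right_mono) auto
    with False show ?thesis by (simp add: min_absorb2 min.coboundedI2)
  qed
  have "ennreal L * min (ennreal r) (ediameter X) < top"
    by (simp add: ennreal_mult_less_top min_less_iff_disj)
  from enn2real_mono[OF le this]
  have "diam_cap X (L * r) \<le> enn2real (ennreal L * min (ennreal r) (ediameter X))"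
    unfolding diam_cap_def .
  then show ?thesis using assms by (simp add: diam_cap_def enn2real_mult)
qed

lemma n_regular_imp_regular_space:
  fixes M :: "'a::metric_space measure"
  assumes "0 < n" "n_regular n M"
  obtains c C where "regular_space M (\<lambda>r. diam_cap (UNIV :: 'a set) r powr n) n c C"
proof -
  have sets: "sets M = sets borel" using assms by (simp add: n_regular_def)
  then have sp: "space M = UNIV" using sets_eq_imp_space_eq by fastforce
  obtain c C :: real where cC: "0 < c" "0 < C"
    "\<forall>x::'a. \<forall>r>0. ennreal (c * diam_cap (UNIV :: 'a set) r powr n) \<le> emeasure M (ball x r) \<and>
        emeasure M (ball x r) \<le> ennreal (C * diam_cap (UNIV :: 'a set) r powr n)"
    and ed: "0 < ediameter (UNIV :: 'a set)"
    using assms(2) unfolding n_regular_def sp by auto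
  show ?thesis
  proof (rule that[of c C], unfold_locales)
    fix r L :: real assume r: "0 < r" and L: "1 \<le> L"
    have "0 \<le> diam_cap (UNIV :: 'a set) (L * r)" by (simp add: diam_cap_def)
    then have "diam_cap (UNIV :: 'a set) (L * r) powr n \<le> (L * diam_cap (UNIV :: 'a set) r) powr n"
      using assms(1) diam_cap_scale[OF L r] by (intro powr_mono2) auto
    also have "\<dots> = L powr n * diam_cap (UNIV :: 'a set) r powr n"
      using L by (simp add: powr_mult diam_cap_def)
    finally show "diam_cap (UNIV :: 'a set) (L * r) powr n \<le> L powr n * diam_cap (UNIV :: 'a set) r powr n" .
  qed (use cC sets assms(1) diam_cap_pos[OF ed] in \<open>auto simp: less_imp_neq[symmetric]\<close>)
qed

theorem proposition5p8:
  fixes n s q p \<gamma> :: real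
    and M :: "'a::metric_space measure"
    and U :: "complex set"
    and T :: "complex \<Rightarrow> ('a \<Rightarrow> complex) \<Rightarrow> ('a \<Rightarrow> complex)"
  assumes "0 < n"
    and "n_regular n M"
    and "1 \<le> s" and "s < 2" and "2 < q"
    and "s < p" and "p < q"
    and "U \<subseteq> UNIV - {0}"
    and "\<And>z. z \<in> U \<Longrightarrow> bounded_L2_operator M (T z)"
    and "n / s < \<gamma>"
    and "off_diagonal_estimates n M s q \<gamma> U T"
  shows "square_function_estimates M p U T"
proof -
  define v where "v r = diam_cap (UNIV :: 'a set) r powr n" for r
  obtain c C where "regular_space M v n c C"
    unfolding v_def using n_regular_imp_regular_space[OF assms(1,2)] .
  then interpret regular_space M v n c C .
  have p: "0 < p" and s: "0 < s" using assms by auto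
  obtain C0 where C0: "0 \<le> C0" and \<gamma>: "0 \<le> \<gamma>" and
    OD: "\<forall>z\<in>U. \<forall>f\<in>Lp_space s M \<inter> Lp_space 2 M. \<forall>E\<in>sets M. \<forall>F\<in>sets M.
           Lp_norm q M (\<lambda>x. indicator F x * T z (\<lambda>y. indicator E y * f y) x) \<le>
           ennreal (C0 * diam_cap (UNIV :: 'a set) (cmod z) powr (n / q - n / s)
                      * (1 + setdist E F / cmod z) powr (- \<gamma>))
           * Lp_norm s M (\<lambda>y. indicator E y * f y)"
    using assms(11) unfolding off_diagonal_estimates_def space_M by blast
  \<comment> \<open>Half of the excess of \<open>\<gamma>\<close> over \<open>n/s\<close> pays for the summation of the annuli; the other half is left for the sum over the net.\<close>
  define \<eta> where "\<eta> = (\<gamma> - n / s) / 2"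
  have \<eta>: "0 < \<eta>" and \<kappa>: "n / s < \<gamma> - \<eta>"
  proof -
    have mid: "x < y - (y - x) / 2" if "x < y" for x y :: real
      using that by (simp add: field_simps)
    show "0 < \<eta>" "n / s < \<gamma> - \<eta>"
      using assms(10) mid[OF assms(10)] by (simp_all add: \<eta>_def)
  qed
  \<comment> \<open>The constant \<open>C0\<close> may be 0 and is enlarged, since the argument for \<open>p < 2\<close> uses \<open>K > 0\<close>.\<close>
  define K where "K = dyadic_series \<eta> powr ((q - 1) * (2 / q)) * (C0 + 1)\<^sup>2"
  have K: "0 < K" using dyadic_series_pos[OF \<eta>] C0 by (simp add: K_def)
  have dom: "locally_dominated K s q (\<gamma> - \<eta>) (cmod z) (\<lambda>x. ennreal (cmod (T z f x))) (\<lambda>x. ennreal (cmod (f x)))"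
    if z: "z \<in> U" and f: "f \<in> Lp_space 2 M" for z f
    unfolding K_def
  proof (rule off_diagonal_imp_locally_dominated[OF s assms(4,5) _ \<gamma> \<eta> _ assms(9)[OF z] f])
    show "0 < cmod z" using z assms(8) by auto
    show "0 \<le> C0 + 1" using C0 by simp
    fix f E F assume "f \<in> Lp_space s M" "f \<in> Lp_space 2 M" "E \<in> sets M" "F \<in> sets M"
    then have "Lp_norm q M (\<lambda>x. indicator F x * T z (\<lambda>y. indicator E y * f y) x) \<le>
           ennreal (C0 * diam_cap (UNIV :: 'a set) (cmod z) powr (n / q - n / s)
                      * (1 + setdist E F / cmod z) powr (- \<gamma>))
           * Lp_norm s M (\<lambda>y. indicator E y * f y)"
      by (intro OD[rule_format] z IntI)
    also have "diam_cap (UNIV :: 'a set) (cmod z) powr (n / q - n / s) = v (cmod z) powr (1 / q - 1 / s)"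
      by (simp add: v_def powr_powr right_diff_distrib)
    also have "ennreal (C0 * v (cmod z) powr (1 / q - 1 / s) * (1 + setdist E F / cmod z) powr (- \<gamma>))
        \<le> ennreal ((C0 + 1) * v (cmod z) powr (1 / q - 1 / s) * (1 + setdist E F / cmod z) powr (- \<gamma>))"
      by (intro ennreal_leI mult_right_mono) auto
    finally show "Lp_norm q M (\<lambda>x. indicator F x * T z (\<lambda>y. indicator E y * f y) x) \<le>
           ennreal ((C0 + 1) * v (cmod z) powr (1 / q - 1 / s) * (1 + setdist E F / cmod z) powr (- \<gamma>))
           * Lp_norm s M (\<lambda>y. indicator E y * f y)"
      by (simp add: mult_right_mono)
  qed
  have norm_sq: "Lp_norm p M (\<lambda>x. sqrt (\<Sum>j=1..k. (cmod (h j x))\<^sup>2))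
      = epow (\<integral>\<^sup>+x. epow (\<Sum>j\<in>{1..k}. epow (ennreal (cmod (h j x))) 2) (p / 2) \<partial>M) (1 / p)" for k :: nat and h
  proof -
    have "epow (ennreal (norm (sqrt (\<Sum>j=1..k. (cmod (h j x))\<^sup>2)))) p
        = epow (\<Sum>j\<in>{1..k}. epow (ennreal (cmod (h j x))) 2) (p / 2)" for x
    proof -
      have nn: "0 \<le> (\<Sum>j=1..k. (cmod (h j x))\<^sup>2)" by (intro sum_nonneg) auto
      have "(\<Sum>j\<in>{1..k}. epow (ennreal (cmod (h j x))) 2) = ennreal (\<Sum>j=1..k. (cmod (h j x))\<^sup>2)"
        by (simp add: epow_2 ennreal_power)
      then show ?thesis
        using nn by (simp add: epow_ennreal powr_half_sqrt[symmetric] powr_powr)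
    qed
    then show ?thesis using p by (simp add: Lp_norm_epow)
  qed
  show ?thesis
  proof (rule square_function_bound[OF s assms(4,5) \<kappa> K assms(6,7)])
    fix \<Gamma> :: real
    assume \<Gamma>: "0 \<le> \<Gamma>"
    "\<And>(J :: nat set) r f g. finite J \<Longrightarrow> (\<And>j. j \<in> J \<Longrightarrow> 0 < r j) \<Longrightarrow>
       (\<And>j. j \<in> J \<Longrightarrow> f j \<in> borel_measurable M) \<Longrightarrow> (\<And>j. j \<in> J \<Longrightarrow> g j \<in> borel_measurable M) \<Longrightarrow>
       (\<And>j x. j \<in> J \<Longrightarrow> f j x < top) \<Longrightarrow> (\<And>j x. j \<in> J \<Longrightarrow> g j x < top) \<Longrightarrow>
       (\<And>j. j \<in> J \<Longrightarrow> locally_dominated K s q (\<gamma> - \<eta>) (r j) (g j) (f j)) \<Longrightarrow>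
       (\<integral>\<^sup>+x. epow (\<Sum>j\<in>J. epow (g j x) 2) (p / 2) \<partial>M)
         \<le> ennreal \<Gamma> * (\<integral>\<^sup>+x. epow (\<Sum>j\<in>J. epow (f j x) 2) (p / 2) \<partial>M)"
    show ?thesis
      unfolding square_function_estimates_def
    proof (intro exI[of _ "\<Gamma> powr (1 / p)"] conjI allI impI)
      fix k :: nat and z :: "nat \<Rightarrow> complex" and f :: "nat \<Rightarrow> 'a \<Rightarrow> complex"
      assume zf: "\<forall>j\<in>{1..k}. z j \<in> U \<and> f j \<in> Lp_space p M \<inter> Lp_space 2 M"
      have TL2: "T (z j) (f j) \<in> Lp_space 2 M" if "j \<in> {1..k}" for j
        using assms(9)[of "z j"] zf that unfolding bounded_L2_operator_def by blast
      have "(\<integral>\<^sup>+x. epow (\<Sum>j\<in>{1..k}. epow (ennreal (cmod (T (z j) (f j) x))) 2) (p / 2) \<partial>M)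
          \<le> ennreal \<Gamma> * (\<integral>\<^sup>+x. epow (\<Sum>j\<in>{1..k}. epow (ennreal (cmod (f j x))) 2) (p / 2) \<partial>M)"
      proof (rule \<Gamma>(2)[where r = "\<lambda>j. cmod (z j)"])
        fix j assume j: "j \<in> {1..k}"
        then have zj: "z j \<in> U" "f j \<in> Lp_space 2 M" using zf by auto
        show "0 < cmod (z j)" using zj(1) assms(8) by auto
        have "f j \<in> borel_measurable M" "T (z j) (f j) \<in> borel_measurable M"
          using zj(2) TL2[OF j] by (simp_all add: Lp_space_iff)
        then show "(\<lambda>x. ennreal (cmod (f j x))) \<in> borel_measurable M"
          "(\<lambda>x. ennreal (cmod (T (z j) (f j) x))) \<in> borel_measurable M" by measurable
        show "locally_dominated K s q (\<gamma> - \<eta>) (cmod (z j)) (\<lambda>x. ennreal (cmod (T (z j) (f j) x))) (\<lambda>x. ennreal (cmod (f j x)))"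
          by (rule dom[OF zj])
      qed auto
      then have "epow (\<integral>\<^sup>+x. epow (\<Sum>j\<in>{1..k}. epow (ennreal (cmod (T (z j) (f j) x))) 2) (p / 2) \<partial>M) (1 / p)
          \<le> epow (ennreal \<Gamma> * (\<integral>\<^sup>+x. epow (\<Sum>j\<in>{1..k}. epow (ennreal (cmod (f j x))) 2) (p / 2) \<partial>M)) (1 / p)"
        using p by (intro epow_mono) auto
      then show "Lp_norm p M (\<lambda>x. sqrt (\<Sum>j=1..k. (cmod (T (z j) (f j) x))\<^sup>2)) \<le>
             ennreal (\<Gamma> powr (1 / p)) * Lp_norm p M (\<lambda>x. sqrt (\<Sum>j=1..k. (cmod (f j x))\<^sup>2))"
        unfolding norm_sq using \<Gamma>(1) by (simp add: epow_mult epow_ennreal)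
    qed simp
  qed
qed

end
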